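(* Let $d,T\ge 1$ be integers and $1\le p<\infty$. Let $\xi\in\mathcal P_p((\mathbb R^d)^T)$ be a noise distribution satisfying: (i) $\xi$ has a continuously differentiable density $f:(\mathbb R^d)^T\to\mathbb R$ with $\nabla f\in L^1$; (ii) the set of real zeros of $\widehat f$ has Lebesgue measure zero. Let $\mu\in\mathcal P_p((\mathbb R^d)^T)$. Then for any $\sigma>0$, $$\mathcal{AW}_p(\mu,\mu^\sigma)\le T\left(1\vee (M_p(\xi))^{1/p}\right)\sum_{t=0}^{T-1}h^{t,p}_\mu(\sigma),$$ where $h^{0,p}_\mu(\sigma)=\sigma$ and $h^{t,p}_\mu(\sigma)=\omega^{t,p}_\mu\left(\sum_{s=0}^{t-1}h^{s,p}_\mu(\sigma)\right)$ for $t\in\{1,\dots,T-1\}$.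
   Context: $|\cdot|$ is the Euclidean norm. $\mathcal P_p(\mathbb R^N)$ is the set of Borel probability measures on $\mathbb R^N$ with finite $p$-th moment; $M_p(\mu)=\int|x|^p\mu(dx)$. $\mathcal W_p(\mu,\nu)=(\inf_{\pi\in\mathrm{Cpl}(\mu,\nu)}\int|x-y|^p\,d\pi)^{1/p}$, with $\mathrm{Cpl}(\mu,\nu)$ the set of couplings. For $x\in(\mathbb R^d)^T$, $x_{1:t}=(x_1,\dots,x_t)$. A coupling $\pi$ of $\mu,\nu\in\mathcal P((\mathbb R^d)^T)$ is bicausal if for $(X,Y)\sim\pi$ and every $t\in\{1,\dots,T-1\}$: $Y_{1:t}$ and $(X_{t+1},\dots,X_T)$ are conditionally independent given $X_{1:t}$, and $X_{1:t}$ and $(Y_{t+1},\dots,Y_T)$ are conditionally independent given $Y_{1:t}$; $\mathrm{Cpl}_{bc}(\mu,\nu)$ is the set of bicausal couplings. $\mathcal{AW}_p(\mu,\nu)=\left(\inf_{\pi\in\mathrm{Cpl}_{bc}(\mu,\nu)}\int\sum_{t=1}^T|x_t-y_t|^p\,\pi(dx,dy)\right)^{1/p}$. $\xi_\sigma$ is the law of $\sigma Z$ with $Z\sim\xi$, and $\mu^\sigma:=\mu\ast\xi_\sigma$. $\widehat f(s)=\int e^{-2\pi i s\cdot x}f(x)\,dx$. For $X\sim\mu$, $\mu_{x_{1:t}}\in\mathcal P(\mathbb R^d)$ denotes the regular conditional law $\mathbb P(X_{t+1}\in\cdot\mid X_{1:t}=x_{1:t})$. The $p$-modulus of continuity of $\mu$,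 for $t\in\{1,\dots,T-1\}$ and $\delta>0$, is $\omega^{t,p}_\mu(\delta)=\sup\left\{(\mathbb E[\mathcal W_p(\mu_{X_{1:t}},\mu_{Y_{1:t}})^p])^{1/p}: X,Y\sim\mu,\ (\mathbb E[|X_{1:t}-Y_{1:t}|^p])^{1/p}<\delta\right\}$, the supremum being over all jointly defined pairs $(X,Y)$ with both marginal laws $\mu$. *)

theory Defs
  imports "HOL-Probability.Probability"
begin

section \<open>Moments, couplings and Wasserstein distance\<close>

text \<open>Distances, moments and moduli take values in \<^typ>\<open>ennreal\<close>, so that no integrability side
  conditions are hidden in the definitions. \<open>epowr\<close> is only used with exponents \<open>r > 0\<close>.\<close>

definition epowr :: "ennreal \<Rightarrow> real \<Rightarrow> ennreal" where
  "epowr x r = (if x = \<top> then \<top> else ennreal (enn2real x powr r))"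

definition moment :: "real \<Rightarrow> 'a::euclidean_space measure \<Rightarrow> ennreal" where
  "moment p \<mu> = (\<integral>\<^sup>+x. ennreal (norm x powr p) \<partial>\<mu>)"

definition prob_moment :: "real \<Rightarrow> 'a::euclidean_space measure set" where
  "prob_moment p = {\<mu>. prob_space \<mu> \<and> sets \<mu> = sets borel \<and> moment p \<mu> < \<top>}"

definition couplings ::
  "'a::euclidean_space measure \<Rightarrow> 'a measure \<Rightarrow> ('a \<times> 'a) measure set" where
  "couplings \<mu> \<nu> = {\<pi>. sets \<pi> = sets (borel \<Otimes>\<^sub>M borel) \<and>
     distr \<pi> borel fst = \<mu> \<and> distr \<pi> borel snd = \<nu>}"

definition wasserstein :: "real \<Rightarrow> 'a::euclidean_space measure \<Rightarrow> 'a measure \<Rightarrow> ennreal" where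
  "wasserstein p \<mu> \<nu> =
     epowr (INF \<pi>\<in>couplings \<mu> \<nu>. \<integral>\<^sup>+(x, y). ennreal (norm (x - y) powr p) \<partial>\<pi>) (1 / p)"

section \<open>Paths\<close>

text \<open>A path in \<open>(\<real>\<^sup>d)\<^sup>T\<close> is an element of \<open>((real, 'd) vec, 'n) vec\<close>, where the finite linear order
  \<^typ>\<open>'n\<close> plays the role of \<open>{1..T}\<close> and \<open>T = CARD('n)\<close>; \<open>time_pt t\<close> is its \<open>t\<close>-th smallest
  element, \<open>1 \<le> t \<le> T\<close>.

  The initial segment \<open>x\<^bsub>1:t\<^esub>\<close> and the remainder \<open>(x\<^bsub>t+1\<^esub>, \<dots>, x\<^bsub>T\<^esub>)\<close> are embedded
  isometrically into the full path space by setting the other coordinates to zero. They are only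
  used for \<open>1 \<le> t \<le> T - 1\<close>.\<close>

type_synonym ('d, 'n) path = "((real, 'd) vec, 'n) vec"

definition time_pt :: "nat \<Rightarrow> 'n::{finite,linorder}" where
  "time_pt t = sorted_list_of_set UNIV ! (t - 1)"

definition init_seg :: "nat \<Rightarrow> ('d::finite, 'n::{finite,linorder}) path \<Rightarrow> ('d, 'n) path" where
  "init_seg t x = (\<chi> i. if i \<le> time_pt t then x $ i else 0)"

definition final_seg :: "nat \<Rightarrow> ('d::finite, 'n::{finite,linorder}) path \<Rightarrow> ('d, 'n) path" where
  "final_seg t x = (\<chi> i. if time_pt t < i then x $ i else 0)"

lemma bij_betw_time_pt:
  "bij_betw (time_pt :: nat \<Rightarrow> 'n::{finite,linorder}) {1..CARD('n)} UNIV"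
proof -
  have "bij_betw (\<lambda>t. t - 1) {1..CARD('n)} {..<CARD('n)}"
    by (rule bij_betw_byWitness[where f' = Suc]) auto
  moreover have "bij_betw ((!) (sorted_list_of_set (UNIV :: 'n set))) {..<CARD('n)} UNIV"
    by (rule bij_betw_nth) auto
  ultimately have "bij_betw ((!) (sorted_list_of_set (UNIV :: 'n set)) \<circ> (\<lambda>t. t - 1))
      {1..CARD('n)} UNIV"
    by (rule bij_betw_trans)
  then show ?thesis
    by (simp add: time_pt_def[abs_def] comp_def)
qed

lemma strict_mono_on_time_pt:
  "strict_mono_on {1..CARD('n)} (time_pt :: nat \<Rightarrow> 'n::{finite,linorder})"
  unfolding time_pt_def
  by (intro strict_mono_onI sorted_wrt_nth_less[where P = "(<)"]) auto

section \<open>Adapted Wasserstein distance\<close>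

text \<open>Conditional independence of \<open>X\<close> and \<open>Y\<close> given the \<open>\<sigma>\<close>-algebra generated by \<open>Z\<close>.\<close>

definition cond_indep ::
  "'w measure \<Rightarrow> ('w \<Rightarrow> 'a::topological_space) \<Rightarrow> ('w \<Rightarrow> 'b::topological_space) \<Rightarrow>
   ('w \<Rightarrow> 'c::topological_space) \<Rightarrow> bool" where
  "cond_indep M X Y Z \<longleftrightarrow>
     (\<forall>A\<in>sets borel. \<forall>B\<in>sets borel. AE w in M.
        real_cond_exp M (vimage_algebra (space M) Z borel)
            (\<lambda>v. indicator A (X v) * indicator B (Y v)) w =
        real_cond_exp M (vimage_algebra (space M) Z borel) (\<lambda>v. indicator A (X v)) w *
        real_cond_exp M (vimage_algebra (space M) Z borel) (\<lambda>v. indicator B (Y v)) w)"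

definition bicausal_couplings ::
  "('d::finite, 'n::{finite,linorder}) path measure \<Rightarrow> ('d, 'n) path measure \<Rightarrow>
   (('d, 'n) path \<times> ('d, 'n) path) measure set" where
  "bicausal_couplings \<mu> \<nu> = {\<pi> \<in> couplings \<mu> \<nu>. \<forall>t. 1 \<le> t \<and> t < CARD('n) \<longrightarrow>
     cond_indep \<pi> (\<lambda>(x, y). init_seg t y) (\<lambda>(x, y). final_seg t x) (\<lambda>(x, y). init_seg t x) \<and>
     cond_indep \<pi> (\<lambda>(x, y). init_seg t x) (\<lambda>(x, y). final_seg t y) (\<lambda>(x, y). init_seg t y)}"

definition adapted_wasserstein ::
  "real \<Rightarrow> ('d::finite, 'n::{finite,linorder}) path measure \<Rightarrow> ('d, 'n) path measure \<Rightarrow> ennreal"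
  where
  "adapted_wasserstein p \<mu> \<nu> =
     epowr (INF \<pi>\<in>bicausal_couplings \<mu> \<nu>.
       \<integral>\<^sup>+(x, y). (\<Sum>i\<in>UNIV. ennreal (norm (x $ i - y $ i) powr p)) \<partial>\<pi>) (1 / p)"

section \<open>Modulus of continuity of the conditional laws\<close>

text \<open>\<open>\<kappa>\<close> is a regular conditional law of \<open>X\<^bsub>t+1\<^esub>\<close> given \<open>X\<^bsub>1:t\<^esub>\<close> for \<open>X \<sim> \<mu>\<close>. Such a kernel exists for
  every Borel probability measure \<open>\<mu>\<close> and is unique up to null sets; \<open>cond_law\<close> fixes a version.\<close>

definition is_cond_law ::
  "('d::finite, 'n::{finite,linorder}) path measure \<Rightarrow> nat \<Rightarrow>
   (('d, 'n) path \<Rightarrow> (real ^ 'd) measure) \<Rightarrow> bool" where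
  "is_cond_law \<mu> t \<kappa> \<longleftrightarrow>
     \<kappa> \<in> borel \<rightarrow>\<^sub>M prob_algebra borel \<and>
     (\<forall>A\<in>sets borel. \<forall>B\<in>sets borel.
        emeasure \<mu> {x. init_seg t x \<in> A \<and> x $ time_pt (t + 1) \<in> B} =
        (\<integral>\<^sup>+x. indicator A (init_seg t x) * emeasure (\<kappa> (init_seg t x)) B \<partial>\<mu>))"

definition cond_law ::
  "('d::finite, 'n::{finite,linorder}) path measure \<Rightarrow> nat \<Rightarrow> ('d, 'n) path \<Rightarrow> (real ^ 'd) measure"
  where
  "cond_law \<mu> t = (SOME \<kappa>. is_cond_law \<mu> t \<kappa>)"

definition modulus ::
  "real \<Rightarrow> ('d::finite, 'n::{finite,linorder}) path measure \<Rightarrow> nat \<Rightarrow> ennreal \<Rightarrow> ennreal" where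
  "modulus p \<mu> t \<delta> =
     (SUP \<pi> \<in> {\<pi> \<in> couplings \<mu> \<mu>.
         epowr (\<integral>\<^sup>+(x, y). ennreal (norm (init_seg t x - init_seg t y) powr p) \<partial>\<pi>) (1 / p) < \<delta>}.
       epowr (\<integral>\<^sup>+(x, y). epowr (wasserstein p (cond_law \<mu> t (init_seg t x))
                                        (cond_law \<mu> t (init_seg t y))) p \<partial>\<pi>) (1 / p))"

fun h_mod ::
  "real \<Rightarrow> ('d::finite, 'n::{finite,linorder}) path measure \<Rightarrow> real \<Rightarrow> nat \<Rightarrow> ennreal" where
  "h_mod p \<mu> \<sigma> t =
     (if t = 0 then ennreal \<sigma> else modulus p \<mu> t (\<Sum>s\<in>{0..<t}. h_mod p \<mu> \<sigma> s))"

declare h_mod.simps [simp del]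

section \<open>Smoothing\<close>

definition scaled_law :: "real \<Rightarrow> 'a::euclidean_space measure \<Rightarrow> 'a measure" where
  "scaled_law \<sigma> \<xi> = distr \<xi> borel (\<lambda>z. \<sigma> *\<^sub>R z)"

definition smoothed ::
  "'a::ordered_euclidean_space measure \<Rightarrow> 'a measure \<Rightarrow> real \<Rightarrow> 'a measure" where
  "smoothed \<mu> \<xi> \<sigma> = convolution \<mu> (scaled_law \<sigma> \<xi>)"

definition fourier :: "('a::euclidean_space \<Rightarrow> real) \<Rightarrow> 'a \<Rightarrow> complex" where
  "fourier f s =
     (LINT x|lborel. exp (- 2 * of_real pi * \<i> * of_real (s \<bullet> x)) * complex_of_real (f x))"

end

theory Submission
  imports Defs
begin

text \<open>Let \<open>\<nu>\<close> be the law of \<open>Y = X' + \<sigma>Z\<close> with independent \<open>X' \<sim> \<mu>\<close> and \<open>Z \<sim> \<xi>\<close>. A bicausal coupling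
  of \<open>\<mu>\<close> and \<open>\<nu>\<close> is built one time step at a time: given the paths \<open>x\<close> and \<open>y\<close> up to time \<open>t\<close>, draw
  \<open>X'\<close> and \<open>Z\<close> up to time \<open>t\<close> from their law given \<open>Y = y\<close>, continue \<open>x\<close> and \<open>X'\<close> by a nearly
  optimal coupling of their conditional laws, and set \<open>Y = X' + \<sigma>Z\<close> at time \<open>t + 1\<close>. Let \<open>a\<^sub>t\<close> be the
  \<open>L\<^sup>p\<close> distance of \<open>X\<close> and \<open>Y\<close> at time \<open>t\<close>, let \<open>C = max 1 (M\<^sub>p(\<xi>)\<^sup>1\<^sup>/\<^sup>p)\<close>, and write \<open>\<omega>\<^sub>t\<close> for the
  modulus of continuity. As \<open>(X, X')\<close> is a coupling of \<open>\<mu>\<close> with itself whose initial segments are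
  within \<open>a\<^sub>1 + \<dots> + a\<^sub>t + C\<sigma>\<close> of each other, \<open>a\<^sub>t\<^sub>+\<^sub>1 \<le> \<omega>\<^sub>t(a\<^sub>1 + \<dots> + a\<^sub>t + C\<sigma>) + C\<sigma>\<close> up to an
  arbitrarily small error. Mixing with the diagonal coupling shows \<open>\<omega>\<^sub>t(c\<delta>) \<le> c \<omega>\<^sub>t(\<delta>)\<close> for \<open>c \<ge> 1\<close>,
  and \<open>a\<^sub>1 + \<dots> + a\<^sub>t \<le> t C (h\<^sub>0 + \<dots> + h\<^sub>t\<^sub>-\<^sub>1)\<close> follows by induction.

  After discretising \<open>X\<^sub>t\<^sub>+\<^sub>1\<close>, nearly optimal couplings can be selected measurably, with a density
  with respect to the product of the conditional laws. So the bicausal coupling has a density \<open>D\<close>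
  with respect to \<open>\<mu> \<Otimes> \<nu>\<close>, and its properties become identities between integrals of \<open>D\<close>.\<close>

section \<open>Regular conditional distributions\<close>

text \<open>The modulus compares conditional laws of \<open>\<mu>\<close> with each other, so a step
  couples \<open>X\<close> with the hidden copy \<open>X'\<close>; the noise enters only afterwards,
  by adding \<open>\<sigma>Z\<close>. The delicate point is bicausality. Both directions rest on one
  fact: the factor \<open>g\<close> of a step integrates to 1 in either variable once the past is
  fixed. In the direction of \<open>y\<close> the noise is frozen first; then the old density is a
  function of the past of \<open>X'\<close> alone, even though the coordinates of \<open>Z\<close>
  may depend on each other in time. These identities hold at every point, so no exceptional sets
  pass from one step to the next.

  Constants: on the first \<open>t\<close> times \<open>X - X' = (X - Y) + \<sigma>Z\<close>, and
  the norm of the whole noise path is charged once. Since \<open>\<sigma>\<close> is the zeroth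
  \<open>h\<close>, it is at most the sum of the earlier ones and only raises the factor
  \<open>t C\<close> to \<open>(t + 1) C\<close>. A factor \<open>\<theta> > 1\<close> absorbs the
  selection errors and makes the distance bound strict, as the modulus requires; it tends to 1 at
  the end.\<close>

lemma AE_le_of_set_nn_integral_le:
  fixes f g :: "'a \<Rightarrow> ennreal"
  assumes [measurable]: "f \<in> borel_measurable M" "g \<in> borel_measurable M"
    and fin: "(\<integral>\<^sup>+x. g x \<partial>M) < \<infinity>"
    and le: "\<And>A. A \<in> sets M \<Longrightarrow> (\<integral>\<^sup>+x. indicator A x * f x \<partial>M) \<le> (\<integral>\<^sup>+x. indicator A x * g x \<partial>M)"
  shows "AE x in M. f x \<le> g x"
proof -
  define A where "A = {x\<in>space M. g x < f x}"
  have A[measurable]: "A \<in> sets M" unfolding A_def by measurable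
  have fA: "(\<integral>\<^sup>+x. indicator A x * g x \<partial>M) < \<infinity>"
    by (rule le_less_trans[OF nn_integral_mono fin]) (auto split: split_indicator)
  have "(\<integral>\<^sup>+x. indicator A x * f x - indicator A x * g x \<partial>M) =
     (\<integral>\<^sup>+x. indicator A x * f x \<partial>M) - (\<integral>\<^sup>+x. indicator A x * g x \<partial>M)"
    using fA by (intro nn_integral_diff) (auto simp: A_def split: split_indicator)
  also have "\<dots> = 0"
    using le[OF A] fA by (intro diff_eq_0_ennreal) auto
  finally have "AE x in M. indicator A x * f x - indicator A x * g x = 0"
    by (subst (asm) nn_integral_0_iff_AE) auto
  with AE_space show ?thesis
  proof eventually_elim
    fix x assume x: "x \<in> space M" "indicator A x * f x - indicator A x * g x = 0"
    show "f x \<le> g x"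
    proof (rule ccontr)
      assume *: "\<not> f x \<le> g x"
      then have "f x - g x = 0" using x by (simp add: A_def)
      then show False using * by (auto simp: diff_eq_0_iff_ennreal)
    qed
  qed
qed

lemma Int_stable_Iic: "Int_stable (range (atMost :: 'a::linorder \<Rightarrow> _))"
proof (rule Int_stableI)
  fix A B assume "A \<in> range (atMost :: 'a \<Rightarrow> _)" "B \<in> range (atMost :: 'a \<Rightarrow> _)"
  then obtain a b where ab: "A = {..a}" "B = {..b}" by auto
  have "{..a} \<inter> {..b} = {..min a b}" by auto
  then show "A \<inter> B \<in> range atMost" unfolding ab by blast
qed

text \<open>Dynkin's argument: both sides are finite measures in \<open>B\<close>, and the
  half-lines are an intersection-stable generator. Complements use that every \<open>k a\<close> has
  mass 1.\<close>

lemma kernel_disintegration_of_Iic: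
  fixes S :: "'m \<Rightarrow> 's" and X :: "'m \<Rightarrow> real"
  assumes "prob_space M" and S[measurable]: "S \<in> M \<rightarrow>\<^sub>M N" and X[measurable]: "X \<in> borel_measurable M"
    and k: "k \<in> N \<rightarrow>\<^sub>M prob_algebra borel" and A: "A \<in> sets N"
    and Iic: "\<And>x. (\<integral>\<^sup>+a. indicator A a * emeasure (k a) {..x} \<partial>distr M N S)
       = emeasure M {w\<in>space M. S w \<in> A \<and> X w \<le> x}"
    and B: "B \<in> sets borel"
  shows "(\<integral>\<^sup>+a. indicator A a * emeasure (k a) B \<partial>distr M N S)
       = emeasure M {w\<in>space M. S w \<in> A \<and> X w \<in> B}"
proof -
  interpret M: prob_space M by fact
  note A[measurable]
  have ks: "k \<in> N \<rightarrow>\<^sub>M subprob_algebra borel" using k by (rule measurable_prob_algebraD)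
  have [measurable]: "(\<lambda>a. emeasure (k a) C) \<in> borel_measurable N" if "C \<in> sets borel" for C
    using measurable_compose[OF ks measurable_emeasure_subprob_algebra[OF that]] .
  have kp: "prob_space (k a)" "sets (k a) = sets borel" if "a \<in> space N" for a
    using measurable_space[OF k that] by (auto simp: space_prob_algebra)
  define G :: "real set set" where "G = range atMost"
  have sb: "sets (borel::real measure) = sigma_sets UNIV G"
    by (simp add: borel_eq_atMost G_def)
  have "B \<in> sigma_sets UNIV G" using B sb by simp
  have "Int_stable G" "G \<subseteq> Pow UNIV" unfolding G_def by (rule Int_stable_Iic) simp
  from this \<open>B \<in> sigma_sets UNIV G\<close> show ?thesis
  proof (induct rule: sigma_sets_induct_disjoint)
    case (basic B) then show ?case using Iic by (auto simp: G_def)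
  next
    case (compl B)
    then have Bm[measurable]: "B \<in> sets borel" by (simp add: sb)
    have "(\<integral>\<^sup>+a. indicator A a * emeasure (k a) (UNIV - B) \<partial>distr M N S) =
      (\<integral>\<^sup>+a. indicator A a - indicator A a * emeasure (k a) B \<partial>distr M N S)"
    proof (rule nn_integral_cong)
      fix a assume "a \<in> space (distr M N S)" then have a: "a \<in> space N" by simp
      interpret k: prob_space "k a" using kp a by auto
      have "space (k a) = UNIV" using kp[OF a] sets_eq_imp_space_eq by fastforce
      then show "indicator A a * emeasure (k a) (UNIV - B) = indicator A a - indicator A a * emeasure (k a) B"
        using emeasure_compl[of B "k a"] kp(2)[OF a] k.emeasure_space_1 Bm
        by (auto split: split_indicator)
    qed
    also have "\<dots> = (\<integral>\<^sup>+a. indicator A a \<partial>distr M N S) - (\<integral>\<^sup>+a. indicator A a * emeasure (k a) B \<partial>distr M N S)"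
    proof (rule nn_integral_diff)
      show "AE x in distr M N S. indicator A x * emeasure (k x) B \<le> indicator A x"
        by (rule AE_I2) (auto split: split_indicator intro!: subprob_space.subprob_emeasure_le_1 prob_space_imp_subprob_space kp)
      show "(\<integral>\<^sup>+ x. indicator A x * emeasure (k x) B \<partial>distr M N S) \<noteq> \<infinity>"
        unfolding compl(2) by simp
    qed auto
    also have "\<dots> = emeasure M {w\<in>space M. S w \<in> A} - emeasure M {w\<in>space M. S w \<in> A \<and> X w \<in> B}"
      unfolding compl(2) by (simp add: emeasure_distr vimage_def Int_def conj_commute)
    also have "\<dots> = emeasure M ({w\<in>space M. S w \<in> A} - {w\<in>space M. S w \<in> A \<and> X w \<in> B})"
      by (rule emeasure_Diff[symmetric]) auto
    also have "{w\<in>space M. S w \<in> A} - {w\<in>space M. S w \<in> A \<and> X w \<in> B} = {w\<in>space M. S w \<in> A \<and> X w \<in> UNIV - B}" by auto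
    finally show ?case .
  next
    case (union B)
    then have Bm[measurable]: "B i \<in> sets borel" for i by (auto simp: sb)
    have "(\<integral>\<^sup>+a. indicator A a * emeasure (k a) (\<Union>i. B i) \<partial>distr M N S) =
      (\<integral>\<^sup>+a. (\<Sum>i. indicator A a * emeasure (k a) (B i)) \<partial>distr M N S)"
      using union(1) kp Bm by (intro nn_integral_cong) (auto simp: suminf_emeasure image_subset_iff)
    also have "\<dots> = (\<Sum>i. emeasure M {w\<in>space M. S w \<in> A \<and> X w \<in> B i})"
      using union(3) by (subst nn_integral_suminf) auto
    also have "\<dots> = emeasure M (\<Union>i. {w\<in>space M. S w \<in> A \<and> X w \<in> B i})"
      using union(1) by (intro suminf_emeasure) (auto simp: disjoint_family_on_def)
    also have "(\<Union>i. {w\<in>space M. S w \<in> A \<and> X w \<in> B i}) = {w\<in>space M. S w \<in> A \<and> X w \<in> (\<Union>i. B i)}" by auto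
    finally show ?case .
  qed simp
qed

text \<open>The kernel comes from a conditional distribution function. For each threshold
  \<open>q\<close> the conditional probability of \<open>X w \<le> q\<close> is a Radon-Nikodym
  derivative, fixed only up to null sets; monotonicity and boundary values are repaired along the
  rational thresholds.\<close>

lemma disintegration_unit_interval:
  fixes S :: "'m \<Rightarrow> 's" and X :: "'m \<Rightarrow> real"
  assumes "prob_space M" and S[measurable]: "S \<in> M \<rightarrow>\<^sub>M N" and X[measurable]: "X \<in> borel_measurable M"
    and X01: "\<And>w. w \<in> space M \<Longrightarrow> 0 \<le> X w \<and> X w \<le> 1"
  shows "\<exists>k \<in> N \<rightarrow>\<^sub>M prob_algebra borel. \<forall>A\<in>sets N. \<forall>B\<in>sets borel.
     (\<integral>\<^sup>+a. indicator A a * emeasure (k a) B \<partial>distr M N S)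
       = emeasure M {w\<in>space M. S w \<in> A \<and> X w \<in> B}"
proof -
  interpret M: prob_space M by fact
  define L where "L = distr M N S"
  interpret L: prob_space L unfolding L_def by (rule M.prob_space_distr) simp
  have [simp, measurable_cong]: "sets L = sets N" "space L = space N" by (auto simp: L_def)
  define Q where "Q q = distr (density M (indicator {w\<in>space M. X w \<le> q})) N S" for q
  have Q: "emeasure (Q q) A = emeasure M {w\<in>space M. S w \<in> A \<and> X w \<le> q}" if "A \<in> sets N" for A q
  proof -
    have "emeasure (Q q) A = (\<integral>\<^sup>+w. indicator {w\<in>space M. X w \<le> q} w * indicator (S -` A \<inter> space M) w \<partial>M)"
      using that by (simp add: Q_def emeasure_distr emeasure_density)
    also have "\<dots> = (\<integral>\<^sup>+w. indicator {w\<in>space M. S w \<in> A \<and> X w \<le> q} w \<partial>M)"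
      by (intro nn_integral_cong) (auto split: split_indicator)
    also have "\<dots> = emeasure M {w\<in>space M. S w \<in> A \<and> X w \<le> q}"
      using that[measurable] by (intro nn_integral_indicator) measurable
    finally show ?thesis .
  qed
  have Lem: "emeasure L A = emeasure M {w\<in>space M. S w \<in> A}" if "A \<in> sets N" for A
    using that by (simp add: L_def emeasure_distr vimage_def Int_def conj_commute)
  have ac: "absolutely_continuous L (Q q)" for q
    unfolding absolutely_continuous_def
  proof
    fix A assume A: "A \<in> null_sets L"
    then have "A \<in> sets N" and *: "emeasure M {w\<in>space M. S w \<in> A} = 0" using Lem by (auto simp: null_sets_def)
    have "emeasure M {w\<in>space M. S w \<in> A \<and> X w \<le> q} \<le> emeasure M {w\<in>space M. S w \<in> A}"
      using \<open>A \<in> sets N\<close> by (intro emeasure_mono) auto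
    then show "A \<in> null_sets (Q q)" using * Q[OF \<open>A \<in> sets N\<close>] \<open>A \<in> sets N\<close>
      by (auto simp: null_sets_def Q_def)
  qed
  define R where "R q = RN_deriv L (Q q)" for q
  have Rm[measurable]: "R q \<in> borel_measurable N" for q
    using borel_measurable_RN_deriv[of L "Q q"] by (simp add: R_def)
  have RQ: "density L (R q) = Q q" for q
    unfolding R_def by (rule L.density_RN_deriv[OF ac]) (simp add: Q_def)
  have R: "(\<integral>\<^sup>+a. indicator A a * R q a \<partial>L) = emeasure M {w\<in>space M. S w \<in> A \<and> X w \<le> q}"
    if A: "A \<in> sets N" for A q
  proof -
    have "(\<integral>\<^sup>+a. indicator A a * R q a \<partial>L) = emeasure (density L (R q)) A"
      using A by (simp add: emeasure_density mult.commute)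
    then show ?thesis by (simp add: RQ Q A)
  qed
  have Rfin: "(\<integral>\<^sup>+a. R q a \<partial>L) < \<infinity>" for q
  proof -
    have "(\<integral>\<^sup>+a. R q a \<partial>L) = (\<integral>\<^sup>+a. indicator (space N) a * R q a \<partial>L)"
      by (intro nn_integral_cong) auto
    also have "\<dots> < \<infinity>" unfolding R[OF sets.top] by (simp add: M.emeasure_eq_measure)
    finally show ?thesis .
  qed
  have mono: "AE a in L. R q a \<le> R q' a" if "q \<le> q'" for q q'
    using that by (intro AE_le_of_set_nn_integral_le) (auto simp: R Rfin[unfolded infinity_ennreal_def] intro!: emeasure_mono)
  have one: "AE a in L. R q a = 1" if "1 \<le> q" for q
  proof -
    have "{w\<in>space M. S w \<in> A \<and> X w \<le> q} = {w\<in>space M. S w \<in> A}" for A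
      using X01 that by force
    then have *: "(\<integral>\<^sup>+a. indicator A a * R q a \<partial>L) = (\<integral>\<^sup>+a. indicator A a * 1 \<partial>L)" if "A \<in> sets N" for A
      using that by (simp add: R Lem)
    have "AE a in L. R q a \<le> 1" by (intro AE_le_of_set_nn_integral_le) (auto simp: * L.emeasure_space_1[simplified])
    moreover have "AE a in L. 1 \<le> R q a" by (intro AE_le_of_set_nn_integral_le) (auto simp: * Rfin[unfolded infinity_ennreal_def])
    ultimately show ?thesis by eventually_elim auto
  qed
  have zero: "AE a in L. R q a = 0" if "q < 0" for q
  proof -
    have e: "{w\<in>space M. S w \<in> A \<and> X w \<le> q} = {}" for A
      using X01 that by force
    have *: "(\<integral>\<^sup>+a. indicator A a * R q a \<partial>L) = (\<integral>\<^sup>+a. indicator A a * 0 \<partial>L)" if "A \<in> sets N" for A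
      using that by (simp only: R e) simp
    have "AE a in L. R q a \<le> 0" by (intro AE_le_of_set_nn_integral_le) (auto simp: *)
    then show ?thesis by eventually_elim auto
  qed
  \<comment> \<open>The exceptional sets are indexed by rationals, so their union is still
    null.\<close>
  define G where "G = {a\<in>space N. (\<forall>q\<in>\<rat>. \<forall>q'\<in>\<rat>. q \<le> q' \<longrightarrow> R q a \<le> R q' a)
    \<and> (\<forall>q\<in>\<rat>. 1 \<le> q \<longrightarrow> R q a = 1) \<and> (\<forall>q\<in>\<rat>. q < 0 \<longrightarrow> R q a = 0)}"
  have G[measurable]: "G \<in> sets N" unfolding G_def
    using countable_rat by measurable
  have AEG: "AE a in L. a \<in> G"
  proof -
    have "AE a in L. \<forall>q\<in>\<rat>. \<forall>q'\<in>\<rat>. q \<le> q' \<longrightarrow> R q a \<le> R q' a"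
      using mono by (auto simp: AE_ball_countable countable_rat)
    moreover have "AE a in L. \<forall>q\<in>\<rat>. 1 \<le> q \<longrightarrow> R q a = 1"
      using one by (auto simp: AE_ball_countable countable_rat)
    moreover have "AE a in L. \<forall>q\<in>\<rat>. q < 0 \<longrightarrow> R q a = 0"
      using zero by (auto simp: AE_ball_countable countable_rat)
    ultimately show ?thesis using AE_space by eventually_elim (auto simp: G_def)
  qed
  \<comment> \<open>The infimum over rationals strictly above \<open>x\<close> forces right
    continuity. Off \<open>G\<close> the default is the distribution function of the unit mass at
    0.\<close>
  define H where "H a x = (if a \<in> G then INF q\<in>{q\<in>\<rat>. x < q}. R q a else indicator {0..} x)" for a x
  have Hm[measurable]: "(\<lambda>a. H a x) \<in> borel_measurable N" for x
    unfolding H_def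
    by (intro measurable_If borel_measurable_INF) (auto intro: countable_subset[OF _ countable_rat])
  have H_upper: "H a x \<le> R q a" if "a \<in> G" "q \<in> \<rat>" "x < q" for a x q
    using that by (auto simp: H_def intro!: INF_lower)
  have H_le1: "H a x \<le> 1" for a x
  proof (cases "a \<in> G")
    case True
    obtain q where "max x 1 < q" "q \<in> \<rat>" using Rats_dense_in_real[of "max x 1" "max x 1 + 1"] by auto
    with H_upper[OF True this(2), of x] True show ?thesis by (auto simp: G_def)
  qed (auto simp: H_def split: split_indicator)
  have H_mono: "H a x \<le> H a y" if "x \<le> y" for a x y
    using that by (auto simp: H_def intro!: INF_superset_mono split: split_indicator)
  have H_top: "H a x = 1" if "1 \<le> x" for a x
    using that by (auto simp: H_def G_def intro!: INF_eqI[where x=1] split: split_indicator)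
      (use Rats_dense_in_real[of x "x+1"] in force)
  have H_bot: "H a x = 0" if "x < 0" for a x
  proof (cases "a \<in> G")
    case True
    obtain q where "x < q" "q < 0" "q \<in> \<rat>" using Rats_dense_in_real[OF \<open>x < 0\<close>] by auto
    with H_upper[OF True this(3), of x] True show ?thesis by (auto simp: G_def)
  qed (use that in \<open>auto simp: H_def\<close>)
  have H_right: "\<exists>z>x. \<forall>y. x < y \<and> y < z \<longrightarrow> H a y < c" if c: "H a x < c" for a x c
  proof (cases "a \<in> G")
    case True
    then obtain q where q: "q \<in> \<rat>" "x < q" "R q a < c" using c by (auto simp: H_def INF_less_iff)
    then show ?thesis using H_upper[OF True q(1)] by (intro exI[of _ q]) (auto intro: le_less_trans)
  next
    case False
    show ?thesis
    proof (cases "x < 0")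
      case True then show ?thesis using False c by (intro exI[of _ 0]) (auto simp: H_def)
    next
      case F: False then show ?thesis using False c by (intro exI[of _ "x+1"]) (auto simp: H_def)
    qed
  qed
  define F where "F a x = enn2real (H a x)" for a x
  have HF: "H a x = ennreal (F a x)" for a x
    using H_le1[of a x] unfolding F_def by (metis ennreal_enn2real ennreal_one_less_top le_less_trans less_top)
  have F0: "0 \<le> F a x" for a x by (simp add: F_def)
  have F_mono: "F a x \<le> F a y" if "x \<le> y" for a x y
    using H_mono[OF that, of a] F0 by (simp add: HF)
  have F_right: "continuous (at_right x) (F a)" for a x
    unfolding continuous_within
  proof (rule decreasing_tendsto)
    show "\<forall>\<^sub>F y in at x within {x<..}. F a x \<le> F a y"
      unfolding eventually_at_filter by (rule always_eventually) (auto intro!: F_mono)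
    fix c assume c: "F a x < c"
    then have "H a x < ennreal c" using F0[of a x] by (simp add: HF ennreal_less_iff)
    from H_right[OF this] obtain z where z: "z > x" "\<And>y. x < y \<Longrightarrow> y < z \<Longrightarrow> H a y < ennreal c" by auto
    have "F a y < c" if "x < y" "y < z" for y
      using z(2)[OF that] F0[of a y] c F0[of a x] by (simp add: HF ennreal_less_iff)
    then show "\<forall>\<^sub>F y in at_right x. F a y < c"
      using z(1) by (auto simp: eventually_at_right_field)
  qed
  have F_bot: "(F a \<longlongrightarrow> 0) at_bot" for a
    by (rule tendsto_eventually) (auto simp: eventually_at_bot_dense F_def H_bot intro!: exI[of _ 0])
  have F_top: "(F a \<longlongrightarrow> 1) at_top" for a
    by (rule tendsto_eventually) (auto simp: eventually_at_top_linorder F_def H_top intro!: exI[of _ 1])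
  define k where "k a = interval_measure (F a)" for a
  have kp: "prob_space (k a)" for a
    using real_distribution_interval_measure[OF F_mono F_right F_bot F_top]
    unfolding k_def real_distribution_def by auto
  have kI: "emeasure (k a) {..x} = H a x" for a x
    unfolding k_def HF by (rule emeasure_interval_measure_Iic[OF F_mono F_right F_bot])
  have km: "k \<in> N \<rightarrow>\<^sub>M prob_algebra borel"
  proof (rule measurable_prob_algebra_generated[where \<Omega>=UNIV and G="range atMost"])
    show "sets borel = sigma_sets UNIV (range (atMost :: real \<Rightarrow> _))" by (simp add: borel_eq_atMost)
    show "Int_stable (range (atMost :: real \<Rightarrow> _))" by (rule Int_stable_Iic)
    show "sets (k a) = sets borel" for a by (simp add: k_def)
  qed (auto simp: kp kI)
  \<comment> \<open>Regularising costs nothing. From above, approximate \<open>x\<close> by larger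
    rationals and use continuity of the measure along decreasing events; from below,
    \<open>R x\<close> is almost surely at most \<open>R q\<close> for all rational
    \<open>q > x\<close>.\<close>
  have HI: "(\<integral>\<^sup>+a. indicator A a * H a x \<partial>L) = emeasure M {w\<in>space M. S w \<in> A \<and> X w \<le> x}"
    if A[measurable]: "A \<in> sets N" for A x
  proof (rule antisym)
    have le: "(\<integral>\<^sup>+a. indicator A a * H a x \<partial>L) \<le> emeasure M {w\<in>space M. S w \<in> A \<and> X w \<le> x + 1 / Suc n}" for n
    proof -
      obtain q where q: "x < q" "q < x + 1 / Suc n" "q \<in> \<rat>" using Rats_dense_in_real[of x "x + 1 / Suc n"] by auto
      have "(\<integral>\<^sup>+a. indicator A a * H a x \<partial>L) \<le> (\<integral>\<^sup>+a. indicator A a * R q a \<partial>L)"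
      proof (rule nn_integral_mono_AE)
        show "AE a in L. indicator A a * H a x \<le> indicator A a * R q a"
          using AEG by eventually_elim (auto split: split_indicator intro!: H_upper q)
      qed
      also have "\<dots> \<le> emeasure M {w\<in>space M. S w \<in> A \<and> X w \<le> x + 1 / Suc n}"
        unfolding R[OF A] using q by (intro emeasure_mono) auto
      finally show ?thesis .
    qed
    have "(\<lambda>n. emeasure M {w\<in>space M. S w \<in> A \<and> X w \<le> x + 1 / Suc n}) \<longlonglongrightarrow>
       emeasure M (\<Inter>n. {w\<in>space M. S w \<in> A \<and> X w \<le> x + 1 / Suc n})"
    proof (rule Lim_emeasure_decseq)
      have "x + 1 / Suc n \<le> x + 1 / Suc m" if "m \<le> n" for m n
        using that by (simp add: frac_le)
      then show "decseq (\<lambda>n. {w\<in>space M. S w \<in> A \<and> X w \<le> x + 1 / Suc n})"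
        unfolding decseq_def by (auto intro: order_trans)
    qed auto
    also have "(\<Inter>n. {w\<in>space M. S w \<in> A \<and> X w \<le> x + 1 / Suc n}) = {w\<in>space M. S w \<in> A \<and> X w \<le> x}"
    proof -
      have "X w \<le> x" if "\<And>n. X w \<le> x + 1 / Suc n" for w
      proof (rule field_le_epsilon)
        fix e :: real assume "0 < e"
        then obtain n where "1 / Suc n < e" using nat_approx_posE by blast
        then show "X w \<le> x + e" using that[of n] by simp
      qed
      moreover have "X w \<le> x + 1 / Suc n" if "X w \<le> x" for w n
        using that by (rule order_trans) simp
      ultimately show ?thesis by auto
    qed
    finally show "(\<integral>\<^sup>+a. indicator A a * H a x \<partial>L) \<le> emeasure M {w\<in>space M. S w \<in> A \<and> X w \<le> x}"
      by (rule LIMSEQ_le_const) (use le in auto)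
    have "AE a in L. \<forall>q\<in>\<rat>. x < q \<longrightarrow> R x a \<le> R q a"
      using mono by (auto simp: AE_ball_countable countable_rat)
    then have "AE a in L. R x a \<le> H a x"
      using AEG by eventually_elim (auto simp: H_def intro!: INF_greatest)
    then show "emeasure M {w\<in>space M. S w \<in> A \<and> X w \<le> x} \<le> (\<integral>\<^sup>+a. indicator A a * H a x \<partial>L)"
      unfolding R[OF A, symmetric]
    proof (intro nn_integral_mono_AE)
      assume "AE a in L. R x a \<le> H a x"
      then show "AE a in L. indicator A a * R x a \<le> indicator A a * H a x"
        by eventually_elim (auto split: split_indicator)
    qed
  qed
  show ?thesis
    by (intro bexI[OF _ km] ballI kernel_disintegration_of_Iic[OF \<open>prob_space M\<close> S X km])
      (auto simp: kI HI[unfolded L_def])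
qed


text \<open>After multiplication by \<open>4 ^ Suc n\<close> the digits beyond position
  \<open>n\<close> contribute at most 1/3, so the floor keeps exactly the digits up to
  \<open>n\<close>. All of these but the last carry a factor 4, hence the parity is digit
  \<open>n\<close>.\<close>

lemma odd_floor_base_4:
  fixes b :: "nat \<Rightarrow> bool"
  shows "odd \<lfloor>4 ^ Suc n * (\<Sum>k. of_bool (b k) * (1/4::real) ^ Suc k)\<rfloor> \<longleftrightarrow> b n"
proof -
  define c where "c k = of_bool (b k) * (1/4::real) ^ Suc k" for k
  have g: "(\<lambda>k. (1/4::real) ^ Suc k) sums (1/3)"
    using sums_mult[OF geometric_sums[of "1/4::real"], of "1/4"] by (simp add: mult.commute)
  have sc: "summable c"
    by (rule summable_comparison_test[OF _ sums_summable[OF g]]) (auto simp: c_def)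
  define N :: int where "N = (\<Sum>k<Suc n. of_bool (b k) * 4 ^ (n - k))"
  define t where "t = 4 ^ Suc n * (\<Sum>k. c (k + Suc n))"
  have "4 ^ Suc n * (\<Sum>k<Suc n. c k) = (\<Sum>k<Suc n. of_bool (b k) * 4 ^ (n - k))"
    unfolding sum_distrib_left
  proof (rule sum.cong)
    fix k assume "k \<in> {..<Suc n}"
    then have "(4::real) ^ Suc n = 4 ^ (n - k) * 4 ^ Suc k" by (simp add: power_add[symmetric])
    then show "4 ^ Suc n * c k = of_bool (b k) * 4 ^ (n - k)" by (simp add: c_def power_divide)
  qed simp
  then have head: "4 ^ Suc n * (\<Sum>k<Suc n. c k) = of_int N" by (simp add: N_def)
  have tail: "t = (\<Sum>k. of_bool (b (k + Suc n)) * (1/4) ^ Suc k)"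
    unfolding t_def
  proof (subst suminf_mult[symmetric])
    show "summable (\<lambda>k. c (k + Suc n))" using sc by (rule summable_ignore_initial_segment)
    show "(\<Sum>k. 4 ^ Suc n * c (k + Suc n)) = (\<Sum>k. of_bool (b (k + Suc n)) * (1/4) ^ Suc k)"
      by (rule suminf_cong) (simp add: c_def power_add power_divide)
  qed
  have st: "summable (\<lambda>k. of_bool (b (k + Suc n)) * (1/4::real) ^ Suc k)"
    by (rule summable_comparison_test[OF _ sums_summable[OF g]]) auto
  have t0: "0 \<le> t" unfolding tail by (rule suminf_nonneg[OF st]) auto
  have "t \<le> 1/3" unfolding tail sums_unique[OF g]
    by (rule suminf_le[OF _ st sums_summable[OF g]]) auto
  have "4 ^ Suc n * suminf c = t + of_int N"
    using suminf_split_initial_segment[OF sc, of "Suc n"] head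
    unfolding t_def by (simp only: distrib_left)
  then have "\<lfloor>4 ^ Suc n * suminf c\<rfloor> = N"
    using t0 \<open>t \<le> 1/3\<close> by (simp add: floor_eq_iff)
  moreover have "odd N \<longleftrightarrow> b n"
  proof -
    have "even (\<Sum>k<n. of_bool (b k) * (4::int) ^ (n - k))"
      by (rule dvd_sum) auto
    then show ?thesis by (simp add: N_def)
  qed
  ultimately show ?thesis by (simp add: c_def[abs_def])
qed

text \<open>Codes \<open>x\<close> by the base-4 expansion with digits in \<open>{0, 1}\<close> recording which balls around the
  points of a dense sequence contain \<open>x\<close>; base 4 keeps the expansion unique.\<close>

lemma borel_embedding_unit_interval:
  "\<exists>(\<phi> :: 'b::{banach, second_countable_topology} \<Rightarrow> real) \<psi>.
     \<phi> \<in> borel_measurable borel \<and> \<psi> \<in> borel_measurable borel \<and>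
     (\<forall>x. 0 \<le> \<phi> x \<and> \<phi> x \<le> 1 \<and> \<psi> (\<phi> x) = x)"
proof -
  obtain D :: "'b set" where D: "countable D" "\<And>X. open X \<Longrightarrow> X \<noteq> {} \<Longrightarrow> \<exists>d\<in>D. d \<in> X"
    by (rule countable_dense_setE) blast
  define d where "d = from_nat_into D"
  have "D \<noteq> {}" using D(2)[of UNIV] by auto
  have dense: "\<exists>n. dist x (d n) < e" if "0 < e" for x e
  proof -
    have "ball x e \<noteq> {}" using \<open>0 < e\<close> by simp
    then obtain y where "y \<in> D" "y \<in> ball x e" using D(2)[of "ball x e"] by auto
    then show ?thesis using from_nat_into_surj[OF D(1) \<open>y \<in> D\<close>] by (auto simp: d_def)
  qed
  define b where "b x m = (case prod_decode m of (k, n) \<Rightarrow> dist x (d n) < (1/2) ^ k)" for x m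
  define \<phi> where "\<phi> x = (\<Sum>m. of_bool (b x m) * (1/4::real) ^ Suc m)" for x
  define B where "B m r \<longleftrightarrow> odd \<lfloor>4 ^ Suc m * r\<rfloor>" for m and r :: real
  \<comment> \<open>For each radius \<open>(1/2) ^ k\<close> the decoder reads off the first point
    of the dense sequence that is this close to \<open>x\<close>; these points converge to
    \<open>x\<close>. \<open>lim\<close> also gives a value to reals that are not codes.\<close>
  define \<psi> where "\<psi> r = lim (\<lambda>k. d (LEAST n. B (prod_encode (k, n)) r))" for r
  have g: "(\<lambda>k. (1/4::real) ^ Suc k) sums (1/3)"
    using sums_mult[OF geometric_sums[of "1/4::real"], of "1/4"] by (simp add: mult.commute)
  have s: "summable (\<lambda>m. of_bool (b x m) * (1/4::real) ^ Suc m)" for x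
    by (rule summable_comparison_test[OF _ sums_summable[OF g]]) auto
  have \<phi>01: "0 \<le> \<phi> x" "\<phi> x \<le> 1" for x
  proof -
    show "0 \<le> \<phi> x" unfolding \<phi>_def by (rule suminf_nonneg[OF s]) auto
    have "\<phi> x \<le> 1/3" unfolding \<phi>_def sums_unique[OF g]
      by (rule suminf_le[OF _ s sums_summable[OF g]]) auto
    then show "\<phi> x \<le> 1" by simp
  qed
  have [measurable]: "Measurable.pred borel (\<lambda>x. b x m)" for m
    unfolding b_def by (cases "prod_decode m") simp
  have \<phi>m: "\<phi> \<in> borel_measurable borel"
    unfolding \<phi>_def of_bool_def by measurable
  have Bm[measurable]: "Measurable.pred borel (B m)" for m
  proof -
    have [measurable]: "Measurable.pred (count_space UNIV) (odd :: int \<Rightarrow> bool)" by simp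
    show ?thesis unfolding B_def by measurable
  qed
  have \<psi>m: "\<psi> \<in> borel_measurable borel"
    unfolding \<psi>_def
  proof (rule borel_measurable_lim_metric)
    fix k
    have "(\<lambda>r. LEAST n. B (prod_encode (k, n)) r) \<in> borel \<rightarrow>\<^sub>M count_space UNIV"
      by (rule measurable_Least) simp
    then show "(\<lambda>r. d (LEAST n. B (prod_encode (k, n)) r)) \<in> borel_measurable borel"
      by (rule measurable_compose) simp
  qed
  have "\<psi> (\<phi> x) = x" for x
  proof -
    have "B (prod_encode (k, n)) (\<phi> x) \<longleftrightarrow> dist x (d n) < (1/2) ^ k" for k n
      unfolding B_def \<phi>_def odd_floor_base_4 by (simp add: b_def)
    then have "\<psi> (\<phi> x) = lim (\<lambda>k. d (LEAST n. dist x (d n) < (1/2) ^ k))"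
      by (simp add: \<psi>_def)
    also have "\<dots> = x"
    proof (rule limI)
      have le: "dist (d (LEAST n. dist x (d n) < (1/2) ^ k)) x \<le> (1/2) ^ k" for k
        using LeastI_ex[OF dense[of "(1/2)^k" x]] by (simp add: dist_commute less_imp_le)
      have "(\<lambda>k. dist (d (LEAST n. dist x (d n) < (1/2) ^ k)) x) \<longlonglongrightarrow> 0"
        by (rule tendsto_sandwich[OF _ _ tendsto_const LIMSEQ_power_zero[of "1/2::real"]])
          (auto intro!: always_eventually le)
      then show "(\<lambda>k. d (LEAST n. dist x (d n) < (1/2) ^ k)) \<longlonglongrightarrow> x"
        by (subst tendsto_dist_iff)
    qed
    finally show ?thesis .
  qed
  with \<phi>m \<psi>m \<phi>01 show ?thesis by blast
qed

text \<open>The coded variable has a kernel by the real case; it is pushed forward along the decoder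
  \<open>\<psi>\<close>. As \<open>\<psi>\<close> inverts \<open>\<phi>\<close>, \<open>X w\<close>
  lies in \<open>B\<close> exactly if its code lies in the preimage of \<open>B\<close> under
  \<open>\<psi>\<close>.\<close>

theorem disintegration:
  fixes S :: "'m \<Rightarrow> 's" and X :: "'m \<Rightarrow> 'b::{banach, second_countable_topology}"
  assumes "prob_space M" and S[measurable]: "S \<in> M \<rightarrow>\<^sub>M N" and X[measurable]: "X \<in> borel_measurable M"
  shows "\<exists>k \<in> N \<rightarrow>\<^sub>M prob_algebra borel. \<forall>A\<in>sets N. \<forall>B\<in>sets borel.
     emeasure M {w\<in>space M. S w \<in> A \<and> X w \<in> B} = (\<integral>\<^sup>+w. indicator A (S w) * emeasure (k (S w)) B \<partial>M)"
proof -
  obtain \<phi> :: "'b \<Rightarrow> real" and \<psi> where \<phi>[measurable]: "\<phi> \<in> borel_measurable borel"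
    and \<psi>[measurable]: "\<psi> \<in> borel_measurable borel"
    and \<phi>\<psi>: "\<And>x. 0 \<le> \<phi> x \<and> \<phi> x \<le> 1" "\<And>x. \<psi> (\<phi> x) = x"
    using borel_embedding_unit_interval[where 'b='b] by (elim exE conjE) (rule that, auto)
  obtain k where k: "k \<in> N \<rightarrow>\<^sub>M prob_algebra borel"
    and kI: "\<And>A B. A \<in> sets N \<Longrightarrow> B \<in> sets borel \<Longrightarrow>
     (\<integral>\<^sup>+a. indicator A a * emeasure (k a) B \<partial>distr M N S)
       = emeasure M {w\<in>space M. S w \<in> A \<and> \<phi> (X w) \<in> B}"
    using disintegration_unit_interval[OF assms(1) S measurable_compose[OF X \<phi>]] \<phi>\<psi>(1) by blast
  have kp: "prob_space (k a)" "sets (k a) = sets borel" if "a \<in> space N" for a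
    using measurable_space[OF k that] by (auto simp: space_prob_algebra)
  let ?k = "\<lambda>a. distr (k a) borel \<psi>"
  have k': "?k \<in> N \<rightarrow>\<^sub>M prob_algebra borel"
    using k by (rule measurable_compose[OF _ measurable_distr_prob_space]) simp
  show ?thesis
  proof (intro bexI[OF _ k'] ballI)
    fix A B assume A[measurable]: "A \<in> sets N" and B[measurable]: "B \<in> sets (borel :: 'b measure)"
    have "emeasure M {w\<in>space M. S w \<in> A \<and> X w \<in> B} = emeasure M {w\<in>space M. S w \<in> A \<and> \<phi> (X w) \<in> \<psi> -` B}"
      by (simp add: \<phi>\<psi>(2))
    also have "\<dots> = (\<integral>\<^sup>+a. indicator A a * emeasure (k a) (\<psi> -` B) \<partial>distr M N S)"
      by (rule kI[symmetric, OF A measurable_sets[OF \<psi> B, simplified]])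
    also have "\<dots> = (\<integral>\<^sup>+a. indicator A a * emeasure (?k a) B \<partial>distr M N S)"
    proof (rule nn_integral_cong)
      fix a assume "a \<in> space (distr M N S)"
      then have a: "sets (k a) = sets borel" using kp by simp
      then have "space (k a) = UNIV" using sets_eq_imp_space_eq by fastforce
      then show "indicator A a * emeasure (k a) (\<psi> -` B) = indicator A a * emeasure (?k a) B"
        using a by (subst emeasure_distr) (auto simp: measurable_cong_sets[OF a refl])
    qed
    also have "\<dots> = (\<integral>\<^sup>+w. indicator A (S w) * emeasure (?k (S w)) B \<partial>M)"
    proof (rule nn_integral_distr[OF S])
      have [measurable]: "(\<lambda>a. emeasure (?k a) B) \<in> borel_measurable N"
        by (rule measurable_compose[OF measurable_prob_algebraD[OF k'] measurable_emeasure_subprob_algebra[OF B]])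
      show "(\<lambda>a. indicator A a * emeasure (?k a) B) \<in> borel_measurable (distr M N S)" by measurable
    qed
    finally show "emeasure M {w\<in>space M. S w \<in> A \<and> X w \<in> B} = (\<integral>\<^sup>+w. indicator A (S w) * emeasure (?k (S w)) B \<partial>M)" .
  qed
qed

text \<open>Rectangles generate the product, so the law of \<open>(S, X)\<close> is the law obtained
  by drawing \<open>S\<close> and then a point from \<open>k (S w)\<close>. The formula is
  integration against this law.\<close>

lemma disintegration_nn_integral:
  fixes S :: "'m \<Rightarrow> 's" and X :: "'m \<Rightarrow> 'b"
  assumes "prob_space M" and S[measurable]: "S \<in> M \<rightarrow>\<^sub>M N" and X[measurable]: "X \<in> M \<rightarrow>\<^sub>M K"
    and k: "k \<in> N \<rightarrow>\<^sub>M prob_algebra K"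
    and rect: "\<And>A B. A \<in> sets N \<Longrightarrow> B \<in> sets K \<Longrightarrow>
     emeasure M {w\<in>space M. S w \<in> A \<and> X w \<in> B} = (\<integral>\<^sup>+w. indicator A (S w) * emeasure (k (S w)) B \<partial>M)"
    and f[measurable]: "f \<in> borel_measurable (N \<Otimes>\<^sub>M K)"
  shows "(\<integral>\<^sup>+w. f (S w, X w) \<partial>M) = (\<integral>\<^sup>+w. (\<integral>\<^sup>+x. f (S w, x) \<partial>k (S w)) \<partial>M)"
proof -
  interpret M: prob_space M by fact
  have ks[measurable]: "(\<lambda>w. k (S w)) \<in> M \<rightarrow>\<^sub>M subprob_algebra K"
    using measurable_compose[OF S measurable_prob_algebraD[OF k]] .
  have kp: "prob_space (k a)" "sets (k a) = sets K" if "a \<in> space N" for a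
    using measurable_space[OF k that] by (auto simp: space_prob_algebra)
  define P1 where "P1 = distr M (N \<Otimes>\<^sub>M K) (\<lambda>w. (S w, X w))"
  define J where "J w = distr (k (S w)) (N \<Otimes>\<^sub>M K) (\<lambda>x. (S w, x))" for w
  have J: "J \<in> M \<rightarrow>\<^sub>M subprob_algebra (N \<Otimes>\<^sub>M K)"
    unfolding J_def by (rule measurable_distr2[OF _ ks]) measurable
  have km: "k (S w) \<in> space (prob_algebra K)" "S w \<in> space N" if "w \<in> space M" for w
    using measurable_space[OF k] measurable_space[OF S that] by auto
  have Pair: "(\<lambda>x. (S w, x)) \<in> k (S w) \<rightarrow>\<^sub>M N \<Otimes>\<^sub>M K" if "w \<in> space M" for w
    by (subst measurable_cong_sets[OF kp(2)[OF km(2)[OF that]] refl]) (rule measurable_Pair1'[OF km(2)[OF that]])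
  have "P1 = bind M J"
  proof (rule measure_eqI_generator_eq[OF Int_stable_pair_measure_generator pair_measure_closed])
    show "sets P1 = sigma_sets (space N \<times> space K) {A \<times> B |A B. A \<in> sets N \<and> B \<in> sets K}"
      by (simp add: P1_def sets_pair_measure)
    show "sets (bind M J) = sigma_sets (space N \<times> space K) {A \<times> B |A B. A \<in> sets N \<and> B \<in> sets K}"
      using sets_bind[of M J "N \<Otimes>\<^sub>M K"] M.not_empty by (simp add: J_def sets_pair_measure)
    show "range (\<lambda>_::nat. space N \<times> space K) \<subseteq> {A \<times> B |A B. A \<in> sets N \<and> B \<in> sets K}" by auto
    show "emeasure P1 (space N \<times> space K) \<noteq> \<infinity>"
      by (simp add: P1_def emeasure_distr)
    fix C assume "C \<in> {A \<times> B |A B. A \<in> sets N \<and> B \<in> sets K}"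
    then obtain A B where C: "C = A \<times> B" and A[measurable]: "A \<in> sets N" and B[measurable]: "B \<in> sets K" by auto
    have "emeasure P1 C = emeasure M {w\<in>space M. S w \<in> A \<and> X w \<in> B}"
      unfolding P1_def C by (subst emeasure_distr) (auto intro!: arg_cong[where f="emeasure M"])
    also have "\<dots> = (\<integral>\<^sup>+w. emeasure (J w) C \<partial>M)"
      unfolding rect[OF A B]
    proof (rule nn_integral_cong)
      fix w assume w: "w \<in> space M"
      have "emeasure (J w) C = emeasure (k (S w)) ((\<lambda>x. (S w, x)) -` C \<inter> space (k (S w)))"
        unfolding J_def by (rule emeasure_distr[OF Pair[OF w]]) (simp add: C)
      also have "(\<lambda>x. (S w, x)) -` C \<inter> space (k (S w)) = (if S w \<in> A then B else {})"
        using sets.sets_into_space[OF B] sets_eq_imp_space_eq[OF kp(2)[OF km(2)[OF w]]] by (auto simp: C)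
      finally show "indicator A (S w) * emeasure (k (S w)) B = emeasure (J w) C"
        by (auto split: split_indicator)
    qed
    also have "\<dots> = emeasure (bind M J) C"
      using A B by (subst emeasure_bind[OF M.not_empty J]) (auto simp: C)
    finally show "emeasure P1 C = emeasure (bind M J) C" .
  qed auto
  then have "(\<integral>\<^sup>+z. f z \<partial>P1) = (\<integral>\<^sup>+w. \<integral>\<^sup>+z. f z \<partial>J w \<partial>M)"
    by (simp add: nn_integral_bind[OF f J])
  also have "\<dots> = (\<integral>\<^sup>+w. (\<integral>\<^sup>+x. f (S w, x) \<partial>k (S w)) \<partial>M)"
    unfolding J_def using Pair by (intro nn_integral_cong) (simp add: nn_integral_distr)
  also have "(\<integral>\<^sup>+z. f z \<partial>P1) = (\<integral>\<^sup>+w. f (S w, X w) \<partial>M)"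
    unfolding P1_def by (rule nn_integral_distr) measurable
  finally show ?thesis .
qed

section \<open>Powers and \<open>L\<^sup>p\<close> norms of extended nonnegative functions\<close>

lemma epowr_top [simp]: "epowr \<top> r = \<top>"
  by (simp add: epowr_def)

lemma epowr_0 [simp]: "epowr 0 r = 0"
  by (simp add: epowr_def)

lemma epowr_ennreal: "0 \<le> a \<Longrightarrow> epowr (ennreal a) r = ennreal (a powr r)"
  by (simp add: epowr_def)

lemma epowr_1_left [simp]: "epowr 1 r = 1"
  using epowr_ennreal[of 1 r] by simp

lemma epowr_1_right [simp]: "epowr x 1 = x"
  by (cases x) (auto simp: epowr_ennreal)

lemma epowr_epowr: "epowr (epowr x r) s = epowr x (r * s)"
  by (cases x) (auto simp: epowr_ennreal powr_powr)

lemma epowr_mono: "x \<le> y \<Longrightarrow> 0 \<le> r \<Longrightarrow> epowr x r \<le> epowr y r"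
  by (cases x; cases y) (auto simp: epowr_ennreal top_unique intro!: ennreal_leI powr_mono2)

lemma epowr_mult: "epowr (x * y) r = epowr x r * epowr y r"
proof (cases "x = 0 \<or> y = 0")
  case False
  show ?thesis
  proof (cases "x = \<top> \<or> y = \<top>")
    case True
    have "epowr z r \<noteq> 0" if "z \<noteq> 0" for z
      using that by (cases z) (auto simp: epowr_ennreal)
    from this[of x] this[of y] True False show ?thesis
      by (elim disjE) (simp_all add: ennreal_top_mult ennreal_mult_top)
  next
    case False
    then show ?thesis
      by (cases x; cases y) (auto simp: epowr_ennreal powr_mult simp flip: ennreal_mult)
  qed
qed auto

lemma epowr_eq_top_iff [simp]: "epowr x r = \<top> \<longleftrightarrow> x = \<top>"
  by (cases x) (auto simp: epowr_ennreal)

lemma epowr_inverse: "0 < r \<Longrightarrow> epowr (epowr x r) (1 / r) = x" "0 < r \<Longrightarrow> epowr (epowr x (1 / r)) r = x"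
  by (simp_all add: epowr_epowr)

lemma borel_measurable_epowr [measurable (raw)]:
  assumes [measurable]: "f \<in> borel_measurable M"
  shows "(\<lambda>x. epowr (f x) r) \<in> borel_measurable M"
  unfolding epowr_def by measurable

definition lpn :: "real \<Rightarrow> 'a measure \<Rightarrow> ('a \<Rightarrow> ennreal) \<Rightarrow> ennreal" where
  "lpn p M f = epowr (\<integral>\<^sup>+x. epowr (f x) p \<partial>M) (1 / p)"

lemma lpn_mono: "0 < p \<Longrightarrow> (\<And>x. x \<in> space M \<Longrightarrow> f x \<le> g x) \<Longrightarrow> lpn p M f \<le> lpn p M g"
  unfolding lpn_def by (intro epowr_mono nn_integral_mono) auto

lemma lpn_const: "prob_space M \<Longrightarrow> 0 < p \<Longrightarrow> lpn p M (\<lambda>_. c) = c"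
  unfolding lpn_def by (simp add: prob_space.emeasure_space_1 epowr_inverse)

lemma lpn_cmult: "f \<in> borel_measurable M \<Longrightarrow> 0 < p \<Longrightarrow> lpn p M (\<lambda>x. c * f x) = c * lpn p M f"
  unfolding lpn_def by (simp add: epowr_mult nn_integral_cmult epowr_inverse)

lemma lpn_distr:
  "T \<in> M \<rightarrow>\<^sub>M N \<Longrightarrow> f \<in> borel_measurable N \<Longrightarrow> lpn p (distr M N T) f = lpn p M (\<lambda>x. f (T x))"
  unfolding lpn_def by (simp add: nn_integral_distr)

text \<open>Convexity of the power at the points \<open>a / A\<close> and \<open>b / B\<close> with
  weights \<open>A / (A + B)\<close> and \<open>B / (A + B)\<close>. With \<open>A\<close> and
  \<open>B\<close> close to the norms of two functions, integration yields Minkowski's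
  inequality.\<close>

lemma convex_powr_weighted:
  fixes a b A B p :: real
  assumes "1 \<le> p" "0 < A" "0 < B" "0 \<le> a" "0 \<le> b"
  shows "(a + b) powr p \<le> (A + B) powr (p - 1) * (A powr (1 - p) * a powr p + B powr (1 - p) * b powr p)"
proof -
  define s where "s = A + B"
  have s: "0 < s" using assms by (simp add: s_def)
  have conv: "(x * (A / s) + y * (B / s)) powr p \<le> (A / s) * x powr p + (B / s) * y powr p"
    if xy: "0 \<le> x" "0 \<le> y" for x y
  proof -
    have AB: "A / s + B / s = 1" using s by (simp add: s_def add_divide_distrib[symmetric])
    have Bs: "0 < A / s" "0 < B / s" "A / s \<le> 1" "B / s \<le> 1" using assms s by (auto simp: s_def)
    \<comment> \<open>For the cases in which one argument vanishes.\<close>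
    have le: "(t * z) powr p \<le> t * z powr p" if "0 < t" "t \<le> 1" "0 \<le> z" for t z :: real
    proof -
      have "t powr p \<le> t powr 1" using that assms by (intro powr_mono') auto
      then show ?thesis using that by (simp add: powr_mult mult_right_mono)
    qed
    consider "x = 0" | "y = 0" | "0 < x" "0 < y" using xy by linarith
    then show ?thesis
    proof cases
      case 1 then show ?thesis using le[of "B/s" y] Bs xy assms by (simp add: mult.commute)
    next
      case 2 then show ?thesis using le[of "A/s" x] Bs xy assms by (simp add: mult.commute)
    next
      case 3
      have e: "1 - B / s = A / s" using AB by simp
      have "((1 - B / s) *\<^sub>R x + (B / s) *\<^sub>R y) powr p \<le> (1 - B / s) * x powr p + (B / s) * y powr p"
        using 3 Bs by (intro convex_onD[OF powr_convex[OF assms(1)]]) auto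
      then show ?thesis unfolding e by (simp only: real_scaleR_def mult.commute)
    qed
  qed
  have "a + b = s * ((a / A) * (A / s) + (b / B) * (B / s))"
    using assms s by (simp add: distrib_left)
  then have "(a + b) powr p = (s * ((a / A) * (A / s) + (b / B) * (B / s))) powr p" by simp
  also have "\<dots> = s powr p * ((a / A) * (A / s) + (b / B) * (B / s)) powr p"
    by (rule powr_mult)
  also have "\<dots> \<le> s powr p * ((A / s) * (a / A) powr p + (B / s) * (b / B) powr p)"
    using assms by (intro mult_left_mono conv) auto
  also have "\<dots> = s powr (p - 1) * (A powr (1 - p) * a powr p + B powr (1 - p) * b powr p)"
    using assms s by (simp add: powr_divide powr_diff field_simps)
  finally show ?thesis by (simp add: s_def)
qed

lemma lpn_add_le:
  assumes p: "1 \<le> p" and [measurable]: "f \<in> borel_measurable M" "g \<in> borel_measurable M"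
  shows "lpn p M (\<lambda>x. f x + g x) \<le> lpn p M f + lpn p M g"
proof (rule ennreal_le_epsilon)
  fix e :: real assume fin: "lpn p M f + lpn p M g < \<top>" and e: "0 < e"
  obtain f0 g0 where f0: "lpn p M f = ennreal f0" "0 \<le> f0" and g0: "lpn p M g = ennreal g0" "0 \<le> g0"
    using fin by (cases "lpn p M f"; cases "lpn p M g") auto
  \<comment> \<open>The extra \<open>e / 2\<close> keeps \<open>A\<close> and \<open>B\<close>
    positive when a norm vanishes.\<close>
  define A where "A = f0 + e / 2"
  define B where "B = g0 + e / 2"
  have AB: "0 < A" "0 < B" using e f0 g0 by (auto simp: A_def B_def intro: add_nonneg_pos)
  have lf: "lpn p M f \<le> ennreal A" "lpn p M g \<le> ennreal B"
    using e by (auto simp: A_def B_def f0 g0 intro!: ennreal_leI)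
  have nf: "(\<integral>\<^sup>+x. epowr (f x) p \<partial>M) \<le> ennreal (A powr p)" if "lpn p M f \<le> ennreal A" "0 < A" for f A
    using epowr_mono[OF that(1), of p] p that(2) by (simp add: lpn_def epowr_inverse epowr_ennreal)
  let ?s = "ennreal ((A + B) powr (p - 1))" and ?a = "ennreal (A powr (1 - p))" and ?b = "ennreal (B powr (1 - p))"
  have pt: "epowr (u + v) p \<le> ?s * (?a * epowr u p + ?b * epowr v p)" for u v
  proof (cases "u = \<top> \<or> v = \<top>")
    case True
    then have "?s * (?a * epowr u p + ?b * epowr v p) = \<top>"
      using AB by (auto simp: ennreal_mult_eq_top_iff)
    then show ?thesis by simp
  next
    case False
    then show ?thesis using convex_powr_weighted[OF p AB] AB p
      by (cases u; cases v) (auto simp: epowr_ennreal simp flip: ennreal_plus ennreal_mult)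
  qed
  have "(\<integral>\<^sup>+x. epowr (f x + g x) p \<partial>M) \<le> (\<integral>\<^sup>+x. ?s * (?a * epowr (f x) p + ?b * epowr (g x) p) \<partial>M)"
    by (intro nn_integral_mono pt)
  also have "\<dots> = ?s * (?a * (\<integral>\<^sup>+x. epowr (f x) p \<partial>M) + ?b * (\<integral>\<^sup>+x. epowr (g x) p \<partial>M))"
    by (simp add: nn_integral_cmult nn_integral_add)
  also have "\<dots> \<le> ?s * (?a * ennreal (A powr p) + ?b * ennreal (B powr p))"
    by (intro mult_left_mono add_mono nf lf AB) auto
  also have "\<dots> = ennreal ((A + B) powr p)"
  proof -
    have "(A + B) powr (p - 1) * (A powr (1 - p) * A powr p + B powr (1 - p) * B powr p) = (A + B) powr p"
      using AB powr_mult_base[of "A + B" "p - 1"] by (simp add: powr_add[symmetric] mult.commute)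
    then show ?thesis using AB by (simp flip: ennreal_plus ennreal_mult)
  qed
  finally have "lpn p M (\<lambda>x. f x + g x) \<le> epowr (ennreal ((A + B) powr p)) (1 / p)"
    unfolding lpn_def using p by (intro epowr_mono) auto
  also have "\<dots> = ennreal (A + B)" using AB p by (simp add: epowr_ennreal powr_powr)
  also have "\<dots> = lpn p M f + lpn p M g + ennreal e"
    using e f0 g0 by (simp add: A_def B_def flip: ennreal_plus)
  finally show "lpn p M (\<lambda>x. f x + g x) \<le> lpn p M f + lpn p M g + ennreal e" .
qed

lemma lpn_0 [simp]: "lpn p M (\<lambda>_. 0) = 0"
  by (simp add: lpn_def)

lemma lpn_sum_le:
  assumes p: "1 \<le> p" and "finite I" and "\<And>i. i \<in> I \<Longrightarrow> f i \<in> borel_measurable M"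
  shows "lpn p M (\<lambda>x. \<Sum>i\<in>I. f i x) \<le> (\<Sum>i\<in>I. lpn p M (f i))"
  using assms(2,3)
proof induction
  case (insert i I)
  have "lpn p M (\<lambda>x. f i x + (\<Sum>i\<in>I. f i x)) \<le> lpn p M (f i) + lpn p M (\<lambda>x. \<Sum>i\<in>I. f i x)"
    using insert.prems by (intro lpn_add_le p) auto
  also have "\<dots> \<le> lpn p M (f i) + (\<Sum>i\<in>I. lpn p M (f i))"
    using insert by (intro add_left_mono) auto
  finally show ?case using insert by simp
qed simp

text \<open>Minkowski's inequality for functions with disjoint supports on the index set.\<close>

lemma epowr_sum_le:
  assumes p: "1 \<le> p" and I: "finite I"
  shows "epowr (\<Sum>i\<in>I. a i) (1 / p) \<le> (\<Sum>i\<in>I. epowr (a i) (1 / p))"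
proof -
  define f where "f i j = (if i = j then epowr (a i) (1 / p) else 0)" for i j
  have "epowr (\<Sum>i\<in>I. a i) (1 / p) = lpn p (count_space I) (\<lambda>j. \<Sum>i\<in>I. f i j)"
    using I p unfolding lpn_def
    by (auto simp: nn_integral_count_space_finite f_def epowr_inverse intro!: arg_cong2[where f=epowr] sum.cong)
  also have "\<dots> \<le> (\<Sum>i\<in>I. lpn p (count_space I) (f i))"
    by (intro lpn_sum_le p I) auto
  also have "\<dots> = (\<Sum>i\<in>I. epowr (a i) (1 / p))"
  proof (rule sum.cong[OF refl])
    fix i assume i: "i \<in> I"
    have "(\<Sum>j\<in>I. epowr (f i j) p) = (\<Sum>j\<in>I. if i = j then a i else 0)"
      using p by (intro sum.cong) (auto simp: f_def epowr_inverse)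
    then show "lpn p (count_space I) (f i) = epowr (a i) (1 / p)"
      using I i unfolding lpn_def by (simp add: nn_integral_count_space_finite)
  qed
  finally show ?thesis .
qed

lemma epowr_add_le: "1 \<le> p \<Longrightarrow> epowr (a + b) (1 / p) \<le> epowr a (1 / p) + epowr b (1 / p)"
  using epowr_sum_le[of p "{True, False}" "\<lambda>i. if i then a else b"] by simp

section \<open>Measurable selection of nearly optimal discrete couplings\<close>

lemma measurable_finite_selection:
  fixes h :: "'i \<Rightarrow> 'm \<Rightarrow> real"
  assumes I: "finite I" and sel[measurable]: "sel \<in> M \<rightarrow>\<^sub>M count_space UNIV" and "\<And>w. sel w \<in> I"
    and [measurable]: "\<And>i. i \<in> I \<Longrightarrow> h i \<in> borel_measurable M"
  shows "(\<lambda>w. h (sel w) w) \<in> borel_measurable M"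
proof -
  have "(\<lambda>w. \<Sum>i\<in>I. of_bool (sel w = i) * h i w) \<in> borel_measurable M"
    unfolding of_bool_def by measurable
  also have "(\<lambda>w. \<Sum>i\<in>I. of_bool (sel w = i) * h i w) = (\<lambda>w. h (sel w) w)"
  proof
    fix w
    have "(\<Sum>i\<in>I. of_bool (sel w = i) * h i w) = (\<Sum>i\<in>I. if i = sel w then h i w else 0)"
      by (intro sum.cong) auto
    then show "(\<Sum>i\<in>I. of_bool (sel w = i) * h i w) = h (sel w) w"
      using I assms(3) by simp
  qed
  finally show ?thesis .
qed

text \<open>Measurability of the attained cost is carried along for the induction: it makes the
  comparison with a new candidate measurable.\<close>

lemma measurable_finite_argmin:
  fixes c :: "'i \<Rightarrow> 'm \<Rightarrow> ennreal"
  assumes "finite I" "I \<noteq> {}" "\<And>i. i \<in> I \<Longrightarrow> c i \<in> borel_measurable M"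
  shows "\<exists>sel. sel \<in> M \<rightarrow>\<^sub>M count_space UNIV \<and> (\<lambda>w. c (sel w) w) \<in> borel_measurable M \<and>
    (\<forall>w. sel w \<in> I \<and> (\<forall>i\<in>I. c (sel w) w \<le> c i w))"
  using assms
proof (induction rule: finite_ne_induct)
  case (singleton i) then show ?case by (intro exI[of _ "\<lambda>_. i"]) auto
next
  case (insert i I)
  then obtain sel where [measurable]: "sel \<in> M \<rightarrow>\<^sub>M count_space UNIV"
      "(\<lambda>w. c (sel w) w) \<in> borel_measurable M" "c i \<in> borel_measurable M"
    and sel: "\<And>w. sel w \<in> I" "\<And>w j. j \<in> I \<Longrightarrow> c (sel w) w \<le> c j w" by auto
  let ?sel = "\<lambda>w. if c i w \<le> c (sel w) w then i else sel w"
  have "(\<lambda>w. c (?sel w) w) = (\<lambda>w. min (c i w) (c (sel w) w))" by (auto simp: min_def)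
  then have "(\<lambda>w. c (?sel w) w) \<in> borel_measurable M" by simp
  moreover have "?sel \<in> M \<rightarrow>\<^sub>M count_space UNIV" by measurable
  moreover have "?sel w \<in> insert i I \<and> (\<forall>j\<in>insert i I. c (?sel w) w \<le> c j w)" for w
    using sel(1)[of w] sel(2)[of _ w] by (auto intro: order_trans)
  ultimately show ?case by (intro exI[of _ ?sel]) blast
qed

text \<open>A sub-coupling \<open>k\<close> is completed by the product of the missing marginals. If nothing is missing
  the quotient is \<open>0 / 0 = 0\<close>, as it should be.\<close>

definition complete_coupling ::
  "'i set \<Rightarrow> ('i \<Rightarrow> real) \<Rightarrow> ('i \<Rightarrow> real) \<Rightarrow> ('i \<Rightarrow> 'i \<Rightarrow> real) \<Rightarrow> 'i \<Rightarrow> 'i \<Rightarrow> real" where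
  "complete_coupling I u v k i j = k i j +
     (u i - (\<Sum>j\<in>I. k i j)) * (v j - (\<Sum>i\<in>I. k i j)) / (1 - (\<Sum>i\<in>I. \<Sum>j\<in>I. k i j))"

text \<open>The row deficits and the column deficits have the same total \<open>t\<close>, so adding
  \<open>a i * b j / t\<close> restores both marginals. The added mass is \<open>t\<close>, which
  costs at most \<open>C * t\<close>.\<close>

lemma complete_coupling:
  assumes I: "finite I" and u: "(\<Sum>i\<in>I. u i) = 1" and v: "(\<Sum>i\<in>I. v i) = 1"
    and k: "\<And>i j. i \<in> I \<Longrightarrow> j \<in> I \<Longrightarrow> 0 \<le> k i j"
    and row: "\<And>i. i \<in> I \<Longrightarrow> (\<Sum>j\<in>I. k i j) \<le> u i" and col: "\<And>j. j \<in> I \<Longrightarrow> (\<Sum>i\<in>I. k i j) \<le> v j"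
  shows "i \<in> I \<Longrightarrow> j \<in> I \<Longrightarrow> 0 \<le> complete_coupling I u v k i j"
    and "i \<in> I \<Longrightarrow> (\<Sum>j\<in>I. complete_coupling I u v k i j) = u i"
    and "j \<in> I \<Longrightarrow> (\<Sum>i\<in>I. complete_coupling I u v k i j) = v j"
    and "(\<And>i j. i \<in> I \<Longrightarrow> j \<in> I \<Longrightarrow> 0 \<le> c i j \<and> c i j \<le> C) \<Longrightarrow>
      (\<Sum>i\<in>I. \<Sum>j\<in>I. c i j * complete_coupling I u v k i j) \<le>
      (\<Sum>i\<in>I. \<Sum>j\<in>I. c i j * k i j) + C * (1 - (\<Sum>i\<in>I. \<Sum>j\<in>I. k i j))"
proof -
  define a where "a i = u i - (\<Sum>j\<in>I. k i j)" for i
  define b where "b j = v j - (\<Sum>i\<in>I. k i j)" for j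
  define t where "t = 1 - (\<Sum>i\<in>I. \<Sum>j\<in>I. k i j)"
  have a0: "0 \<le> a i" if "i \<in> I" for i using row that by (simp add: a_def)
  have b0: "0 \<le> b i" if "i \<in> I" for i using col that by (simp add: b_def)
  have sa: "(\<Sum>i\<in>I. a i) = t" by (simp add: a_def t_def sum_subtractf u)
  have sb: "(\<Sum>i\<in>I. b i) = t"
    by (simp add: b_def t_def sum_subtractf v) (rule sum.swap)
  have t0: "0 \<le> t" using sum_nonneg[of I a] a0 sa by simp
  have cc: "complete_coupling I u v k i j = k i j + a i * b j / t" for i j
    by (simp add: complete_coupling_def a_def b_def t_def)
  have az: "a i = 0" if "t = 0" "i \<in> I" for i
    using sa a0 that I by (simp add: sum_nonneg_eq_0_iff)
  have bz: "b i = 0" if "t = 0" "i \<in> I" for i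
    using sb b0 that I by (simp add: sum_nonneg_eq_0_iff)
  show "i \<in> I \<Longrightarrow> j \<in> I \<Longrightarrow> 0 \<le> complete_coupling I u v k i j"
    unfolding cc using k a0 b0 t0 by simp
  show "(\<Sum>j\<in>I. complete_coupling I u v k i j) = u i" if "i \<in> I"
  proof -
    have "(\<Sum>j\<in>I. complete_coupling I u v k i j) = (\<Sum>j\<in>I. k i j) + a i * (\<Sum>j\<in>I. b j) / t"
      unfolding cc by (simp add: sum.distrib sum_distrib_left sum_divide_distrib)
    also have "\<dots> = (\<Sum>j\<in>I. k i j) + a i" using az that sb by (cases "t = 0") auto
    finally show ?thesis by (simp add: a_def)
  qed
  show "(\<Sum>i\<in>I. complete_coupling I u v k i j) = v j" if "j \<in> I"
  proof -
    have "(\<Sum>i\<in>I. complete_coupling I u v k i j) = (\<Sum>i\<in>I. k i j) + (\<Sum>i\<in>I. a i) * b j / t"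
      unfolding cc by (simp add: sum.distrib sum_distrib_right sum_divide_distrib)
    also have "\<dots> = (\<Sum>i\<in>I. k i j) + b j" using bz that sa by (cases "t = 0") auto
    finally show ?thesis by (simp add: b_def)
  qed
  assume c: "\<And>i j. i \<in> I \<Longrightarrow> j \<in> I \<Longrightarrow> 0 \<le> c i j \<and> c i j \<le> C"
  have "(\<Sum>i\<in>I. \<Sum>j\<in>I. c i j * (a i * b j / t)) \<le> (\<Sum>i\<in>I. \<Sum>j\<in>I. C * (a i * b j / t))"
    using a0 b0 t0 c by (intro sum_mono mult_right_mono) auto
  also have "\<dots> = C * ((\<Sum>i\<in>I. a i) * (\<Sum>j\<in>I. b j) / t)"
    by (subst sum_product) (simp add: sum_distrib_left sum_divide_distrib)
  also have "\<dots> = C * t" by (simp add: sa sb)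
  finally show "(\<Sum>i\<in>I. \<Sum>j\<in>I. c i j * complete_coupling I u v k i j) \<le>
      (\<Sum>i\<in>I. \<Sum>j\<in>I. c i j * k i j) + C * (1 - (\<Sum>i\<in>I. \<Sum>j\<in>I. k i j))"
    unfolding cc by (simp add: distrib_left sum.distrib t_def)
qed

definition is_coupling_matrix ::
  "'i set \<Rightarrow> ('i \<Rightarrow> real) \<Rightarrow> ('i \<Rightarrow> real) \<Rightarrow> ('i \<Rightarrow> 'i \<Rightarrow> real) \<Rightarrow> bool" where
  "is_coupling_matrix I u v q \<longleftrightarrow> (\<forall>i\<in>I. \<forall>j\<in>I. 0 \<le> q i j) \<and>
     (\<forall>i\<in>I. (\<Sum>j\<in>I. q i j) = u i) \<and> (\<forall>j\<in>I. (\<Sum>i\<in>I. q i j) = v j)"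

text \<open>The candidates are the completions of the finitely many sub-couplings with entries in
  \<open>{0, 1/m, \<dots>, 1}\<close>.\<close>

lemma measurable_coupling_matrix_selection:
  fixes u v :: "'m \<Rightarrow> 'i \<Rightarrow> real" and c :: "'i \<Rightarrow> 'i \<Rightarrow> real"
  assumes I: "finite I"
    and [measurable]: "\<And>i. i \<in> I \<Longrightarrow> (\<lambda>w. u w i) \<in> borel_measurable M"
      "\<And>i. i \<in> I \<Longrightarrow> (\<lambda>w. v w i) \<in> borel_measurable M"
    and u: "\<And>w i. i \<in> I \<Longrightarrow> 0 \<le> u w i" "\<And>w. (\<Sum>i\<in>I. u w i) = 1"
    and v: "\<And>w i. i \<in> I \<Longrightarrow> 0 \<le> v w i" "\<And>w. (\<Sum>i\<in>I. v w i) = 1"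
    and c: "\<And>i j. i \<in> I \<Longrightarrow> j \<in> I \<Longrightarrow> 0 \<le> c i j" and \<eta>: "0 < \<eta>"
  shows "\<exists>q. (\<forall>i\<in>I. \<forall>j\<in>I. (\<lambda>w. q w i j) \<in> borel_measurable M) \<and>
    (\<forall>w. is_coupling_matrix I (u w) (v w) (q w) \<and>
      (\<forall>r. is_coupling_matrix I (u w) (v w) r \<longrightarrow>
        (\<Sum>i\<in>I. \<Sum>j\<in>I. c i j * q w i j) \<le> (\<Sum>i\<in>I. \<Sum>j\<in>I. c i j * r i j) + \<eta>))"
proof -
  define C where "C = (\<Sum>i\<in>I. \<Sum>j\<in>I. c i j)"
  have cC: "0 \<le> c i j \<and> c i j \<le> C" if "i \<in> I" "j \<in> I" for i j
  proof -
    have "c i j \<le> (\<Sum>j\<in>I. c i j)" using I c that by (intro member_le_sum) auto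
    also have "\<dots> \<le> C" unfolding C_def using I c that by (intro member_le_sum sum_nonneg) auto
    finally show ?thesis using c that by simp
  qed
  have C0: "0 \<le> C" unfolding C_def by (intro sum_nonneg c)
  \<comment> \<open>Rounding all entries down to multiples of \<open>1 / m\<close> loses at most
    \<open>(card I)\<^sup>2 / m\<close> of mass, and completing it costs at most \<open>C\<close>
    per unit.\<close>
  obtain m :: nat where m: "C * (card I)\<^sup>2 / \<eta> < m" using reals_Archimedean2 by blast
  then have m0: "0 < m" using C0 \<eta>
    by (metis divide_nonneg_pos mult_nonneg_nonneg of_nat_0_le_iff of_nat_0_less_iff order_le_less_trans)
  have mC: "C * ((card I)\<^sup>2 / m) \<le> \<eta>" using m m0 \<eta> by (simp add: field_simps)
  define F where "F = (I \<times> I) \<rightarrow>\<^sub>E {0..m}"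
  define k where "k f i j = real (f (i, j)) / real m" for f :: "'i \<times> 'i \<Rightarrow> nat" and i j
  have F: "finite F" using I by (auto simp: F_def intro!: finite_PiE)
  define valid where "valid f w \<longleftrightarrow> (\<forall>i\<in>I. (\<Sum>j\<in>I. k f i j) \<le> u w i) \<and> (\<forall>j\<in>I. (\<Sum>i\<in>I. k f i j) \<le> v w j)" for f w
  define Q where "Q f w = complete_coupling I (u w) (v w) (k f)" for f w
  \<comment> \<open>Cost \<open>\<top>\<close> excludes matrices that exceed a marginal at
    \<open>w\<close>. The zero matrix is valid everywhere (its completion is the product coupling),
    so the minimum is attained at a valid candidate.\<close>
  define cost where "cost f w = (if valid f w then ennreal (\<Sum>i\<in>I. \<Sum>j\<in>I. c i j * Q f w i j) else \<top>)" for f w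
  have k0: "0 \<le> k f i j" for f i j by (simp add: k_def)
  have Qm[measurable]: "(\<lambda>w. Q f w i j) \<in> borel_measurable M" if "i \<in> I" "j \<in> I" for f i j
    unfolding Q_def complete_coupling_def using that by measurable
  have [measurable]: "Measurable.pred M (valid f)" for f
    unfolding valid_def using I countable_finite[OF I] by measurable
  have cm: "cost f \<in> borel_measurable M" for f
    unfolding cost_def by measurable
  define z where "z = restrict (\<lambda>_. 0 :: nat) (I \<times> I)"
  have zF: "z \<in> F" by (auto simp: z_def F_def)
  have kz: "k z i j = 0" if "i \<in> I" "j \<in> I" for i j using that by (simp add: k_def z_def)
  have vz: "valid z w" for w
    using u v by (auto simp: valid_def kz)
  obtain sel where sel: "sel \<in> M \<rightarrow>\<^sub>M count_space UNIV" "\<And>w. sel w \<in> F"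
    "\<And>w f. f \<in> F \<Longrightarrow> cost (sel w) w \<le> cost f w"
    using measurable_finite_argmin[of F cost M] F cm zF by blast
  have vs: "valid (sel w) w" for w
    using sel(3)[OF zF, of w] vz[of w] by (auto simp: cost_def top_unique split: if_splits)
  have Qc: "is_coupling_matrix I (u w) (v w) (Q f w)" if "valid f w" for f w
    using complete_coupling(1-3)[OF I u(2) v(2) k0] that
    unfolding is_coupling_matrix_def Q_def valid_def by simp
  have Q0: "0 \<le> (\<Sum>i\<in>I. \<Sum>j\<in>I. c i j * Q f w i j)" if "valid f w" for f w
    using Qc[OF that] c by (auto simp: is_coupling_matrix_def intro!: sum_nonneg)
  have opt: "(\<Sum>i\<in>I. \<Sum>j\<in>I. c i j * Q (sel w) w i j) \<le> (\<Sum>i\<in>I. \<Sum>j\<in>I. c i j * r i j) + \<eta>"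
    if r: "is_coupling_matrix I (u w) (v w) r" for w r
  proof -
    have r0: "0 \<le> r i j" if "i \<in> I" "j \<in> I" for i j using r that by (auto simp: is_coupling_matrix_def)
    have r1: "r i j \<le> 1" if "i \<in> I" "j \<in> I" for i j
    proof -
      have "r i j \<le> (\<Sum>j\<in>I. r i j)" using I r0 that by (intro member_le_sum) auto
      also have "\<dots> = u w i" using r that by (auto simp: is_coupling_matrix_def)
      also have "\<dots> \<le> (\<Sum>i\<in>I. u w i)" using I u that by (intro member_le_sum) auto
      finally show ?thesis by (simp add: u)
    qed
    \<comment> \<open>The competitor for \<open>r\<close>: rounding every entry down can only
      decrease row and column sums, so the result is a sub-coupling.\<close>
    define f where "f = restrict (\<lambda>(i, j). nat \<lfloor>real m * r i j\<rfloor>) (I \<times> I)"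
    have kf: "k f i j \<le> r i j" "r i j - k f i j \<le> 1 / m" if "i \<in> I" "j \<in> I" for i j
    proof -
      have k: "k f i j = of_int \<lfloor>real m * r i j\<rfloor> / m" using that r0[OF that] by (simp add: k_def f_def)
      have "of_int \<lfloor>real m * r i j\<rfloor> \<le> real m * r i j" by simp
      then show "k f i j \<le> r i j" unfolding k using m0 by (simp add: field_simps)
      have "real m * r i j - of_int \<lfloor>real m * r i j\<rfloor> \<le> 1" by linarith
      then have "(real m * r i j - of_int \<lfloor>real m * r i j\<rfloor>) / m \<le> 1 / m" by (rule divide_right_mono) simp
      then show "r i j - k f i j \<le> 1 / m" unfolding k using m0 by (simp add: diff_divide_distrib)
    qed
    have "nat \<lfloor>real m * r i j\<rfloor> \<le> m" if "i \<in> I" "j \<in> I" for i j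
    proof -
      have "real m * r i j \<le> real m" using r1[OF that] by (simp add: mult_left_le)
      then show ?thesis by linarith
    qed
    then have fF: "f \<in> F" by (auto simp: F_def f_def)
    have vf: "valid f w" unfolding valid_def
    proof safe
      fix i assume i: "i \<in> I"
      have "(\<Sum>j\<in>I. k f i j) \<le> (\<Sum>j\<in>I. r i j)" "(\<Sum>j\<in>I. k f j i) \<le> (\<Sum>j\<in>I. r j i)"
        using kf(1) i by (auto intro: sum_mono)
      then show "(\<Sum>j\<in>I. k f i j) \<le> u w i" "(\<Sum>j\<in>I. k f j i) \<le> v w i"
        using r i by (auto simp: is_coupling_matrix_def)
    qed
    have tot: "1 - (\<Sum>i\<in>I. \<Sum>j\<in>I. k f i j) \<le> (card I)\<^sup>2 / m"
    proof -
      have "(\<Sum>i\<in>I. \<Sum>j\<in>I. r i j) = 1" using r u(2) by (simp add: is_coupling_matrix_def)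
      then have "1 - (\<Sum>i\<in>I. \<Sum>j\<in>I. k f i j) = (\<Sum>i\<in>I. \<Sum>j\<in>I. r i j - k f i j)"
        by (simp add: sum_subtractf)
      also have "\<dots> \<le> (\<Sum>i\<in>I. \<Sum>j\<in>I. 1 / m)" using kf(2) by (intro sum_mono)
      finally show ?thesis by (simp add: power2_eq_square)
    qed
    have "ennreal (\<Sum>i\<in>I. \<Sum>j\<in>I. c i j * Q (sel w) w i j) \<le> ennreal (\<Sum>i\<in>I. \<Sum>j\<in>I. c i j * Q f w i j)"
      using sel(3)[OF fF, of w] vs[of w] vf by (simp add: cost_def)
    then have "(\<Sum>i\<in>I. \<Sum>j\<in>I. c i j * Q (sel w) w i j) \<le> (\<Sum>i\<in>I. \<Sum>j\<in>I. c i j * Q f w i j)"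
      using Q0[OF vf] by (simp add: ennreal_le_iff)
    also have "\<dots> \<le> (\<Sum>i\<in>I. \<Sum>j\<in>I. c i j * k f i j) + C * (1 - (\<Sum>i\<in>I. \<Sum>j\<in>I. k f i j))"
      unfolding Q_def using vf by (intro complete_coupling(4)[OF I u(2) v(2) k0] cC) (auto simp: valid_def)
    also have "\<dots> \<le> (\<Sum>i\<in>I. \<Sum>j\<in>I. c i j * r i j) + C * ((card I)\<^sup>2 / m)"
      using kf c C0 tot by (intro add_mono sum_mono mult_left_mono) auto
    finally show ?thesis using mC by simp
  qed
  show ?thesis
  proof (intro exI[of _ "\<lambda>w. Q (sel w) w"] conjI ballI allI impI)
    show "(\<lambda>w. Q (sel w) w i j) \<in> borel_measurable M" if "i \<in> I" "j \<in> I" for i j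
      by (rule measurable_finite_selection[OF F sel(1,2)]) (rule Qm[OF that])
    show "is_coupling_matrix I (u w) (v w) (Q (sel w) w)" for w by (rule Qc[OF vs])
  qed (rule opt)
qed

section \<open>Discretisation and the Wasserstein distance\<close>

lemma epowr_norm: "ennreal (norm x powr p) = epowr (ennreal (norm x)) p"
  by (simp add: epowr_ennreal)

text \<open>Simple functions bounded by \<open>2 * norm x\<close> converge pointwise to the
  identity; the majorant \<open>3 powr p * norm x powr p\<close> turns this into convergence of the
  p-th moments of the error.\<close>

lemma simple_approximation_Lp:
  fixes \<alpha> :: "'a::euclidean_space measure"
  assumes p: "1 \<le> p" and \<alpha>: "sets \<alpha> = sets borel" and fin: "(\<integral>\<^sup>+x. ennreal (norm x powr p) \<partial>\<alpha>) < \<top>" and e: "0 < e"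
  shows "\<exists>\<rho> :: 'a \<Rightarrow> 'a. \<rho> \<in> borel_measurable borel \<and> finite (range \<rho>) \<and>
    lpn p \<alpha> (\<lambda>x. ennreal (norm (x - \<rho> x))) \<le> ennreal e"
proof -
  note [measurable_cong] = \<alpha>
  have sp: "space \<alpha> = UNIV" using sets_eq_imp_space_eq[OF \<alpha>] by simp
  have "(\<lambda>x. x) \<in> borel_measurable \<alpha>" by measurable
  then obtain F where F: "\<And>i. simple_function \<alpha> (F i)" "\<And>x. (\<lambda>i. F i x) \<longlonglongrightarrow> x"
    "\<And>i x. dist (F i x) 0 \<le> 2 * dist x (0 :: 'a)"
    using borel_measurable_implies_sequence_metric[of "\<lambda>x. x" \<alpha> 0] sp by auto
  have Fm[measurable]: "F i \<in> borel_measurable \<alpha>" for i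
    using F(1) by (rule borel_measurable_simple_function)
  have bound: "norm (x - F i x) powr p \<le> 3 powr p * norm x powr p" for i x
  proof -
    have "norm (x - F i x) \<le> 3 * norm x"
      using norm_triangle_ineq4[of x "F i x"] F(3)[of i x] by simp
    then have "norm (x - F i x) powr p \<le> (3 * norm x) powr p" using p by (intro powr_mono2) auto
    then show ?thesis by (simp add: powr_mult)
  qed
  have "(\<lambda>i. \<integral>\<^sup>+x. ennreal (norm (x - F i x) powr p) \<partial>\<alpha>) \<longlonglongrightarrow> (\<integral>\<^sup>+x. 0 \<partial>\<alpha>)"
  proof (rule nn_integral_dominated_convergence)
    show "AE x in \<alpha>. ennreal (norm (x - F i x) powr p) \<le> ennreal (3 powr p) * ennreal (norm x powr p)" for i
      using bound by (intro AE_I2) (simp flip: ennreal_mult)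
    have "(\<integral>\<^sup>+x. ennreal (3 powr p) * ennreal (norm x powr p) \<partial>\<alpha>) =
        ennreal (3 powr p) * (\<integral>\<^sup>+x. ennreal (norm x powr p) \<partial>\<alpha>)"
      by (rule nn_integral_cmult) measurable
    then show "(\<integral>\<^sup>+x. ennreal (3 powr p) * ennreal (norm x powr p) \<partial>\<alpha>) < \<infinity>"
      using fin by (simp add: ennreal_mult_less_top)
    show "AE x in \<alpha>. (\<lambda>i. ennreal (norm (x - F i x) powr p)) \<longlonglongrightarrow> 0"
    proof (rule AE_I2)
      fix x
      have "(\<lambda>i. norm (x - F i x)) \<longlonglongrightarrow> norm (x - x)"
        by (intro tendsto_intros F(2))
      then have "(\<lambda>i. norm (x - F i x) powr p) \<longlonglongrightarrow> 0 powr p"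
        using p by (intro tendsto_powr2 tendsto_const) auto
      then show "(\<lambda>i. ennreal (norm (x - F i x) powr p)) \<longlonglongrightarrow> 0"
        using tendsto_ennrealI by fastforce
    qed
  qed measurable
  then have "\<forall>\<^sub>F i in sequentially. (\<integral>\<^sup>+x. ennreal (norm (x - F i x) powr p) \<partial>\<alpha>) < ennreal (e powr p)"
    using e by (intro order_tendstoD) auto
  then obtain i where i: "(\<integral>\<^sup>+x. ennreal (norm (x - F i x) powr p) \<partial>\<alpha>) < ennreal (e powr p)"
    by (auto simp: eventually_sequentially)
  have "lpn p \<alpha> (\<lambda>x. ennreal (norm (x - F i x))) \<le> epowr (ennreal (e powr p)) (1 / p)"
    using i p unfolding lpn_def epowr_norm by (intro epowr_mono) auto
  also have "\<dots> = ennreal e" using e p by (simp add: epowr_ennreal powr_powr)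
  finally have "lpn p \<alpha> (\<lambda>x. ennreal (norm (x - F i x))) \<le> ennreal e" .
  moreover have "finite (range (F i))" using simple_functionD(1)[OF F(1)[of i]] sp by simp
  moreover have "F i \<in> borel_measurable borel" using Fm[of i] measurable_cong_sets[OF \<alpha> refl] by blast
  ultimately show ?thesis by blast
qed

lemma coupling_prob_space:
  assumes "prob_space \<alpha>" "\<pi> \<in> couplings \<alpha> \<beta>"
  shows "prob_space \<pi>"
proof (rule prob_spaceI)
  have s: "sets \<pi> = sets (borel \<Otimes>\<^sub>M borel)" and d: "distr \<pi> borel fst = \<alpha>" using assms by (auto simp: couplings_def)
  have [measurable]: "fst \<in> \<pi> \<rightarrow>\<^sub>M borel" using measurable_cong_sets[OF s refl] by auto
  have "space \<alpha> = UNIV" unfolding d[symmetric] by simp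
  then have "1 = emeasure (distr \<pi> borel fst) UNIV" using prob_space.emeasure_space_1[OF assms(1)] d by simp
  also have "\<dots> = emeasure \<pi> (space \<pi>)" by (subst emeasure_distr) auto
  finally show "emeasure \<pi> (space \<pi>) = 1" by simp
qed

text \<open>Discretising both coordinates of a coupling by \<open>\<rho>\<close> gives a coupling
  matrix, and by the triangle inequality its cost exceeds that of the coupling by at most the two
  discretisation errors. \<open>Q\<close> stands for the cost of an \<open>\<eta>\<close>-optimal
  matrix.\<close>

lemma discrete_cost_le_wasserstein:
  fixes \<alpha> \<beta> :: "'a::euclidean_space measure" and \<rho> :: "'a \<Rightarrow> 'a"
  assumes p: "1 \<le> p" and \<alpha>: "prob_space \<alpha>" and \<rho>[measurable]: "\<rho> \<in> borel_measurable borel"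
    and fin: "finite (range \<rho>)" and \<eta>: "0 \<le> \<eta>"
    and Q: "\<And>r. is_coupling_matrix (range \<rho>) (\<lambda>j. measure \<alpha> (\<rho> -` {j})) (\<lambda>j. measure \<beta> (\<rho> -` {j})) r \<Longrightarrow>
       Q \<le> (\<Sum>j\<in>range \<rho>. \<Sum>l\<in>range \<rho>. norm (j - l) powr p * r j l) + \<eta>"
  shows "epowr (ennreal Q) (1 / p) \<le> wasserstein p \<alpha> \<beta> +
    (lpn p \<alpha> (\<lambda>a. ennreal (norm (a - \<rho> a))) + lpn p \<beta> (\<lambda>a. ennreal (norm (a - \<rho> a))) + epowr (ennreal \<eta>) (1 / p))"
    (is "?L \<le> _ + ?E")
proof -
  define c where "c \<pi> = (\<integral>\<^sup>+(x, y). ennreal (norm (x - y :: 'a) powr p) \<partial>\<pi>)" for \<pi>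
  let ?R = "range \<rho>"
  have main: "?L \<le> epowr (c \<pi>) (1 / p) + ?E" if \<pi>: "\<pi> \<in> couplings \<alpha> \<beta>" for \<pi>
  proof -
    have s[measurable_cong]: "sets \<pi> = sets (borel \<Otimes>\<^sub>M borel)" and d1: "distr \<pi> borel fst = \<alpha>" and d2: "distr \<pi> borel snd = \<beta>"
      using \<pi> by (auto simp: couplings_def)
    interpret \<pi>: prob_space \<pi> by (rule coupling_prob_space[OF \<alpha> \<pi>])
    have sp: "space \<pi> = UNIV" using sets_eq_imp_space_eq[OF s] by (simp add: space_pair_measure)
    define r where "r j l = measure \<pi> {w. \<rho> (fst w) = j \<and> \<rho> (snd w) = l}" for j l
    have jm[measurable]: "{w. \<rho> (fst w) = j \<and> \<rho> (snd w) = l} \<in> sets \<pi>" for j l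
    proof -
      have "{w\<in>space \<pi>. \<rho> (fst w) = j \<and> \<rho> (snd w) = l} \<in> sets \<pi>" by measurable
      then show ?thesis by (simp add: sp)
    qed
    have "is_coupling_matrix ?R (\<lambda>j. measure \<alpha> (\<rho> -` {j})) (\<lambda>j. measure \<beta> (\<rho> -` {j})) r"
      unfolding is_coupling_matrix_def
    proof (intro conjI ballI)
      have rj: "\<rho> -` {j} \<in> sets borel" for j using measurable_sets[OF \<rho>, of "{j}"] by simp
      fix j
      have "(\<Sum>l\<in>?R. r j l) = measure \<pi> (\<Union>l\<in>?R. {w. \<rho> (fst w) = j \<and> \<rho> (snd w) = l})"
        unfolding r_def by (rule \<pi>.finite_measure_finite_Union[symmetric, OF fin]) (auto simp: disjoint_family_on_def)
      also have "(\<Union>l\<in>?R. {w. \<rho> (fst w) = j \<and> \<rho> (snd w) = l}) = fst -` (\<rho> -` {j}) \<inter> space \<pi>" by (auto simp: sp)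
      also have "measure \<pi> \<dots> = measure \<alpha> (\<rho> -` {j})"
        unfolding d1[symmetric] using rj by (subst measure_distr) auto
      finally show "(\<Sum>l\<in>?R. r j l) = measure \<alpha> (\<rho> -` {j})" .
      have "(\<Sum>l\<in>?R. r l j) = measure \<pi> (\<Union>l\<in>?R. {w. \<rho> (fst w) = l \<and> \<rho> (snd w) = j})"
        unfolding r_def by (rule \<pi>.finite_measure_finite_Union[symmetric, OF fin]) (auto simp: disjoint_family_on_def)
      also have "(\<Union>l\<in>?R. {w. \<rho> (fst w) = l \<and> \<rho> (snd w) = j}) = snd -` (\<rho> -` {j}) \<inter> space \<pi>" by (auto simp: sp)
      also have "measure \<pi> \<dots> = measure \<beta> (\<rho> -` {j})"
        unfolding d2[symmetric] using rj by (subst measure_distr) auto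
      finally show "(\<Sum>l\<in>?R. r l j) = measure \<beta> (\<rho> -` {j})" .
    qed (simp add: r_def)
    note Q[OF this]
    moreover have "ennreal (\<Sum>j\<in>?R. \<Sum>l\<in>?R. norm (j - l) powr p * r j l) =
       (\<integral>\<^sup>+w. ennreal (norm (\<rho> (fst w) - \<rho> (snd w)) powr p) \<partial>\<pi>)"
    proof -
      have "(\<integral>\<^sup>+w. ennreal (norm (\<rho> (fst w) - \<rho> (snd w)) powr p) \<partial>\<pi>) =
        (\<integral>\<^sup>+w. (\<Sum>j\<in>?R. \<Sum>l\<in>?R. ennreal (norm (j - l) powr p) * indicator {w. \<rho> (fst w) = j \<and> \<rho> (snd w) = l} w) \<partial>\<pi>)"
      proof (rule nn_integral_cong)
        fix w
        have "(\<Sum>j\<in>?R. \<Sum>l\<in>?R. ennreal (norm (j - l) powr p) * indicator {w. \<rho> (fst w) = j \<and> \<rho> (snd w) = l} w)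
         = (\<Sum>j\<in>?R. \<Sum>l\<in>?R. if l = \<rho> (snd w) then (if j = \<rho> (fst w) then ennreal (norm (j - l) powr p) else 0) else 0)"
          by (intro sum.cong) auto
        also have "\<dots> = ennreal (norm (\<rho> (fst w) - \<rho> (snd w)) powr p)"
          using fin by simp
        finally show "ennreal (norm (\<rho> (fst w) - \<rho> (snd w)) powr p) = (\<Sum>j\<in>?R. \<Sum>l\<in>?R. ennreal (norm (j - l) powr p) * indicator {w. \<rho> (fst w) = j \<and> \<rho> (snd w) = l} w)"
          by simp
      qed
      also have "\<dots> = (\<Sum>j\<in>?R. \<Sum>l\<in>?R. ennreal (norm (j - l) powr p) * emeasure \<pi> {w. \<rho> (fst w) = j \<and> \<rho> (snd w) = l})"
        by (simp add: nn_integral_sum nn_integral_cmult_indicator)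
      also have "\<dots> = ennreal (\<Sum>j\<in>?R. \<Sum>l\<in>?R. norm (j - l) powr p * r j l)"
        by (simp add: r_def \<pi>.emeasure_eq_measure sum_nonneg flip: ennreal_mult)
      finally show ?thesis by simp
    qed
    ultimately have "ennreal Q \<le> (\<integral>\<^sup>+w. ennreal (norm (\<rho> (fst w) - \<rho> (snd w)) powr p) \<partial>\<pi>) + ennreal \<eta>"
      using \<eta> by (metis (no_types, lifting) ennreal_leI ennreal_plus mult_nonneg_nonneg powr_ge_zero r_def sum_nonneg measure_nonneg)
    then have "?L \<le> epowr ((\<integral>\<^sup>+w. ennreal (norm (\<rho> (fst w) - \<rho> (snd w)) powr p) \<partial>\<pi>) + ennreal \<eta>) (1 / p)"
      using p by (intro epowr_mono) auto
    also have "\<dots> \<le> lpn p \<pi> (\<lambda>w. ennreal (norm (\<rho> (fst w) - \<rho> (snd w)))) + epowr (ennreal \<eta>) (1 / p)"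
      unfolding lpn_def epowr_norm by (rule epowr_add_le[OF p])
    also have "lpn p \<pi> (\<lambda>w. ennreal (norm (\<rho> (fst w) - \<rho> (snd w)))) \<le>
      lpn p \<pi> (\<lambda>w. ennreal (norm (fst w - snd w)) + (ennreal (norm (fst w - \<rho> (fst w))) + ennreal (norm (snd w - \<rho> (snd w)))))"
    proof (rule lpn_mono)
      fix w
      have "norm (\<rho> (fst w) - \<rho> (snd w)) \<le> norm (fst w - snd w) + (norm (fst w - \<rho> (fst w)) + norm (snd w - \<rho> (snd w)))"
        by norm
      then show "ennreal (norm (\<rho> (fst w) - \<rho> (snd w))) \<le> ennreal (norm (fst w - snd w)) + (ennreal (norm (fst w - \<rho> (fst w))) + ennreal (norm (snd w - \<rho> (snd w))))"
        by (simp flip: ennreal_plus)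
    qed (use p in simp)
    also have "\<dots> \<le> lpn p \<pi> (\<lambda>w. ennreal (norm (fst w - snd w))) + lpn p \<pi> (\<lambda>w. ennreal (norm (fst w - \<rho> (fst w))) + ennreal (norm (snd w - \<rho> (snd w))))"
      by (rule lpn_add_le[OF p]) measurable
    also have "lpn p \<pi> (\<lambda>w. ennreal (norm (fst w - \<rho> (fst w))) + ennreal (norm (snd w - \<rho> (snd w)))) \<le>
      lpn p \<pi> (\<lambda>w. ennreal (norm (fst w - \<rho> (fst w)))) + lpn p \<pi> (\<lambda>w. ennreal (norm (snd w - \<rho> (snd w))))"
      by (rule lpn_add_le[OF p]) measurable
    also have "lpn p \<pi> (\<lambda>w. ennreal (norm (fst w - \<rho> (fst w)))) = lpn p \<alpha> (\<lambda>a. ennreal (norm (a - \<rho> a)))"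
      unfolding d1[symmetric] by (rule lpn_distr[symmetric]) measurable
    also have "lpn p \<pi> (\<lambda>w. ennreal (norm (snd w - \<rho> (snd w)))) = lpn p \<beta> (\<lambda>a. ennreal (norm (a - \<rho> a)))"
      unfolding d2[symmetric] by (rule lpn_distr[symmetric]) measurable
    also have "lpn p \<pi> (\<lambda>w. ennreal (norm (fst w - snd w))) = epowr (c \<pi>) (1 / p)"
      by (simp add: lpn_def c_def epowr_norm case_prod_unfold)
    finally show ?thesis by (simp add: add.assoc add_mono)
  qed
  have p0: "0 < p" using p by simp
  show ?thesis
  proof (cases "?E = \<top>")
    case False
    \<comment> \<open>The infimum over couplings stands inside the root, so the error is moved to
      the left before the infimum is taken; this needs a finite error.\<close>
    have "epowr (?L - ?E) p \<le> (INF \<pi>\<in>couplings \<alpha> \<beta>. c \<pi>)"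
    proof (rule INF_greatest)
      fix \<pi> assume "\<pi> \<in> couplings \<alpha> \<beta>"
      then have "?L - ?E \<le> epowr (c \<pi>) (1 / p)"
        using main[of \<pi>] False by (simp add: ennreal_minus_le_iff add.commute)
      then have "epowr (?L - ?E) p \<le> epowr (epowr (c \<pi>) (1 / p)) p" using p0 by (intro epowr_mono) auto
      then show "epowr (?L - ?E) p \<le> c \<pi>" using p0 by (simp add: epowr_inverse)
    qed
    then have "epowr (epowr (?L - ?E) p) (1 / p) \<le> wasserstein p \<alpha> \<beta>"
      unfolding wasserstein_def c_def[symmetric] using p0 by (intro epowr_mono) auto
    then have "?L - ?E \<le> wasserstein p \<alpha> \<beta>" using p0 by (simp add: epowr_inverse)
    then show ?thesis using False by (simp add: ennreal_minus_le_iff add.commute)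
  next
    case True
    show ?thesis unfolding True by simp
  qed
qed

section \<open>Restriction of paths to sets of times\<close>

text \<open>One notion for initial and final segments, over arbitrary sets of times so that the
  empty past is included. Filling with 0 makes \<open>seg A\<close> additive, hence compatible with
  \<open>x + \<sigma> *\<^sub>R z\<close>.\<close>

definition seg :: "'n set \<Rightarrow> ('a::zero, 'n::finite) vec \<Rightarrow> ('a, 'n) vec" where
  "seg A x = (\<chi> i. if i \<in> A then x $ i else 0)"

lemma seg_nth [simp]: "seg A x $ i = (if i \<in> A then x $ i else 0)"
  by (simp add: seg_def)

lemma seg_seg [simp]: "seg A (seg B x) = seg (A \<inter> B) x"
  by (simp add: vec_eq_iff)

lemma seg_empty: "seg {} x = 0"
  by (simp add: vec_eq_iff)

lemma seg_add: "seg A (x + y) = seg A x + seg A (y :: ('a::monoid_add, 'n::finite) vec)"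
  by (simp add: vec_eq_iff)

lemma borel_measurable_seg [measurable]:
  "seg A \<in> borel_measurable (borel :: (('a::{real_normed_vector, second_countable_topology}, 'n::finite) vec) measure)"
proof (rule borel_measurable_continuous_onI)
  show "continuous_on UNIV (seg A :: ('a, 'n) vec \<Rightarrow> _)"
    unfolding seg_def
  proof (rule continuous_on_vec_lambda)
    fix i show "continuous_on UNIV (\<lambda>x :: ('a, 'n) vec. if i \<in> A then x $ i else 0)"
      by (cases "i \<in> A") (auto intro!: continuous_intros)
  qed
qed

lemma borel_measurable_vec_nth' [measurable (raw)]:
  fixes f :: "'m \<Rightarrow> ('a::{real_normed_vector, second_countable_topology}, 'n::finite) vec"
  assumes "f \<in> borel_measurable M"
  shows "(\<lambda>w. f w $ i) \<in> borel_measurable M"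
proof -
  have "(\<lambda>x :: ('a, 'n) vec. x $ i) \<in> borel_measurable borel"
    by (rule borel_measurable_continuous_onI) (auto intro!: continuous_intros)
  then show ?thesis by (rule measurable_compose[OF assms])
qed

lemma nn_integral_swap:
  assumes "sigma_finite_measure M" "sigma_finite_measure N" "sets M = sets A" "sets N = sets B"
    and "(\<lambda>(x, y). f x y) \<in> borel_measurable (A \<Otimes>\<^sub>M B)"
  shows "(\<integral>\<^sup>+x. \<integral>\<^sup>+y. f x y \<partial>N \<partial>M) = (\<integral>\<^sup>+y. \<integral>\<^sup>+x. f x y \<partial>M \<partial>N)"
proof -
  interpret pair_sigma_finite M N
    using assms(1,2) by (rule pair_sigma_finite.intro)
  have "(\<lambda>(x, y). f x y) \<in> borel_measurable (M \<Otimes>\<^sub>M N)"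
    using assms(5) measurable_cong_sets[OF sets_pair_measure_cong[OF assms(3,4)] refl] by blast
  from Fubini'[OF this] show ?thesis by simp
qed

section \<open>Conditional kernels and cell probabilities\<close>

definition is_kernel ::
  "('d::finite, 'n::finite) path measure \<Rightarrow> 'n set \<Rightarrow> 'n \<Rightarrow> (('d, 'n) path \<Rightarrow> (real ^ 'd) measure) \<Rightarrow> bool" where
  "is_kernel \<mu> A i \<kappa> \<longleftrightarrow> \<kappa> \<in> borel \<rightarrow>\<^sub>M prob_algebra borel \<and>
     (\<forall>f\<in>borel_measurable (borel \<Otimes>\<^sub>M borel).
        (\<integral>\<^sup>+x. f (seg A x, x $ i) \<partial>\<mu>) = (\<integral>\<^sup>+x. \<integral>\<^sup>+a. f (seg A x, a) \<partial>\<kappa> (seg A x) \<partial>\<mu>))"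

definition cell_prob :: "('s \<Rightarrow> 'b measure) \<Rightarrow> ('b \<Rightarrow> 'c) \<Rightarrow> 's \<Rightarrow> 'c \<Rightarrow> real" where
  "cell_prob \<kappa> \<rho> s j = measure (\<kappa> s) (\<rho> -` {j})"

lemma kernel_prob:
  assumes "\<kappa> \<in> borel \<rightarrow>\<^sub>M prob_algebra borel"
  shows "prob_space (\<kappa> s)" "sets (\<kappa> s) = sets borel" "space (\<kappa> s) = UNIV"
proof -
  show "prob_space (\<kappa> s)" "sets (\<kappa> s) = sets borel"
    using measurable_space[OF assms, of s] by (auto simp: space_prob_algebra)
  then show "space (\<kappa> s) = UNIV" using sets_eq_imp_space_eq by fastforce
qed

lemma cell_prob_nonneg [simp]: "0 \<le> cell_prob \<kappa> \<rho> s j"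
  by (simp add: cell_prob_def)

lemma cell_prob_sum:
  fixes \<rho> :: "'b::t1_space \<Rightarrow> 'b"
  assumes \<kappa>: "\<kappa> \<in> borel \<rightarrow>\<^sub>M prob_algebra borel" and \<rho>: "\<rho> \<in> borel_measurable borel" and fin: "finite (range \<rho>)"
  shows "(\<Sum>j\<in>range \<rho>. cell_prob \<kappa> \<rho> s j) = 1"
proof -
  interpret prob_space "\<kappa> s" by (rule kernel_prob[OF \<kappa>])
  have "\<rho> -` {j} \<in> sets (\<kappa> s)" for j
    using measurable_sets[OF \<rho> borel_singleton[OF sets.empty_sets]] by (simp add: kernel_prob[OF \<kappa>])
  then have "(\<Sum>j\<in>range \<rho>. cell_prob \<kappa> \<rho> s j) = prob (\<Union>j\<in>range \<rho>. \<rho> -` {j})"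
    unfolding cell_prob_def
    by (intro finite_measure_finite_Union[symmetric] fin) (auto simp: disjoint_family_on_def)
  also have "(\<Union>j\<in>range \<rho>. \<rho> -` {j}) = space (\<kappa> s)" by (auto simp: kernel_prob[OF \<kappa>])
  finally show ?thesis by (simp add: prob_space)
qed

lemma borel_measurable_cell_prob:
  fixes \<rho> :: "'b::t1_space \<Rightarrow> 'b"
  assumes \<kappa>: "\<kappa> \<in> borel \<rightarrow>\<^sub>M prob_algebra borel" and \<rho>: "\<rho> \<in> borel_measurable borel"
  shows "(\<lambda>s. cell_prob \<kappa> \<rho> s j) \<in> borel_measurable borel"
  unfolding cell_prob_def
proof (rule measurable_compose[OF \<kappa> measurable_measure_prob_algebra])
  show "\<rho> -` {j} \<in> sets borel" using measurable_sets[OF \<rho> borel_singleton[OF sets.empty_sets]] by simp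
qed

text \<open>An integrand that sees \<open>x $ i\<close> only through its cell turns the kernel
  integral into a finite sum, where the marginal identities of a coupling matrix can be applied.
  Measurability is asked for one cell at a time because the coupling matrices are measurable entry
  by entry.\<close>

lemma is_kernel_simple:
  fixes \<rho> :: "real ^ 'd::finite \<Rightarrow> real ^ 'd"
  assumes k: "is_kernel \<mu> A i \<kappa>" and s: "sets \<mu> = sets borel" and \<rho>[measurable]: "\<rho> \<in> borel_measurable borel" and fin: "finite (range \<rho>)"
    and h[measurable]: "\<And>j. j \<in> range \<rho> \<Longrightarrow> (\<lambda>s. h s j) \<in> borel_measurable borel"
  shows "(\<integral>\<^sup>+x. h (seg A x) (\<rho> (x $ i)) \<partial>\<mu>) =
    (\<integral>\<^sup>+x. (\<Sum>j\<in>range \<rho>. h (seg A x) j * ennreal (cell_prob \<kappa> \<rho> (seg A x) j)) \<partial>\<mu>)"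
proof -
  define f where "f w = (\<Sum>j\<in>range \<rho>. h (fst w) j * indicator (\<rho> -` {j}) (snd w))" for w
  have rj: "\<rho> -` {j} \<in> sets borel" for j using measurable_sets[OF \<rho> borel_singleton[OF sets.empty_sets]] by simp
  note [measurable] = rj
  have \<kappa>: "\<kappa> \<in> borel \<rightarrow>\<^sub>M prob_algebra borel" using k by (simp add: is_kernel_def)
  have fm: "f \<in> borel_measurable (borel \<Otimes>\<^sub>M borel)"
    unfolding f_def by measurable
  have fe: "f (s, a) = h s (\<rho> a)" for s a
  proof -
    have "f (s, a) = (\<Sum>j\<in>range \<rho>. if j = \<rho> a then h s j else 0)"
      unfolding f_def by (intro sum.cong) auto
    also have "\<dots> = h s (\<rho> a)" using fin by simp
    finally show ?thesis .
  qed
  have "(\<integral>\<^sup>+x. f (seg A x, x $ i) \<partial>\<mu>) = (\<integral>\<^sup>+x. \<integral>\<^sup>+a. f (seg A x, a) \<partial>\<kappa> (seg A x) \<partial>\<mu>)"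
    using k fm by (simp add: is_kernel_def)
  also have "\<dots> = (\<integral>\<^sup>+x. (\<Sum>j\<in>range \<rho>. h (seg A x) j * ennreal (cell_prob \<kappa> \<rho> (seg A x) j)) \<partial>\<mu>)"
  proof (rule nn_integral_cong)
    fix x
    interpret prob_space "\<kappa> (seg A x)" by (rule kernel_prob[OF \<kappa>])
    have rj': "\<rho> -` {j} \<in> sets (\<kappa> (seg A x))" for j using rj by (simp add: kernel_prob[OF \<kappa>])
    have "(\<integral>\<^sup>+a. f (seg A x, a) \<partial>\<kappa> (seg A x)) =
      (\<Sum>j\<in>range \<rho>. \<integral>\<^sup>+a. h (seg A x) j * indicator (\<rho> -` {j}) a \<partial>\<kappa> (seg A x))"
      unfolding f_def fst_conv snd_conv using rj'
      by (intro nn_integral_sum borel_measurable_times_ennreal borel_measurable_const borel_measurable_indicator)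
    also have "\<dots> = (\<Sum>j\<in>range \<rho>. h (seg A x) j * ennreal (cell_prob \<kappa> \<rho> (seg A x) j))"
      using rj' by (intro sum.cong) (simp_all add: nn_integral_cmult_indicator cell_prob_def emeasure_eq_measure)
    finally show "(\<integral>\<^sup>+a. f (seg A x, a) \<partial>\<kappa> (seg A x)) = (\<Sum>j\<in>range \<rho>. h (seg A x) j * ennreal (cell_prob \<kappa> \<rho> (seg A x) j))" .
  qed
  finally show ?thesis by (simp add: fe)
qed

section \<open>Densities of bicausal couplings\<close>

locale smoothing =
  fixes p \<sigma> :: real and \<mu> \<xi> :: "('d::finite, 'n::{finite,linorder}) path measure"
  assumes p: "1 \<le> p" and prob_\<mu>: "prob_space \<mu>" and sets_\<mu>[measurable_cong, simp]: "sets \<mu> = sets borel"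
    and prob_\<xi>: "prob_space \<xi>" and sets_\<xi>[measurable_cong, simp]: "sets \<xi> = sets borel"
begin

sublocale \<mu>: prob_space \<mu> by (rule prob_\<mu>)
sublocale \<xi>: prob_space \<xi> by (rule prob_\<xi>)

lemma space_\<mu>\<xi> [simp]: "space \<mu> = UNIV" "space \<xi> = UNIV"
  using sets_eq_imp_space_eq[OF sets_\<mu>] sets_eq_imp_space_eq[OF sets_\<xi>] by auto

lemma emeasure_UNIV [simp]: "emeasure \<mu> UNIV = 1" "emeasure \<xi> UNIV = 1"
  using \<mu>.emeasure_space_1 \<xi>.emeasure_space_1 by simp_all

abbreviation "\<nu> \<equiv> smoothed \<mu> \<xi> \<sigma>"

lemma sets_\<nu> [measurable_cong, simp]: "sets \<nu> = sets borel"
  by (simp add: smoothed_def convolution_def)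

lemma space_\<nu> [simp]: "space \<nu> = UNIV"
  by (simp add: smoothed_def convolution_def)

lemma swap_\<mu>\<mu>:
  "f \<in> borel_measurable (borel \<Otimes>\<^sub>M borel) \<Longrightarrow> (\<integral>\<^sup>+x. \<integral>\<^sup>+y. f (x, y) \<partial>\<mu> \<partial>\<mu>) = (\<integral>\<^sup>+y. \<integral>\<^sup>+x. f (x, y) \<partial>\<mu> \<partial>\<mu>)"
  by (intro nn_integral_swap) (auto intro: \<mu>.sigma_finite_measure_axioms)

lemma swap_\<mu>\<xi>:
  "f \<in> borel_measurable (borel \<Otimes>\<^sub>M borel) \<Longrightarrow> (\<integral>\<^sup>+x. \<integral>\<^sup>+z. f (x, z) \<partial>\<xi> \<partial>\<mu>) = (\<integral>\<^sup>+z. \<integral>\<^sup>+x. f (x, z) \<partial>\<mu> \<partial>\<xi>)"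
  by (intro nn_integral_swap) (auto intro: \<mu>.sigma_finite_measure_axioms \<xi>.sigma_finite_measure_axioms)

text \<open>The noise is integrated outermost: for fixed \<open>z\<close> the smoothed path is a
  translate of \<open>x\<close>, so conditional laws of \<open>\<mu>\<close> apply to the inner
  integral.\<close>

lemma nn_integral_\<nu>:
  assumes [measurable]: "f \<in> borel_measurable borel"
  shows "(\<integral>\<^sup>+y. f y \<partial>\<nu>) = (\<integral>\<^sup>+z. \<integral>\<^sup>+x. f (x + \<sigma> *\<^sub>R z) \<partial>\<mu> \<partial>\<xi>)"
proof -
  interpret N: prob_space "scaled_law \<sigma> \<xi>"
    unfolding scaled_law_def by (rule \<xi>.prob_space_distr) simp
  have [measurable_cong, simp]: "sets (scaled_law \<sigma> \<xi>) = sets borel" by (simp add: scaled_law_def)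
  have "(\<integral>\<^sup>+y. f y \<partial>\<nu>) = (\<integral>\<^sup>+w. f (fst w + snd w) \<partial>(\<mu> \<Otimes>\<^sub>M scaled_law \<sigma> \<xi>))"
    unfolding smoothed_def convolution_def by (subst nn_integral_distr) (auto simp: case_prod_unfold)
  also have "\<dots> = (\<integral>\<^sup>+x. \<integral>\<^sup>+y. f (x + y) \<partial>scaled_law \<sigma> \<xi> \<partial>\<mu>)"
    by (subst N.nn_integral_fst[symmetric]) auto
  also have "\<dots> = (\<integral>\<^sup>+x. \<integral>\<^sup>+z. f (x + \<sigma> *\<^sub>R z) \<partial>\<xi> \<partial>\<mu>)"
    unfolding scaled_law_def by (subst nn_integral_distr) auto
  also have "\<dots> = (\<integral>\<^sup>+z. \<integral>\<^sup>+x. f (x + \<sigma> *\<^sub>R z) \<partial>\<mu> \<partial>\<xi>)"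
    using swap_\<mu>\<xi>[of "\<lambda>w. f (fst w + \<sigma> *\<^sub>R snd w)"] by simp
  finally show ?thesis .
qed

lemma prob_\<nu>: "prob_space \<nu>"
proof (rule prob_spaceI)
  have "emeasure \<nu> (space \<nu>) = (\<integral>\<^sup>+y. 1 \<partial>\<nu>)" by simp
  also have "\<dots> = 1"
    by (subst nn_integral_\<nu>) simp_all
  finally show "emeasure \<nu> (space \<nu>) = 1" .
qed

sublocale \<nu>: prob_space \<nu> by (rule prob_\<nu>)

text \<open>\<open>D\<close> is the density, with respect to \<open>\<mu> \<Otimes> \<nu>\<close>, of a coupling that is independent outside \<open>A\<close>.\<close>

definition admissible :: "'n set \<Rightarrow> (('d, 'n) path \<times> ('d, 'n) path \<Rightarrow> ennreal) \<Rightarrow> bool" where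
  "admissible A D \<longleftrightarrow> D \<in> borel_measurable (borel \<Otimes>\<^sub>M borel) \<and>
     (\<forall>x y. D (seg A x, seg A y) = D (x, y)) \<and>
     (\<forall>x. (\<integral>\<^sup>+y. D (x, y) \<partial>\<nu>) = 1) \<and> (\<forall>y. (\<integral>\<^sup>+x. D (x, y) \<partial>\<mu>) = 1)"

text \<open>Passing from \<open>D\<close> to \<open>D'\<close> does not change the joint law of one full path and the other path
  up to time \<open>A\<close>: this is the bicausality of \<open>D'\<close> at \<open>A\<close>.\<close>

definition refines :: "'n set \<Rightarrow> (('d, 'n) path \<times> ('d, 'n) path \<Rightarrow> ennreal) \<Rightarrow>
    (('d, 'n) path \<times> ('d, 'n) path \<Rightarrow> ennreal) \<Rightarrow> bool" where
  "refines A D D' \<longleftrightarrow> (\<forall>f\<in>borel_measurable borel.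
     (\<forall>x. (\<integral>\<^sup>+y. f (seg A y) * D' (x, y) \<partial>\<nu>) = (\<integral>\<^sup>+y. f (seg A y) * D (x, y) \<partial>\<nu>)) \<and>
     (\<forall>y. (\<integral>\<^sup>+x. f (seg A x) * D' (x, y) \<partial>\<mu>) = (\<integral>\<^sup>+x. f (seg A x) * D (x, y) \<partial>\<mu>)))"

lemma refines_refl: "refines A D D"
  by (simp add: refines_def)

lemma refines_trans:
  assumes "refines A D D'" "refines B D' D''" "A \<subseteq> B"
  shows "refines A D D''"
  unfolding refines_def
proof (intro ballI conjI allI)
  fix f :: "('d, 'n) path \<Rightarrow> ennreal" and x y
  assume f: "f \<in> borel_measurable borel"
  have AB: "A \<inter> B = A" using assms(3) by auto
  have "(\<lambda>z. f (seg A z)) \<in> borel_measurable borel" using f by measurable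
  then have "(\<integral>\<^sup>+y. f (seg A y) * D'' (x, y) \<partial>\<nu>) = (\<integral>\<^sup>+y. f (seg A y) * D' (x, y) \<partial>\<nu>)"
    "(\<integral>\<^sup>+x. f (seg A x) * D'' (x, y) \<partial>\<mu>) = (\<integral>\<^sup>+x. f (seg A x) * D' (x, y) \<partial>\<mu>)"
    using assms(2) unfolding refines_def by (auto dest!: bspec simp: AB)
  then show "(\<integral>\<^sup>+y. f (seg A y) * D'' (x, y) \<partial>\<nu>) = (\<integral>\<^sup>+y. f (seg A y) * D (x, y) \<partial>\<nu>)"
    "(\<integral>\<^sup>+x. f (seg A x) * D'' (x, y) \<partial>\<mu>) = (\<integral>\<^sup>+x. f (seg A x) * D (x, y) \<partial>\<mu>)"
    using assms(1) f unfolding refines_def by auto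
qed

abbreviation "\<Omega> \<equiv> \<mu> \<Otimes>\<^sub>M (\<mu> \<Otimes>\<^sub>M \<xi>)"

lemma sets_\<Omega> [measurable_cong]: "sets \<Omega> = sets (borel \<Otimes>\<^sub>M (borel \<Otimes>\<^sub>M borel))"
  by (intro sets_pair_measure_cong) auto

lemma nn_integral_\<Omega>:
  assumes [measurable]: "f \<in> borel_measurable (borel \<Otimes>\<^sub>M (borel \<Otimes>\<^sub>M borel))"
  shows "(\<integral>\<^sup>+w. f w \<partial>\<Omega>) = (\<integral>\<^sup>+x. \<integral>\<^sup>+z. \<integral>\<^sup>+x'. f (x, x', z) \<partial>\<mu> \<partial>\<xi> \<partial>\<mu>)"
    and "(\<integral>\<^sup>+w. f w \<partial>\<Omega>) = (\<integral>\<^sup>+z. \<integral>\<^sup>+x'. \<integral>\<^sup>+x. f (x, x', z) \<partial>\<mu> \<partial>\<mu> \<partial>\<xi>)"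
proof -
  interpret \<mu>\<xi>: pair_prob_space \<mu> \<xi> ..
  interpret \<mu>\<mu>\<xi>: pair_prob_space \<mu> "\<mu> \<Otimes>\<^sub>M \<xi>" ..
  have sw: "(\<integral>\<^sup>+x'. \<integral>\<^sup>+z. h (x', z) \<partial>\<xi> \<partial>\<mu>) = (\<integral>\<^sup>+z. \<integral>\<^sup>+x'. h (x', z) \<partial>\<mu> \<partial>\<xi>)"
    if "h \<in> borel_measurable (borel \<Otimes>\<^sub>M borel)" for h :: "('d, 'n) path \<times> ('d, 'n) path \<Rightarrow> ennreal"
    by (rule swap_\<mu>\<xi>[OF that])
  have "(\<integral>\<^sup>+w. f w \<partial>\<Omega>) = (\<integral>\<^sup>+x. \<integral>\<^sup>+v. f (x, v) \<partial>(\<mu> \<Otimes>\<^sub>M \<xi>) \<partial>\<mu>)"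
    by (rule \<mu>\<xi>.P.nn_integral_fst[symmetric]) measurable
  also have "\<dots> = (\<integral>\<^sup>+x. \<integral>\<^sup>+x'. \<integral>\<^sup>+z. f (x, x', z) \<partial>\<xi> \<partial>\<mu> \<partial>\<mu>)"
    by (intro nn_integral_cong \<xi>.nn_integral_fst[symmetric]) measurable
  also have "\<dots> = (\<integral>\<^sup>+x. \<integral>\<^sup>+z. \<integral>\<^sup>+x'. f (x, x', z) \<partial>\<mu> \<partial>\<xi> \<partial>\<mu>)"
  proof (rule nn_integral_cong)
    fix x
    show "(\<integral>\<^sup>+x'. \<integral>\<^sup>+z. f (x, x', z) \<partial>\<xi> \<partial>\<mu>) = (\<integral>\<^sup>+z. \<integral>\<^sup>+x'. f (x, x', z) \<partial>\<mu> \<partial>\<xi>)"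
      by (rule sw[of "\<lambda>v. f (x, v)"]) measurable
  qed
  finally show "(\<integral>\<^sup>+w. f w \<partial>\<Omega>) = (\<integral>\<^sup>+x. \<integral>\<^sup>+z. \<integral>\<^sup>+x'. f (x, x', z) \<partial>\<mu> \<partial>\<xi> \<partial>\<mu>)" .
  have "(\<integral>\<^sup>+w. f w \<partial>\<Omega>) = (\<integral>\<^sup>+v. \<integral>\<^sup>+x. f (x, v) \<partial>\<mu> \<partial>(\<mu> \<Otimes>\<^sub>M \<xi>))"
    by (rule \<mu>\<mu>\<xi>.nn_integral_snd[symmetric]) measurable
  also have "\<dots> = (\<integral>\<^sup>+x'. \<integral>\<^sup>+z. \<integral>\<^sup>+x. f (x, x', z) \<partial>\<mu> \<partial>\<xi> \<partial>\<mu>)"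
    by (rule \<xi>.nn_integral_fst[symmetric]) measurable
  also have "\<dots> = (\<integral>\<^sup>+z. \<integral>\<^sup>+x'. \<integral>\<^sup>+x. f (x, x', z) \<partial>\<mu> \<partial>\<mu> \<partial>\<xi>)"
    by (rule sw[of "\<lambda>v. \<integral>\<^sup>+x. f (x, v) \<partial>\<mu>"]) measurable
  finally show "(\<integral>\<^sup>+w. f w \<partial>\<Omega>) = (\<integral>\<^sup>+z. \<integral>\<^sup>+x'. \<integral>\<^sup>+x. f (x, x', z) \<partial>\<mu> \<partial>\<mu> \<partial>\<xi>)" .
qed

lemma lpn_density_marginals:
  assumes [measurable]: "w \<in> borel_measurable (borel \<Otimes>\<^sub>M (borel \<Otimes>\<^sub>M borel))" 
    and fst: "\<And>x. (\<integral>\<^sup>+z. \<integral>\<^sup>+x'. w (x, x', z) \<partial>\<mu> \<partial>\<xi>) = 1" and snd: "\<And>x' z. (\<integral>\<^sup>+x. w (x, x', z) \<partial>\<mu>) = 1"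
    and [measurable]: "f \<in> borel_measurable borel"
  shows "lpn p (density \<Omega> w) (\<lambda>(x, x', z). f x) = lpn p \<mu> f"
    "lpn p (density \<Omega> w) (\<lambda>(x, x', z). f x') = lpn p \<mu> f"
    "lpn p (density \<Omega> w) (\<lambda>(x, x', z). f z) = lpn p \<xi> f"
proof -
  show "lpn p (density \<Omega> w) (\<lambda>(x, x', z). f x) = lpn p \<mu> f"
    unfolding lpn_def
    by (simp add: nn_integral_density case_prod_unfold nn_integral_\<Omega>(1) nn_integral_multc fst)
  show "lpn p (density \<Omega> w) (\<lambda>(x, x', z). f x') = lpn p \<mu> f"
    unfolding lpn_def
    by (simp add: nn_integral_density case_prod_unfold nn_integral_\<Omega>(2) nn_integral_multc snd)
  show "lpn p (density \<Omega> w) (\<lambda>(x, x', z). f z) = lpn p \<xi> f"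
    unfolding lpn_def
    by (simp add: nn_integral_density case_prod_unfold nn_integral_\<Omega>(2) nn_integral_multc snd)
qed

text \<open>The joint law of \<open>(X, X', Z)\<close> under which \<open>(X, X' + \<sigma>Z)\<close> has density \<open>D\<close>.\<close>

definition lift :: "(('d, 'n) path \<times> ('d, 'n) path \<Rightarrow> ennreal) \<Rightarrow> (('d, 'n) path \<times> ('d, 'n) path \<times> ('d, 'n) path) measure" where
  "lift D = density \<Omega> (\<lambda>(x, x', z). D (x, x' + \<sigma> *\<^sub>R z))"

lemma sets_lift [measurable_cong, simp]: "sets (lift D) = sets (borel \<Otimes>\<^sub>M (borel \<Otimes>\<^sub>M borel))"
  by (simp add: lift_def sets_\<Omega>)

lemma admissible_lift:
  assumes "admissible A D"
  shows "(\<lambda>(x, x', z). D (x, x' + \<sigma> *\<^sub>R z)) \<in> borel_measurable (borel \<Otimes>\<^sub>M (borel \<Otimes>\<^sub>M borel))"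
    "(\<integral>\<^sup>+z. \<integral>\<^sup>+x'. D (x, x' + \<sigma> *\<^sub>R z) \<partial>\<mu> \<partial>\<xi>) = 1" "(\<integral>\<^sup>+x. D (x, x' + \<sigma> *\<^sub>R z) \<partial>\<mu>) = 1"
proof -
  have D[measurable]: "D \<in> borel_measurable (borel \<Otimes>\<^sub>M borel)" using assms by (simp add: admissible_def)
  show "(\<lambda>(x, x', z). D (x, x' + \<sigma> *\<^sub>R z)) \<in> borel_measurable (borel \<Otimes>\<^sub>M (borel \<Otimes>\<^sub>M borel))" by measurable
  show "(\<integral>\<^sup>+x. D (x, x' + \<sigma> *\<^sub>R z) \<partial>\<mu>) = 1" using assms by (simp add: admissible_def)
  have "(\<integral>\<^sup>+z. \<integral>\<^sup>+x'. D (x, x' + \<sigma> *\<^sub>R z) \<partial>\<mu> \<partial>\<xi>) = (\<integral>\<^sup>+y. D (x, y) \<partial>\<nu>)"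
    by (rule nn_integral_\<nu>[symmetric]) measurable
  then show "(\<integral>\<^sup>+z. \<integral>\<^sup>+x'. D (x, x' + \<sigma> *\<^sub>R z) \<partial>\<mu> \<partial>\<xi>) = 1" using assms by (simp add: admissible_def)
qed

lemma lpn_lift:
  assumes "admissible A D" "f \<in> borel_measurable borel"
  shows "lpn p (lift D) (\<lambda>(x, x', z). f x) = lpn p \<mu> f"
    "lpn p (lift D) (\<lambda>(x, x', z). f x') = lpn p \<mu> f"
    "lpn p (lift D) (\<lambda>(x, x', z). f z) = lpn p \<xi> f"
  unfolding lift_def using assms(2) admissible_lift[OF assms(1)]
  by (intro lpn_density_marginals; simp)+

end

text \<open>One step of the construction. \<open>\<kappa>\<close> and \<open>K\<close> are the conditional laws of \<open>X\<^sub>i\<close> given \<open>X\<close> on \<open>A\<close> and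
  of \<open>X\<close> given \<open>X + \<sigma>Z\<close> on \<open>insert i A\<close>; \<open>\<rho>\<close> discretises \<open>X\<^sub>i\<close>, and \<open>q (s, s')\<close> is a nearly optimal
  coupling matrix of the discretisations of \<open>\<kappa> s\<close> and \<open>\<kappa> s'\<close>.\<close>

locale coupling_step = smoothing p \<sigma> \<mu> \<xi>
  for p \<sigma> :: real and \<mu> \<xi> :: "('d::finite, 'n::{finite,linorder}) path measure" +
  fixes A :: "'n set" and i :: 'n and \<kappa> :: "('d, 'n) path \<Rightarrow> (real ^ 'd) measure"
    and K :: "('d, 'n) path \<Rightarrow> ('d, 'n) path measure" and \<rho> :: "real ^ 'd \<Rightarrow> real ^ 'd"
    and q :: "('d, 'n) path \<times> ('d, 'n) path \<Rightarrow> real ^ 'd \<Rightarrow> real ^ 'd \<Rightarrow> real" and \<epsilon> \<eta> :: real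
  assumes kernel: "is_kernel \<mu> A i \<kappa>"
    and K: "K \<in> borel \<rightarrow>\<^sub>M prob_algebra borel"
    and K_disint: "\<And>f. f \<in> borel_measurable (borel \<Otimes>\<^sub>M borel) \<Longrightarrow>
      (\<integral>\<^sup>+y. \<integral>\<^sup>+x'. f (seg (insert i A) y, x') \<partial>K (seg (insert i A) y) \<partial>smoothed \<mu> \<xi> \<sigma>) =
      (\<integral>\<^sup>+z. \<integral>\<^sup>+x'. f (seg (insert i A) (x' + \<sigma> *\<^sub>R z), x') \<partial>\<mu> \<partial>\<xi>)"
    and \<rho>[measurable]: "\<rho> \<in> borel_measurable borel" and fin: "finite (range \<rho>)"
    and q_meas: "\<And>j l. j \<in> range \<rho> \<Longrightarrow> l \<in> range \<rho> \<Longrightarrow> (\<lambda>w. q w j l) \<in> borel_measurable (borel \<Otimes>\<^sub>M borel)"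
    and q_coupling: "\<And>s s'. is_coupling_matrix (range \<rho>) (cell_prob \<kappa> \<rho> s) (cell_prob \<kappa> \<rho> s') (q (s, s'))"
    and q_opt: "\<And>s s' r. is_coupling_matrix (range \<rho>) (cell_prob \<kappa> \<rho> s) (cell_prob \<kappa> \<rho> s') r \<Longrightarrow>
      (\<Sum>j\<in>range \<rho>. \<Sum>l\<in>range \<rho>. norm (j - l) powr p * q (s, s') j l) \<le>
      (\<Sum>j\<in>range \<rho>. \<Sum>l\<in>range \<rho>. norm (j - l) powr p * r j l) + \<eta>"
    and \<eta>: "0 \<le> \<eta>" "epowr (ennreal \<eta>) (1 / p) \<le> ennreal \<epsilon>"
    and \<rho>_error: "lpn p \<mu> (\<lambda>x. ennreal (norm (x $ i - \<rho> (x $ i)))) \<le> ennreal \<epsilon>"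
    and \<sigma>: "0 < \<sigma>"
begin

section \<open>The transition density of one time step\<close>

abbreviation "A' \<equiv> insert i A"
abbreviation "cp \<equiv> cell_prob \<kappa> \<rho>"

lemma \<kappa>: "\<kappa> \<in> borel \<rightarrow>\<^sub>M prob_algebra borel"
  using kernel by (simp add: is_kernel_def)

lemma cp_meas [measurable]: "(\<lambda>s. cp s j) \<in> borel_measurable borel"
  by (rule borel_measurable_cell_prob[OF \<kappa> \<rho>])

lemma cp_sum: "(\<Sum>j\<in>range \<rho>. cp s j) = 1"
  by (rule cell_prob_sum[OF \<kappa> \<rho> fin])

text \<open>The density of the coupling given by \<open>q (s, s')\<close>, with independent positions inside the cells. The value on null
  cells is irrelevant for the coupling but is chosen such that both marginal identities below hold everywhere.\<close>

definition G :: "('d, 'n) path \<Rightarrow> ('d, 'n) path \<Rightarrow> real ^ 'd \<Rightarrow> real ^ 'd \<Rightarrow> ennreal" where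
  "G s s' j l = (if cp s j = 0 \<or> cp s' l = 0 then 1 else ennreal (q (s, s') j l / (cp s j * cp s' l)))"

definition g :: "('d, 'n) path \<times> ('d, 'n) path \<Rightarrow> ennreal" where
  "g = (\<lambda>(x, x'). G (seg A x) (seg A x') (\<rho> (x $ i)) (\<rho> (x' $ i)))"

lemma q_facts:
  assumes "j \<in> range \<rho>" "l \<in> range \<rho>"
  shows "0 \<le> q (s, s') j l" "(\<Sum>l\<in>range \<rho>. q (s, s') j l) = cp s j" "(\<Sum>j\<in>range \<rho>. q (s, s') j l) = cp s' l"
    "cp s j = 0 \<Longrightarrow> q (s, s') j l = 0" "cp s' l = 0 \<Longrightarrow> q (s, s') j l = 0"
proof -
  have nn: "0 \<le> q (s, s') j l" if "j \<in> range \<rho>" "l \<in> range \<rho>" for j l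
    using q_coupling[of s s'] that by (auto simp: is_coupling_matrix_def)
  show "0 \<le> q (s, s') j l" using nn assms by blast
  show 1: "(\<Sum>l\<in>range \<rho>. q (s, s') j l) = cp s j" "(\<Sum>j\<in>range \<rho>. q (s, s') j l) = cp s' l"
    using q_coupling[of s s'] assms by (auto simp: is_coupling_matrix_def)
  have "q (s, s') j l \<le> cp s j" unfolding 1(1)[symmetric]
    using fin assms nn by (intro member_le_sum) auto
  then show "cp s j = 0 \<Longrightarrow> q (s, s') j l = 0" using nn[OF assms] by simp
  have "q (s, s') j l \<le> cp s' l" unfolding 1(2)[symmetric]
    using fin assms nn by (intro member_le_sum[where f="\<lambda>j. q (s, s') j l"]) auto
  then show "cp s' l = 0 \<Longrightarrow> q (s, s') j l = 0" using nn[OF assms] by simp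
qed

text \<open>If the cell \<open>l\<close> is not null, its probability cancels and a column sum of
  \<open>q\<close> remains; null cells \<open>j\<close> then contribute 0. If \<open>l\<close> is
  null, \<open>G\<close> is 1 and the sum is the total mass of \<open>cp s\<close>.\<close>

lemma G_sum_fst:
  assumes l: "l \<in> range \<rho>"
  shows "(\<Sum>j\<in>range \<rho>. G s s' j l * ennreal (cp s j)) = 1"
proof (cases "cp s' l = 0")
  case True
  then have "(\<Sum>j\<in>range \<rho>. G s s' j l * ennreal (cp s j)) = ennreal (\<Sum>j\<in>range \<rho>. cp s j)"
    by (simp add: G_def)
  then show ?thesis by (simp add: cp_sum)
next
  case False
  have "G s s' j l * ennreal (cp s j) = ennreal (q (s, s') j l / cp s' l)" if "j \<in> range \<rho>" for j
    using False q_facts(1,4)[OF that l, of s s'] by (auto simp: G_def simp flip: ennreal_mult)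
  then have "(\<Sum>j\<in>range \<rho>. G s s' j l * ennreal (cp s j)) = (\<Sum>j\<in>range \<rho>. ennreal (q (s, s') j l / cp s' l))"
    by (rule sum.cong[OF refl])
  also have "\<dots> = ennreal ((\<Sum>j\<in>range \<rho>. q (s, s') j l) / cp s' l)"
    using q_facts(1) l by (subst sum_ennreal) (auto simp: sum_divide_distrib)
  also have "\<dots> = 1" using False q_facts(3)[OF l l] by simp
  finally show ?thesis .
qed

lemma G_sum_snd:
  assumes j: "j \<in> range \<rho>"
  shows "(\<Sum>l\<in>range \<rho>. G s s' j l * ennreal (cp s' l)) = 1"
proof (cases "cp s j = 0")
  case True
  then have "(\<Sum>l\<in>range \<rho>. G s s' j l * ennreal (cp s' l)) = ennreal (\<Sum>l\<in>range \<rho>. cp s' l)"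
    by (simp add: G_def)
  then show ?thesis by (simp add: cp_sum)
next
  case False
  have "G s s' j l * ennreal (cp s' l) = ennreal (q (s, s') j l / cp s j)" if "l \<in> range \<rho>" for l
    using False q_facts(1)[OF j that, of s s'] q_facts(5)[OF j that, of s' s] by (auto simp: G_def simp flip: ennreal_mult)
  then have "(\<Sum>l\<in>range \<rho>. G s s' j l * ennreal (cp s' l)) = (\<Sum>l\<in>range \<rho>. ennreal (q (s, s') j l / cp s j))"
    by (rule sum.cong[OF refl])
  also have "\<dots> = ennreal ((\<Sum>l\<in>range \<rho>. q (s, s') j l) / cp s j)"
    using q_facts(1) j by (subst sum_ennreal) (auto simp: sum_divide_distrib)
  also have "\<dots> = 1" using False q_facts(2)[OF j j] by simp
  finally show ?thesis .
qed

lemma G_meas: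
  assumes "j \<in> range \<rho>" "l \<in> range \<rho>"
  shows "(\<lambda>w. G (fst w) (snd w) j l) \<in> borel_measurable (borel \<Otimes>\<^sub>M borel)"
proof -
  note [measurable] = q_meas[OF assms]
  show ?thesis unfolding G_def by (simp only: prod.collapse) measurable
qed

lemma G_meas_fst: "j \<in> range \<rho> \<Longrightarrow> l \<in> range \<rho> \<Longrightarrow> (\<lambda>s. G s s' j l) \<in> borel_measurable borel"
  using measurable_compose[OF measurable_Pair2'[of s' borel borel] G_meas[of j l]] by simp

lemma G_meas_snd: "j \<in> range \<rho> \<Longrightarrow> l \<in> range \<rho> \<Longrightarrow> (\<lambda>s'. G s s' j l) \<in> borel_measurable borel"
  using measurable_compose[OF measurable_Pair1'[of s borel borel] G_meas[of j l]] by simp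

lemma g_meas [measurable]: "g \<in> borel_measurable (borel \<Otimes>\<^sub>M borel)"
proof -
  have [measurable]: "(\<lambda>w. G (seg A (fst w)) (seg A (snd w)) j l) \<in> borel_measurable (borel \<Otimes>\<^sub>M borel)"
    if "j \<in> range \<rho>" "l \<in> range \<rho>" for j l
  proof -
    have "(\<lambda>w :: ('d, 'n) path \<times> ('d, 'n) path. (seg A (fst w), seg A (snd w))) \<in> borel \<Otimes>\<^sub>M borel \<rightarrow>\<^sub>M borel \<Otimes>\<^sub>M borel"
      by measurable
    from measurable_compose[OF this G_meas[OF that]] show ?thesis by simp
  qed
  have "(\<lambda>w. \<Sum>j\<in>range \<rho>. \<Sum>l\<in>range \<rho>. if \<rho> (fst w $ i) = j \<and> \<rho> (snd w $ i) = l then G (seg A (fst w)) (seg A (snd w)) j l else 0)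
     \<in> borel_measurable (borel \<Otimes>\<^sub>M borel)"
    by measurable
  also have "(\<lambda>w. \<Sum>j\<in>range \<rho>. \<Sum>l\<in>range \<rho>. if \<rho> (fst w $ i) = j \<and> \<rho> (snd w $ i) = l then G (seg A (fst w)) (seg A (snd w)) j l else 0) = g"
  proof
    fix w
    have "(\<Sum>j\<in>range \<rho>. \<Sum>l\<in>range \<rho>. if \<rho> (fst w $ i) = j \<and> \<rho> (snd w $ i) = l then G (seg A (fst w)) (seg A (snd w)) j l else 0)
      = (\<Sum>j\<in>range \<rho>. \<Sum>l\<in>range \<rho>. if l = \<rho> (snd w $ i) then (if j = \<rho> (fst w $ i) then G (seg A (fst w)) (seg A (snd w)) j l else 0) else 0)"
      by (intro sum.cong) auto
    also have "\<dots> = g w" using fin by (simp add: g_def case_prod_unfold)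
    finally show "(\<Sum>j\<in>range \<rho>. \<Sum>l\<in>range \<rho>. if \<rho> (fst w $ i) = j \<and> \<rho> (snd w $ i) = l then G (seg A (fst w)) (seg A (snd w)) j l else 0) = g w" .
  qed
  finally show ?thesis .
qed

text \<open>Given the past \<open>seg A x\<close>, averaging \<open>g\<close> over
  \<open>x $ i\<close> gives 1 for each single \<open>x'\<close>, by the column sums of
  \<open>q\<close>; any function of the past passes through. The row sums give the mirror
  image.\<close>

lemma g_int_fst:
  assumes [measurable]: "f \<in> borel_measurable borel"
  shows "(\<integral>\<^sup>+x. f (seg A x) * g (x, x') \<partial>\<mu>) = (\<integral>\<^sup>+x. f (seg A x) \<partial>\<mu>)"
proof -
  let ?h = "\<lambda>s j. f s * G s (seg A x') j (\<rho> (x' $ i))"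
  have "(\<integral>\<^sup>+x. f (seg A x) * g (x, x') \<partial>\<mu>) = (\<integral>\<^sup>+x. ?h (seg A x) (\<rho> (x $ i)) \<partial>\<mu>)"
    by (simp add: g_def)
  also have "\<dots> = (\<integral>\<^sup>+x. (\<Sum>j\<in>range \<rho>. ?h (seg A x) j * ennreal (cp (seg A x) j)) \<partial>\<mu>)"
    by (intro is_kernel_simple[OF kernel sets_\<mu> \<rho> fin] borel_measurable_times_ennreal G_meas_fst) auto
  also have "\<dots> = (\<integral>\<^sup>+x. f (seg A x) \<partial>\<mu>)"
    by (simp add: mult.assoc G_sum_fst flip: sum_distrib_left)
  finally show ?thesis .
qed

lemma g_int_snd:
  assumes [measurable]: "f \<in> borel_measurable borel"
  shows "(\<integral>\<^sup>+x'. f (seg A x') * g (x, x') \<partial>\<mu>) = (\<integral>\<^sup>+x'. f (seg A x') \<partial>\<mu>)"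
proof -
  let ?h = "\<lambda>s j. f s * G (seg A x) s (\<rho> (x $ i)) j"
  have "(\<integral>\<^sup>+x'. f (seg A x') * g (x, x') \<partial>\<mu>) = (\<integral>\<^sup>+x'. ?h (seg A x') (\<rho> (x' $ i)) \<partial>\<mu>)"
    by (simp add: g_def)
  also have "\<dots> = (\<integral>\<^sup>+x'. (\<Sum>j\<in>range \<rho>. ?h (seg A x') j * ennreal (cp (seg A x') j)) \<partial>\<mu>)"
    by (intro is_kernel_simple[OF kernel sets_\<mu> \<rho> fin] borel_measurable_times_ennreal G_meas_snd) auto
  also have "\<dots> = (\<integral>\<^sup>+x'. f (seg A x') \<partial>\<mu>)"
    by (simp add: mult.assoc G_sum_snd flip: sum_distrib_left)
  finally show ?thesis .
qed

definition cost :: "('d, 'n) path \<times> ('d, 'n) path \<Rightarrow> real" where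
  "cost w = (\<Sum>j\<in>range \<rho>. \<Sum>l\<in>range \<rho>. norm (j - l) powr p * q w j l)"

lemma cost_meas [measurable]: "cost \<in> borel_measurable (borel \<Otimes>\<^sub>M borel)"
proof -
  note [measurable] = q_meas
  show ?thesis unfolding cost_def by measurable
qed

lemma G_cost:
  "(\<Sum>j\<in>range \<rho>. \<Sum>l\<in>range \<rho>. ennreal (norm (j - l) powr p) * G s s' j l * ennreal (cp s j) * ennreal (cp s' l))
    = ennreal (cost (s, s'))"
proof -
  have "ennreal (norm (j - l) powr p) * G s s' j l * ennreal (cp s j) * ennreal (cp s' l) =
    ennreal (norm (j - l) powr p * q (s, s') j l)" if "j \<in> range \<rho>" "l \<in> range \<rho>" for j l
    using q_facts(1,4)[OF that, of s s'] q_facts(5)[OF that, of s' s] by (auto simp: G_def simp flip: ennreal_mult)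
  then have "(\<Sum>j\<in>range \<rho>. \<Sum>l\<in>range \<rho>. ennreal (norm (j - l) powr p) * G s s' j l * ennreal (cp s j) * ennreal (cp s' l))
    = (\<Sum>j\<in>range \<rho>. \<Sum>l\<in>range \<rho>. ennreal (norm (j - l) powr p * q (s, s') j l))"
    by (intro sum.cong) auto
  also have "\<dots> = (\<Sum>j\<in>range \<rho>. ennreal (\<Sum>l\<in>range \<rho>. norm (j - l) powr p * q (s, s') j l))"
    using q_facts(1) by (intro sum.cong sum_ennreal) auto
  also have "\<dots> = ennreal (cost (s, s'))"
    unfolding cost_def using q_facts(1) by (intro sum_ennreal sum_nonneg) auto
  finally show ?thesis .
qed

text \<open>The new factor is the posterior mean of \<open>g (x, X')\<close> given \<open>Y\<close>
  on \<open>A'\<close>. Averaging \<open>X'\<close> out leaves a density in \<open>x\<close> and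
  \<open>y\<close> that depends on \<open>y\<close> only through \<open>A'\<close>.\<close>

definition next_density :: "(('d, 'n) path \<times> ('d, 'n) path \<Rightarrow> ennreal) \<Rightarrow> ('d, 'n) path \<times> ('d, 'n) path \<Rightarrow> ennreal" where
  "next_density D = (\<lambda>(x, y). D (x, y) * (\<integral>\<^sup>+x'. g (x, x') \<partial>K (seg A' y)))"

text \<open>The density of the same step on the larger space of \<open>X\<close>, \<open>X'\<close>
  and \<open>Z\<close>, before \<open>X'\<close> is averaged out. Costs are estimated here, where
  \<open>X\<close> and \<open>X'\<close> can be compared directly.\<close>

definition weight :: "(('d, 'n) path \<times> ('d, 'n) path \<Rightarrow> ennreal) \<Rightarrow> ('d, 'n) path \<times> ('d, 'n) path \<times> ('d, 'n) path \<Rightarrow> ennreal" where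
  "weight D = (\<lambda>(x, x', z). D (x, x' + \<sigma> *\<^sub>R z) * g (x, x'))"

lemma K_facts: "prob_space (K s)" "sets (K s) = sets borel"
  using kernel_prob[OF K] by auto

context
  fixes D assumes adm: "admissible A D"
begin

lemma D_meas [measurable]: "D \<in> borel_measurable (borel \<Otimes>\<^sub>M borel)"
  using adm by (simp add: admissible_def)

lemma D_seg: "D (seg A x, y) = D (x, y)" "D (x, seg A y) = D (x, y)"
proof -
  have *: "D (seg A x, seg A y) = D (x, y)" for x y using adm by (simp add: admissible_def)
  show "D (seg A x, y) = D (x, y)" "D (x, seg A y) = D (x, y)"
    using *[of x y] *[of "seg A x" y] *[of x "seg A y"] by simp_all
qed

lemma next_density_meas [measurable]: "next_density D \<in> borel_measurable (borel \<Otimes>\<^sub>M borel)"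
proof -
  have [measurable]: "(\<lambda>w. K (seg A' (snd w))) \<in> borel \<Otimes>\<^sub>M borel \<rightarrow>\<^sub>M subprob_algebra borel"
    using measurable_compose[OF _ measurable_prob_algebraD[OF K]] by measurable
  have "(\<lambda>w. \<integral>\<^sup>+x'. g (fst w, x') \<partial>K (seg A' (snd w))) \<in> borel_measurable (borel \<Otimes>\<^sub>M borel)"
    by (rule nn_integral_measurable_subprob_algebra2[where N=borel]) measurable
  then show ?thesis unfolding next_density_def case_prod_unfold by measurable
qed

lemma weight_meas [measurable]: "weight D \<in> borel_measurable (borel \<Otimes>\<^sub>M (borel \<Otimes>\<^sub>M borel))"
  unfolding weight_def by measurable

text \<open>This ties the two densities together. Both \<open>f\<close> and \<open>D\<close> see
  \<open>y\<close> only on \<open>A'\<close>, as \<open>A\<close> is contained in \<open>A'\<close>,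
  so everything may be moved under the posterior kernel and disintegrated.\<close>

lemma next_density_int_snd:
  assumes [measurable]: "f \<in> borel_measurable borel"
  shows "(\<integral>\<^sup>+y. f (seg A' y) * next_density D (x, y) \<partial>\<nu>) =
    (\<integral>\<^sup>+z. \<integral>\<^sup>+x'. f (seg A' (x' + \<sigma> *\<^sub>R z)) * weight D (x, x', z) \<partial>\<mu> \<partial>\<xi>)"
proof -
  have DA: "D (x, y) = D (x, seg A' y)" for y
    using D_seg(2)[of x "seg A' y"] D_seg(2)[of x y] by (simp add: Int_absorb2 subset_insertI)
  have "(\<integral>\<^sup>+y. f (seg A' y) * next_density D (x, y) \<partial>\<nu>) =
    (\<integral>\<^sup>+y. \<integral>\<^sup>+x'. f (seg A' y) * D (x, seg A' y) * g (x, x') \<partial>K (seg A' y) \<partial>\<nu>)"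
  proof (rule nn_integral_cong)
    fix y
    note [measurable_cong] = K_facts(2)
    have "(\<integral>\<^sup>+x'. f (seg A' y) * D (x, seg A' y) * g (x, x') \<partial>K (seg A' y)) =
      f (seg A' y) * D (x, seg A' y) * (\<integral>\<^sup>+x'. g (x, x') \<partial>K (seg A' y))"
      by (rule nn_integral_cmult) measurable
    then show "f (seg A' y) * next_density D (x, y) = (\<integral>\<^sup>+x'. f (seg A' y) * D (x, seg A' y) * g (x, x') \<partial>K (seg A' y))"
      by (simp add: next_density_def DA[of y] mult.assoc)
  qed
  also have "\<dots> = (\<integral>\<^sup>+z. \<integral>\<^sup>+x'. f (seg A' (x' + \<sigma> *\<^sub>R z)) * D (x, seg A' (x' + \<sigma> *\<^sub>R z)) * g (x, x') \<partial>\<mu> \<partial>\<xi>)"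
  proof -
    define F where "F w = f (fst w) * D (x, fst w) * g (x, snd w)" for w
    have "F \<in> borel_measurable (borel \<Otimes>\<^sub>M borel)" unfolding F_def by measurable
    from K_disint[OF this] show ?thesis by (simp add: F_def)
  qed
  finally show ?thesis by (simp add: weight_def DA[symmetric] mult.assoc)
qed

text \<open>By Fubini the integral over \<open>x\<close> may be done first, for fixed
  \<open>y\<close> and \<open>x'\<close>. There \<open>D\<close> depends only on the past of
  \<open>x\<close>, so the factor \<open>g\<close> averages to 1.\<close>

lemma next_density_int_fst:
  assumes [measurable]: "f \<in> borel_measurable borel"
  shows "(\<integral>\<^sup>+x. f (seg A x) * next_density D (x, y) \<partial>\<mu>) = (\<integral>\<^sup>+x. f (seg A x) * D (x, y) \<partial>\<mu>)"
proof -
  interpret Ky: prob_space "K (seg A' y)" by (rule K_facts)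
  note [measurable_cong] = K_facts(2)[of "seg A' y"]
  have "(\<integral>\<^sup>+x. f (seg A x) * next_density D (x, y) \<partial>\<mu>) =
    (\<integral>\<^sup>+x. \<integral>\<^sup>+x'. f (seg A x) * D (x, y) * g (x, x') \<partial>K (seg A' y) \<partial>\<mu>)"
    by (simp add: next_density_def nn_integral_cmult mult.assoc)
  also have "\<dots> = (\<integral>\<^sup>+x'. \<integral>\<^sup>+x. f (seg A x) * D (x, y) * g (x, x') \<partial>\<mu> \<partial>K (seg A' y))"
    by (rule nn_integral_swap[where A=borel and B=borel])
      (auto simp: K_facts intro: \<mu>.sigma_finite_measure_axioms Ky.sigma_finite_measure_axioms)
  also have "\<dots> = (\<integral>\<^sup>+x'. \<integral>\<^sup>+x. f (seg A x) * D (x, y) \<partial>\<mu> \<partial>K (seg A' y))"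
  proof (rule nn_integral_cong)
    fix x'
    have "(\<integral>\<^sup>+x. (f (seg A x) * D (seg A x, y)) * g (x, x') \<partial>\<mu>) = (\<integral>\<^sup>+x. f (seg A x) * D (seg A x, y) \<partial>\<mu>)"
      by (rule g_int_fst[where f="\<lambda>s. f s * D (s, y)"]) measurable
    then show "(\<integral>\<^sup>+x. f (seg A x) * D (x, y) * g (x, x') \<partial>\<mu>) = (\<integral>\<^sup>+x. f (seg A x) * D (x, y) \<partial>\<mu>)"
      by (simp add: D_seg)
  qed
  also have "\<dots> = (\<integral>\<^sup>+x. f (seg A x) * D (x, y) \<partial>\<mu>)"
    using Ky.emeasure_space_1 by simp
  finally show ?thesis .
qed

text \<open>With \<open>z\<close> fixed, \<open>f\<close> and \<open>D\<close> depend on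
  \<open>x'\<close> only through \<open>seg A x'\<close>, so \<open>g\<close> averages to 1. The
  noise may therefore have an arbitrary dependence between times.\<close>

lemma weight_int_snd:
  assumes [measurable]: "f \<in> borel_measurable borel"
  shows "(\<integral>\<^sup>+x'. f (seg A (x' + \<sigma> *\<^sub>R z)) * weight D (x, x', z) \<partial>\<mu>) =
    (\<integral>\<^sup>+x'. f (seg A (x' + \<sigma> *\<^sub>R z)) * D (x, x' + \<sigma> *\<^sub>R z) \<partial>\<mu>)"
proof -
  let ?f = "\<lambda>s. f (s + seg A (\<sigma> *\<^sub>R z)) * D (x, s + seg A (\<sigma> *\<^sub>R z))"
  have "(\<integral>\<^sup>+x'. ?f (seg A x') * g (x, x') \<partial>\<mu>) = (\<integral>\<^sup>+x'. ?f (seg A x') \<partial>\<mu>)"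
    by (rule g_int_snd) measurable
  then show ?thesis by (simp add: D_seg weight_def mult.assoc flip: seg_add)
qed

lemma weight_int_fst: "(\<integral>\<^sup>+x. weight D (x, x', z) \<partial>\<mu>) = 1"
proof -
  have "(\<integral>\<^sup>+x. D (seg A x, x' + \<sigma> *\<^sub>R z) * g (x, x') \<partial>\<mu>) = (\<integral>\<^sup>+x. D (seg A x, x' + \<sigma> *\<^sub>R z) \<partial>\<mu>)"
    by (rule g_int_fst) measurable
  then show ?thesis using adm by (simp add: D_seg weight_def admissible_def)
qed

lemma weight_int_snd_one: "(\<integral>\<^sup>+z. \<integral>\<^sup>+x'. weight D (x, x', z) \<partial>\<mu> \<partial>\<xi>) = 1"
  using weight_int_snd[of "\<lambda>_. 1" _ x] admissible_lift(2)[OF adm, of x] by simp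

lemma next_density_refines: "refines A D (next_density D)"
  unfolding refines_def
proof (intro ballI conjI allI)
  fix f :: "('d, 'n) path \<Rightarrow> ennreal" and x y
  assume f[measurable]: "f \<in> borel_measurable borel"
  show "(\<integral>\<^sup>+x. f (seg A x) * next_density D (x, y) \<partial>\<mu>) = (\<integral>\<^sup>+x. f (seg A x) * D (x, y) \<partial>\<mu>)"
    by (rule next_density_int_fst[OF f])
  have AA: "A \<inter> A' = A" by auto
  have "(\<integral>\<^sup>+y. f (seg A (seg A' y)) * next_density D (x, y) \<partial>\<nu>) =
     (\<integral>\<^sup>+z. \<integral>\<^sup>+x'. f (seg A (seg A' (x' + \<sigma> *\<^sub>R z))) * weight D (x, x', z) \<partial>\<mu> \<partial>\<xi>)"
    by (rule next_density_int_snd) measurable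
  also have "\<dots> = (\<integral>\<^sup>+z. \<integral>\<^sup>+x'. f (seg A (x' + \<sigma> *\<^sub>R z)) * D (x, x' + \<sigma> *\<^sub>R z) \<partial>\<mu> \<partial>\<xi>)"
    by (simp add: AA weight_int_snd)
  also have "\<dots> = (\<integral>\<^sup>+y. f (seg A y) * D (x, y) \<partial>\<nu>)"
    by (rule nn_integral_\<nu>[symmetric]) measurable
  finally show "(\<integral>\<^sup>+y. f (seg A y) * next_density D (x, y) \<partial>\<nu>) = (\<integral>\<^sup>+y. f (seg A y) * D (x, y) \<partial>\<nu>)"
    by (simp add: AA)
qed

lemma next_density_admissible: "admissible A' (next_density D)"
  unfolding admissible_def
proof (intro conjI allI)
  have AA: "A \<inter> A' = A" by auto
  show "next_density D (seg A' x, seg A' y) = next_density D (x, y)" for x y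
  proof -
    have "D (seg A' x, seg A' y) = D (x, y)"
      using D_seg(1)[of "seg A' x" "seg A' y"] D_seg(2)[of "seg A x" "seg A' y"] by (simp add: AA D_seg)
    moreover have "g (seg A' x, x') = g (x, x')" for x' by (simp add: g_def AA)
    ultimately show ?thesis by (simp add: next_density_def)
  qed
  have r: "(\<integral>\<^sup>+y. f (seg A y) * next_density D (x, y) \<partial>\<nu>) = (\<integral>\<^sup>+y. f (seg A y) * D (x, y) \<partial>\<nu>)"
    "(\<integral>\<^sup>+x. f (seg A x) * next_density D (x, y) \<partial>\<mu>) = (\<integral>\<^sup>+x. f (seg A x) * D (x, y) \<partial>\<mu>)"
    if "f \<in> borel_measurable borel" for f x y
    using next_density_refines that unfolding refines_def by auto
  show "(\<integral>\<^sup>+y. next_density D (x, y) \<partial>\<nu>) = 1" for x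
    using r(1)[of "\<lambda>_. 1" x] adm by (simp add: admissible_def)
  show "(\<integral>\<^sup>+x. next_density D (x, y) \<partial>\<mu>) = 1" for y
    using r(2)[of "\<lambda>_. 1" y] adm by (simp add: admissible_def)
qed measurable

end

end

section \<open>The cost of one time step\<close>

lemma ennreal_le_diff_add: "a \<le> a - b + (b :: ennreal)"
  by (cases "b \<le> a") (auto simp: diff_add_cancel_ennreal not_le intro: less_imp_le order_trans)

context smoothing
begin

lemma sets_\<mu>\<nu> [measurable_cong]: "sets (\<mu> \<Otimes>\<^sub>M \<nu>) = sets (borel \<Otimes>\<^sub>M borel)"
  by (intro sets_pair_measure_cong) auto

lemma nn_integral_density_\<mu>\<nu>:
  assumes [measurable]: "D \<in> borel_measurable (borel \<Otimes>\<^sub>M borel)" "f \<in> borel_measurable (borel \<Otimes>\<^sub>M borel)"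
  shows "(\<integral>\<^sup>+w. f w \<partial>density (\<mu> \<Otimes>\<^sub>M \<nu>) D) = (\<integral>\<^sup>+x. \<integral>\<^sup>+y. f (x, y) * D (x, y) \<partial>\<nu> \<partial>\<mu>)"
    "(\<integral>\<^sup>+w. f w \<partial>density (\<mu> \<Otimes>\<^sub>M \<nu>) D) = (\<integral>\<^sup>+y. \<integral>\<^sup>+x. f (x, y) * D (x, y) \<partial>\<mu> \<partial>\<nu>)"
proof -
  have "(\<integral>\<^sup>+w. f w \<partial>density (\<mu> \<Otimes>\<^sub>M \<nu>) D) = (\<integral>\<^sup>+w. f w * D w \<partial>(\<mu> \<Otimes>\<^sub>M \<nu>))"
    by (subst nn_integral_density) (auto simp: mult.commute)
  also have "\<dots> = (\<integral>\<^sup>+x. \<integral>\<^sup>+y. f (x, y) * D (x, y) \<partial>\<nu> \<partial>\<mu>)"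
    by (rule \<nu>.nn_integral_fst[symmetric]) measurable
  finally show 1: "(\<integral>\<^sup>+w. f w \<partial>density (\<mu> \<Otimes>\<^sub>M \<nu>) D) = (\<integral>\<^sup>+x. \<integral>\<^sup>+y. f (x, y) * D (x, y) \<partial>\<nu> \<partial>\<mu>)" .
  show "(\<integral>\<^sup>+w. f w \<partial>density (\<mu> \<Otimes>\<^sub>M \<nu>) D) = (\<integral>\<^sup>+y. \<integral>\<^sup>+x. f (x, y) * D (x, y) \<partial>\<mu> \<partial>\<nu>)"
    unfolding 1
    by (rule nn_integral_swap[where A=borel and B=borel])
      (auto intro: \<mu>.sigma_finite_measure_axioms \<nu>.sigma_finite_measure_axioms)
qed

end

context coupling_step
begin

definition disc_error :: "('d, 'n) path \<Rightarrow> ennreal" where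
  "disc_error x = lpn p (\<kappa> (seg A x)) (\<lambda>a. ennreal (norm (a - \<rho> a)))"

lemma disc_error_meas [measurable]: "disc_error \<in> borel_measurable borel"
proof -
  have "(\<lambda>s. \<integral>\<^sup>+a. epowr (ennreal (norm (a - \<rho> a))) p \<partial>\<kappa> s) \<in> borel_measurable borel"
    by (rule measurable_compose[OF measurable_prob_algebraD[OF \<kappa>] nn_integral_measurable_subprob_algebra]) measurable
  from measurable_compose[OF borel_measurable_seg this] show ?thesis
    unfolding disc_error_def lpn_def by measurable
qed

lemma lpn_disc_error: "lpn p \<mu> disc_error \<le> ennreal \<epsilon>"
proof -
  have p0: "0 < p" using p by simp
  define F where "F w = epowr (ennreal (norm (snd w - \<rho> (snd w)))) p" for w :: "('d, 'n) path \<times> (real ^ 'd)"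
  have "F \<in> borel_measurable (borel \<Otimes>\<^sub>M borel)" unfolding F_def by measurable
  then have "(\<integral>\<^sup>+x. F (seg A x, x $ i) \<partial>\<mu>) = (\<integral>\<^sup>+x. \<integral>\<^sup>+a. F (seg A x, a) \<partial>\<kappa> (seg A x) \<partial>\<mu>)"
    using kernel by (simp add: is_kernel_def)
  then have "lpn p \<mu> disc_error = lpn p \<mu> (\<lambda>x. ennreal (norm (x $ i - \<rho> (x $ i))))"
    using p0 by (simp add: lpn_def disc_error_def epowr_inverse F_def)
  then show ?thesis using \<rho>_error by simp
qed

lemma \<rho>_count_space [measurable]: "(\<lambda>x. \<rho> (x $ i)) \<in> borel \<rightarrow>\<^sub>M count_space (range \<rho>)"
proof (subst measurable_count_space_eq2[OF fin], intro conjI ballI)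
  fix j
  have "(\<lambda>x. \<rho> (x $ i)) \<in> borel_measurable (borel :: ('d, 'n) path measure)" by measurable
  from measurable_sets[OF this borel_singleton[OF sets.empty_sets]]
  show "(\<lambda>x. \<rho> (x $ i)) -` {j} \<inter> space borel \<in> sets (borel :: ('d, 'n) path measure)" .
qed auto

text \<open>The nearly optimal discrete cost minus all its errors. It is measurable and bounded by
  the Wasserstein distance of the kernels; adding the errors back gives an upper bound for the
  discrete cost, even where the subtraction truncates.\<close>

definition low :: "('d, 'n) path \<times> ('d, 'n) path \<Rightarrow> ennreal" where
  "low = (\<lambda>(x, x'). epowr (ennreal (cost (seg A x, seg A x'))) (1 / p)
      - (disc_error x + disc_error x' + epowr (ennreal \<eta>) (1 / p)))"

lemma low_meas [measurable]: "low \<in> borel_measurable (borel \<Otimes>\<^sub>M borel)"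
  unfolding low_def by measurable

lemma low_le_wasserstein: "low (x, x') \<le> wasserstein p (\<kappa> (seg A x)) (\<kappa> (seg A x'))"
proof -
  have "epowr (ennreal (cost (seg A x, seg A x'))) (1 / p) \<le>
    wasserstein p (\<kappa> (seg A x)) (\<kappa> (seg A x')) + (disc_error x + disc_error x' + epowr (ennreal \<eta>) (1 / p))"
    unfolding disc_error_def
    using q_opt[of "seg A x" "seg A x'"] kernel_prob[OF \<kappa>] \<eta>
    by (intro discrete_cost_le_wasserstein p \<rho> fin) (auto simp: cost_def cell_prob_def[abs_def])
  then show ?thesis
    unfolding low_def prod.case by (simp add: ennreal_minus_le_iff add.commute)
qed

context
  fixes D assumes adm: "admissible A D"
begin

lemmas [measurable] = D_meas[OF adm] next_density_meas[OF adm] weight_meas[OF adm]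

text \<open>The cost at time \<open>i\<close> sees \<open>y\<close> only through
  \<open>y $ i\<close>, and \<open>i\<close> belongs to \<open>A'\<close>, so it can be evaluated
  before \<open>X'\<close> is averaged out.\<close>

lemma step_cost_eq:
  "lpn p (density (\<mu> \<Otimes>\<^sub>M \<nu>) (next_density D)) (\<lambda>(x, y). ennreal (norm (x $ i - y $ i))) =
   lpn p (density \<Omega> (weight D)) (\<lambda>(x, x', z). ennreal (norm (x $ i - (x' + \<sigma> *\<^sub>R z) $ i)))"
proof -
  let ?c = "\<lambda>a b :: real ^ 'd. epowr (ennreal (norm (a - b))) p"
  have "(\<integral>\<^sup>+w. (case w of (x, y) \<Rightarrow> ?c (x $ i) (y $ i)) \<partial>density (\<mu> \<Otimes>\<^sub>M \<nu>) (next_density D)) =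
    (\<integral>\<^sup>+x. \<integral>\<^sup>+y. ?c (x $ i) (seg A' y $ i) * next_density D (x, y) \<partial>\<nu> \<partial>\<mu>)"
    by (subst nn_integral_density_\<mu>\<nu>(1)) simp_all
  also have "\<dots> = (\<integral>\<^sup>+x. \<integral>\<^sup>+z. \<integral>\<^sup>+x'. ?c (x $ i) (seg A' (x' + \<sigma> *\<^sub>R z) $ i) * weight D (x, x', z) \<partial>\<mu> \<partial>\<xi> \<partial>\<mu>)"
    by (intro nn_integral_cong next_density_int_snd[OF adm]) measurable
  also have "\<dots> = (\<integral>\<^sup>+w. (case w of (x, x', z) \<Rightarrow> ?c (x $ i) ((x' + \<sigma> *\<^sub>R z) $ i)) \<partial>density \<Omega> (weight D))"
    by (simp add: nn_integral_density nn_integral_\<Omega>(1) case_prod_unfold mult.commute)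
  finally show ?thesis by (simp add: lpn_def case_prod_unfold)
qed

text \<open>Averaging over \<open>x $ i\<close> and then over \<open>x' $ i\<close>, each given its
  past, turns \<open>g\<close> into the entries of \<open>q\<close>. What remains is the cost of the
  matrix at the two pasts, under the law \<open>lift D\<close> from before the step.\<close>

lemma discrete_cost_eq:
  "lpn p (density \<Omega> (weight D)) (\<lambda>(x, x', z). ennreal (norm (\<rho> (x $ i) - \<rho> (x' $ i)))) =
   lpn p (lift D) (\<lambda>(x, x', z). epowr (ennreal (cost (seg A x, seg A x'))) (1 / p))"
proof -
  have p0: "0 < p" using p by simp
  define N where "N j l = ennreal (norm (j - l) powr p)" for j l :: "real ^ 'd"
  have [measurable]: "(\<lambda>w. N (f w) (g w)) \<in> borel_measurable M"
    if "f \<in> borel_measurable M" "g \<in> borel_measurable M" for f g and M :: "'m measure"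
    unfolding N_def using that by measurable
  \<comment> \<open>The integrand once \<open>x $ i\<close> is averaged out but
    \<open>x' $ i\<close> is not. The integrals over \<open>x\<close> and \<open>x'\<close> are
    swapped between the two averages.\<close>
  define S where "S z w = (\<Sum>j\<in>range \<rho>. D (seg A (fst w), snd w + \<sigma> *\<^sub>R z) * G (seg A (fst w)) (seg A (snd w)) j (\<rho> (snd w $ i))
      * N j (\<rho> (snd w $ i)) * ennreal (cp (seg A (fst w)) j))" for z w
  have Sm: "S z \<in> borel_measurable (borel \<Otimes>\<^sub>M borel)" for z
  proof -
    have [measurable]: "(\<lambda>w. G (seg A (fst w)) (seg A (snd w)) j (\<rho> (snd w $ i))) \<in> borel_measurable (borel \<Otimes>\<^sub>M borel)"
      if j: "j \<in> range \<rho>" for j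
    proof (rule measurable_compose_countable'[where I="range \<rho>"])
      fix l assume l: "l \<in> range \<rho>"
      have "(\<lambda>w :: ('d, 'n) path \<times> ('d, 'n) path. (seg A (fst w), seg A (snd w))) \<in> borel \<Otimes>\<^sub>M borel \<rightarrow>\<^sub>M borel \<Otimes>\<^sub>M borel"
        by measurable
      from measurable_compose[OF this G_meas[OF j l]]
      show "(\<lambda>w. G (seg A (fst w)) (seg A (snd w)) j l) \<in> borel_measurable (borel \<Otimes>\<^sub>M borel)" by simp
    next
      show "(\<lambda>w. \<rho> (snd w $ i)) \<in> borel \<Otimes>\<^sub>M borel \<rightarrow>\<^sub>M count_space (range \<rho>)"
        by (rule measurable_compose[OF measurable_snd \<rho>_count_space])
    qed (use fin in \<open>simp add: countable_finite\<close>)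
    show ?thesis unfolding S_def by measurable
  qed
  have x: "(\<integral>\<^sup>+x. weight D (x, x', z) * N (\<rho> (x $ i)) (\<rho> (x' $ i)) \<partial>\<mu>) = (\<integral>\<^sup>+x. S z (x, x') \<partial>\<mu>)" for x' z
  proof -
    let ?h = "\<lambda>s j. D (s, x' + \<sigma> *\<^sub>R z) * G s (seg A x') j (\<rho> (x' $ i)) * N j (\<rho> (x' $ i))"
    have "(\<integral>\<^sup>+x. weight D (x, x', z) * N (\<rho> (x $ i)) (\<rho> (x' $ i)) \<partial>\<mu>) = (\<integral>\<^sup>+x. ?h (seg A x) (\<rho> (x $ i)) \<partial>\<mu>)"
      by (simp add: weight_def g_def D_seg[OF adm])
    also have "\<dots> = (\<integral>\<^sup>+x. (\<Sum>j\<in>range \<rho>. ?h (seg A x) j * ennreal (cp (seg A x) j)) \<partial>\<mu>)"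
      by (intro is_kernel_simple[OF kernel sets_\<mu> \<rho> fin] borel_measurable_times_ennreal G_meas_fst) auto
    finally show ?thesis by (simp add: S_def)
  qed
  have x': "(\<integral>\<^sup>+x'. S z (x, x') \<partial>\<mu>) = (\<integral>\<^sup>+x'. D (x, x' + \<sigma> *\<^sub>R z) * ennreal (cost (seg A x, seg A x')) \<partial>\<mu>)" for x z
  proof -
    let ?h = "\<lambda>s l. \<Sum>j\<in>range \<rho>. D (seg A x, s + seg A (\<sigma> *\<^sub>R z)) * G (seg A x) s j l * N j l * ennreal (cp (seg A x) j)"
    have DA: "D (seg A x, seg A x' + seg A (\<sigma> *\<^sub>R z)) = D (x, x' + \<sigma> *\<^sub>R z)" for x'
      unfolding seg_add[symmetric] by (simp add: D_seg[OF adm])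
    have "(\<integral>\<^sup>+x'. S z (x, x') \<partial>\<mu>) = (\<integral>\<^sup>+x'. ?h (seg A x') (\<rho> (x' $ i)) \<partial>\<mu>)"
      unfolding DA by (simp add: S_def D_seg[OF adm])
    also have "\<dots> = (\<integral>\<^sup>+x'. (\<Sum>l\<in>range \<rho>. ?h (seg A x') l * ennreal (cp (seg A x') l)) \<partial>\<mu>)"
      by (intro is_kernel_simple[OF kernel sets_\<mu> \<rho> fin] borel_measurable_sum borel_measurable_times_ennreal G_meas_snd) auto
    also have "\<dots> = (\<integral>\<^sup>+x'. D (x, x' + \<sigma> *\<^sub>R z) * ennreal (cost (seg A x, seg A x')) \<partial>\<mu>)"
    proof (rule nn_integral_cong)
      fix x'
      have "(\<Sum>l\<in>range \<rho>. ?h (seg A x') l * ennreal (cp (seg A x') l)) =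
        (\<Sum>j\<in>range \<rho>. \<Sum>l\<in>range \<rho>. D (x, x' + \<sigma> *\<^sub>R z) * (N j l * G (seg A x) (seg A x') j l * ennreal (cp (seg A x) j) * ennreal (cp (seg A x') l)))"
        unfolding DA sum_distrib_right by (subst sum.swap) (simp only: mult_ac)
      also have "\<dots> = D (x, x' + \<sigma> *\<^sub>R z) * ennreal (cost (seg A x, seg A x'))"
        by (simp add: G_cost[symmetric] N_def sum_distrib_left)
      finally show "(\<Sum>l\<in>range \<rho>. ?h (seg A x') l * ennreal (cp (seg A x') l)) = D (x, x' + \<sigma> *\<^sub>R z) * ennreal (cost (seg A x, seg A x'))" .
    qed
    finally show ?thesis .
  qed
  have "(\<integral>\<^sup>+w. (case w of (x, x', z) \<Rightarrow> N (\<rho> (x $ i)) (\<rho> (x' $ i))) \<partial>density \<Omega> (weight D)) =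
    (\<integral>\<^sup>+z. \<integral>\<^sup>+x'. \<integral>\<^sup>+x. weight D (x, x', z) * N (\<rho> (x $ i)) (\<rho> (x' $ i)) \<partial>\<mu> \<partial>\<mu> \<partial>\<xi>)"
    by (simp add: nn_integral_density nn_integral_\<Omega>(2) case_prod_unfold)
  also have "\<dots> = (\<integral>\<^sup>+z. \<integral>\<^sup>+x'. \<integral>\<^sup>+x. S z (x, x') \<partial>\<mu> \<partial>\<mu> \<partial>\<xi>)"
    by (simp only: x)
  also have "\<dots> = (\<integral>\<^sup>+z. \<integral>\<^sup>+x. \<integral>\<^sup>+x'. S z (x, x') \<partial>\<mu> \<partial>\<mu> \<partial>\<xi>)"
    by (intro nn_integral_cong swap_\<mu>\<mu>[symmetric] Sm)
  also have "\<dots> = (\<integral>\<^sup>+z. \<integral>\<^sup>+x. \<integral>\<^sup>+x'. D (x, x' + \<sigma> *\<^sub>R z) * ennreal (cost (seg A x, seg A x')) \<partial>\<mu> \<partial>\<mu> \<partial>\<xi>)"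
    by (simp only: x')
  also have "\<dots> = (\<integral>\<^sup>+z. \<integral>\<^sup>+x'. \<integral>\<^sup>+x. D (x, x' + \<sigma> *\<^sub>R z) * ennreal (cost (seg A x, seg A x')) \<partial>\<mu> \<partial>\<mu> \<partial>\<xi>)"
  proof (rule nn_integral_cong)
    fix z
    show "(\<integral>\<^sup>+x. \<integral>\<^sup>+x'. D (x, x' + \<sigma> *\<^sub>R z) * ennreal (cost (seg A x, seg A x')) \<partial>\<mu> \<partial>\<mu>) =
      (\<integral>\<^sup>+x'. \<integral>\<^sup>+x. D (x, x' + \<sigma> *\<^sub>R z) * ennreal (cost (seg A x, seg A x')) \<partial>\<mu> \<partial>\<mu>)"
      using swap_\<mu>\<mu>[of "\<lambda>w. D (fst w, snd w + \<sigma> *\<^sub>R z) * ennreal (cost (seg A (fst w), seg A (snd w)))"] by simp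
  qed
  also have "\<dots> = (\<integral>\<^sup>+w. (case w of (x, x', z) \<Rightarrow> ennreal (cost (seg A x, seg A x'))) \<partial>lift D)"
    by (simp add: lift_def nn_integral_density nn_integral_\<Omega>(2) case_prod_unfold)
  finally show ?thesis using p0 by (simp add: lpn_def case_prod_unfold N_def epowr_norm epowr_inverse)
qed

text \<open>The five errors: discretisation of \<open>x $ i\<close> and of \<open>x' $ i\<close>,
  the two conditional errors \<open>disc_error\<close> subtracted in \<open>low\<close>, and the
  slack \<open>\<eta>\<close> of the coupling matrix.\<close>

lemma step_bound:
  "lpn p (density (\<mu> \<Otimes>\<^sub>M \<nu>) (next_density D)) (\<lambda>(x, y). ennreal (norm (x $ i - y $ i))) \<le>
   lpn p (lift D) (\<lambda>(x, x', z). low (x, x')) + ennreal \<sigma> * lpn p \<xi> (\<lambda>z. ennreal (norm z)) + 5 * ennreal \<epsilon>"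
proof -
  have p0: "0 < p" using p by simp
  let ?R = "density \<Omega> (weight D)" and ?e = "\<lambda>x :: ('d, 'n) path. ennreal (norm (x $ i - \<rho> (x $ i)))"
  let ?E = "epowr (ennreal \<eta>) (1 / p)"
  note marg = lpn_density_marginals[OF weight_meas[OF adm] weight_int_snd_one[OF adm] weight_int_fst[OF adm]]
  interpret L: prob_space "lift D"
  proof
    have "epowr (emeasure (lift D) (space (lift D))) (1 / p) = 1"
      using lpn_lift(1)[OF adm, of "\<lambda>_. 1"] by (simp add: lpn_def case_prod_unfold)
    then have "epowr (epowr (emeasure (lift D) (space (lift D))) (1 / p)) p = 1" by simp
    then show "emeasure (lift D) (space (lift D)) = 1" by (simp only: epowr_inverse(2)[OF p0])
  qed
  have "lpn p ?R (\<lambda>(x, x', z). ennreal (norm (x $ i - (x' + \<sigma> *\<^sub>R z) $ i))) \<le>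
    lpn p ?R (\<lambda>w. (case w of (x, x', z) \<Rightarrow> ennreal (norm (\<rho> (x $ i) - \<rho> (x' $ i)))) +
      ((case w of (x, x', z) \<Rightarrow> ?e x) + ((case w of (x, x', z) \<Rightarrow> ?e x') + (case w of (x, x', z) \<Rightarrow> ennreal \<sigma> * ennreal (norm z)))))"
  proof (rule lpn_mono[OF p0], clarsimp)
    fix x x' z :: "('d, 'n) path"
    have "norm (\<sigma> *\<^sub>R z $ i) \<le> \<sigma> * norm z"
      using \<sigma> by (simp add: Finite_Cartesian_Product.norm_nth_le mult_left_mono)
    moreover have "norm (a - (b + c)) \<le> norm (a' - b') + (norm (a - a') + (norm (b - b') + norm c))"
      for a b c a' b' :: "real ^ 'd" by norm
    note this[of "x $ i" "x' $ i" "\<sigma> *\<^sub>R z $ i" "\<rho> (x $ i)" "\<rho> (x' $ i)"]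
    ultimately have "norm (x $ i - (x' $ i + \<sigma> *\<^sub>R z $ i)) \<le> norm (\<rho> (x $ i) - \<rho> (x' $ i)) +
      (norm (x $ i - \<rho> (x $ i)) + (norm (x' $ i - \<rho> (x' $ i)) + \<sigma> * norm z))" by linarith
    then show "ennreal (norm (x $ i - (x' $ i + \<sigma> *\<^sub>R z $ i))) \<le> ennreal (norm (\<rho> (x $ i) - \<rho> (x' $ i))) +
      (ennreal (norm (x $ i - \<rho> (x $ i))) + (ennreal (norm (x' $ i - \<rho> (x' $ i))) + ennreal \<sigma> * ennreal (norm z)))"
      using \<sigma> by (simp flip: ennreal_plus ennreal_mult)
  qed
  also have "\<dots> \<le> lpn p ?R (\<lambda>(x, x', z). ennreal (norm (\<rho> (x $ i) - \<rho> (x' $ i)))) +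
      (lpn p ?R (\<lambda>(x, x', z). ?e x) + (lpn p ?R (\<lambda>(x, x', z). ?e x') + lpn p ?R (\<lambda>(x, x', z). ennreal \<sigma> * ennreal (norm z))))"
    by (intro order_trans[OF lpn_add_le[OF p]] add_left_mono order_refl) measurable
  also have "lpn p ?R (\<lambda>(x, x', z). ?e x) = lpn p \<mu> ?e" by (rule marg) measurable
  also have "lpn p ?R (\<lambda>(x, x', z). ?e x') = lpn p \<mu> ?e" by (rule marg) measurable
  also have "lpn p ?R (\<lambda>(x, x', z). ennreal \<sigma> * ennreal (norm z)) = lpn p \<xi> (\<lambda>z. ennreal \<sigma> * ennreal (norm z))"
    by (rule marg(3)) measurable
  also have "\<dots> = ennreal \<sigma> * lpn p \<xi> (\<lambda>z. ennreal (norm z))"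
    by (rule lpn_cmult[OF _ p0]) measurable
  also have "lpn p ?R (\<lambda>(x, x', z). ennreal (norm (\<rho> (x $ i) - \<rho> (x' $ i)))) =
      lpn p (lift D) (\<lambda>(x, x', z). epowr (ennreal (cost (seg A x, seg A x'))) (1 / p))"
    by (rule discrete_cost_eq)
  also have "\<dots> \<le> lpn p (lift D) (\<lambda>w. (case w of (x, x', z) \<Rightarrow> low (x, x')) +
      ((case w of (x, x', z) \<Rightarrow> disc_error x) + ((case w of (x, x', z) \<Rightarrow> disc_error x') + ?E)))"
    unfolding low_def
    by (intro lpn_mono[OF p0]) (simp only: case_prod_unfold fst_conv snd_conv add.assoc ennreal_le_diff_add)
  also have "\<dots> \<le> lpn p (lift D) (\<lambda>(x, x', z). low (x, x')) +
      (lpn p (lift D) (\<lambda>(x, x', z). disc_error x) + (lpn p (lift D) (\<lambda>(x, x', z). disc_error x') + lpn p (lift D) (\<lambda>_. ?E)))"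
    by (intro order_trans[OF lpn_add_le[OF p]] add_left_mono order_refl) measurable
  also have "lpn p (lift D) (\<lambda>(x, x', z). disc_error x) = lpn p \<mu> disc_error"
    by (rule lpn_lift(1)[OF adm]) measurable
  also have "lpn p (lift D) (\<lambda>(x, x', z). disc_error x') = lpn p \<mu> disc_error"
    by (rule lpn_lift(2)[OF adm]) measurable
  also have "lpn p (lift D) (\<lambda>_. ?E) = ?E"
    by (rule lpn_const[OF L.prob_space_axioms p0])
  finally have "lpn p ?R (\<lambda>(x, x', z). ennreal (norm (x $ i - (x' + \<sigma> *\<^sub>R z) $ i))) \<le>
     lpn p (lift D) (\<lambda>(x, x', z). low (x, x')) + (lpn p \<mu> disc_error + (lpn p \<mu> disc_error + ?E)) +
       (lpn p \<mu> ?e + (lpn p \<mu> ?e + ennreal \<sigma> * lpn p \<xi> (\<lambda>z. ennreal (norm z))))"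
    by (simp add: add_right_mono)
  also have "\<dots> \<le> lpn p (lift D) (\<lambda>(x, x', z). low (x, x')) + (ennreal \<epsilon> + (ennreal \<epsilon> + ennreal \<epsilon>)) +
       (ennreal \<epsilon> + (ennreal \<epsilon> + ennreal \<sigma> * lpn p \<xi> (\<lambda>z. ennreal (norm z))))"
    by (intro add_mono lpn_disc_error \<rho>_error \<eta> order_refl)
  also have "\<dots> = lpn p (lift D) (\<lambda>(x, x', z). low (x, x')) + ennreal \<sigma> * lpn p \<xi> (\<lambda>z. ennreal (norm z)) + 5 * ennreal \<epsilon>"
  proof -
    have "5 * ennreal \<epsilon> = ennreal \<epsilon> + ennreal \<epsilon> + ennreal \<epsilon> + ennreal \<epsilon> + ennreal \<epsilon>"
    proof -
      have "(5 :: ennreal) = 1 + 1 + 1 + 1 + 1" by simp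
      then show ?thesis by (simp only: distrib_right mult_1)
    qed
    then show ?thesis by (simp add: ac_simps)
  qed
  finally show ?thesis by (simp add: step_cost_eq)
qed

end

end

section \<open>Existence of a step, and couplings obtained from densities\<close>

context smoothing
begin

lemma nn_integral_\<mu>\<xi>:
  assumes [measurable]: "f \<in> borel_measurable (borel \<Otimes>\<^sub>M borel)"
  shows "(\<integral>\<^sup>+w. f w \<partial>(\<mu> \<Otimes>\<^sub>M \<xi>)) = (\<integral>\<^sup>+z. \<integral>\<^sup>+x. f (x, z) \<partial>\<mu> \<partial>\<xi>)"
proof -
  interpret pair_prob_space \<mu> \<xi> ..
  show ?thesis by (rule nn_integral_snd[symmetric]) measurable
qed

text \<open>Disintegrate \<open>\<mu> \<Otimes>\<^sub>M \<xi>\<close> along the segment of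
  \<open>fst w + \<sigma> *\<^sub>R snd w\<close>, whose law under this product is that of
  \<open>seg A\<close> under \<open>\<nu>\<close>.\<close>

lemma exists_posterior:
  "\<exists>K. K \<in> borel \<rightarrow>\<^sub>M prob_algebra borel \<and> (\<forall>f\<in>borel_measurable (borel \<Otimes>\<^sub>M borel).
     (\<integral>\<^sup>+y. \<integral>\<^sup>+x'. f (seg A y, x') \<partial>K (seg A y) \<partial>\<nu>) = (\<integral>\<^sup>+z. \<integral>\<^sup>+x'. f (seg A (x' + \<sigma> *\<^sub>R z), x') \<partial>\<mu> \<partial>\<xi>))"
proof -
  interpret pair_prob_space \<mu> \<xi> ..
  let ?S = "\<lambda>w. seg A (fst w + \<sigma> *\<^sub>R snd w)"
  have Sm: "?S \<in> \<mu> \<Otimes>\<^sub>M \<xi> \<rightarrow>\<^sub>M borel" by measurable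
  have Xm: "fst \<in> borel_measurable (\<mu> \<Otimes>\<^sub>M \<xi>)" by measurable
  obtain K where K: "K \<in> borel \<rightarrow>\<^sub>M prob_algebra borel"
    and rect: "\<And>B C. B \<in> sets borel \<Longrightarrow> C \<in> sets borel \<Longrightarrow>
      emeasure (\<mu> \<Otimes>\<^sub>M \<xi>) {w\<in>space (\<mu> \<Otimes>\<^sub>M \<xi>). ?S w \<in> B \<and> fst w \<in> C} =
      (\<integral>\<^sup>+w. indicator B (?S w) * emeasure (K (?S w)) C \<partial>(\<mu> \<Otimes>\<^sub>M \<xi>))"
    using disintegration[OF P.prob_space_axioms Sm Xm] by blast
  have "(\<integral>\<^sup>+y. \<integral>\<^sup>+x'. f (seg A y, x') \<partial>K (seg A y) \<partial>\<nu>) = (\<integral>\<^sup>+z. \<integral>\<^sup>+x'. f (seg A (x' + \<sigma> *\<^sub>R z), x') \<partial>\<mu> \<partial>\<xi>)"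
    if f[measurable]: "f \<in> borel_measurable (borel \<Otimes>\<^sub>M borel)" for f
  proof -
    have [measurable]: "(\<lambda>s. \<integral>\<^sup>+x'. f (s, x') \<partial>K s) \<in> borel_measurable borel"
      by (rule nn_integral_measurable_subprob_algebra2[OF _ measurable_prob_algebraD[OF K]]) measurable
    have "(\<integral>\<^sup>+z. \<integral>\<^sup>+x'. f (seg A (x' + \<sigma> *\<^sub>R z), x') \<partial>\<mu> \<partial>\<xi>) = (\<integral>\<^sup>+w. f (?S w, fst w) \<partial>(\<mu> \<Otimes>\<^sub>M \<xi>))"
      by (subst nn_integral_\<mu>\<xi>) simp_all
    also have "\<dots> = (\<integral>\<^sup>+w. \<integral>\<^sup>+x. f (?S w, x) \<partial>K (?S w) \<partial>(\<mu> \<Otimes>\<^sub>M \<xi>))"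
      by (rule disintegration_nn_integral[OF P.prob_space_axioms Sm Xm K rect f])
    also have "\<dots> = (\<integral>\<^sup>+z. \<integral>\<^sup>+x'. (\<lambda>s. \<integral>\<^sup>+x. f (s, x) \<partial>K s) (seg A (x' + \<sigma> *\<^sub>R z)) \<partial>\<mu> \<partial>\<xi>)"
      by (subst nn_integral_\<mu>\<xi>) simp_all
    also have "\<dots> = (\<integral>\<^sup>+y. (\<lambda>s. \<integral>\<^sup>+x. f (s, x) \<partial>K s) (seg A y) \<partial>\<nu>)"
      by (rule nn_integral_\<nu>[symmetric]) measurable
    finally show ?thesis by simp
  qed
  with K show ?thesis by blast
qed

text \<open>Chooses the data of \<open>coupling_step\<close> and hides them: the induction over time
  sees only the new density and a measurable minorant \<open>W\<close> of the Wasserstein distance,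
  for which \<open>low\<close> is taken.\<close>

lemma exists_step:
  assumes \<sigma>: "0 < \<sigma>" and moment: "(\<integral>\<^sup>+x. ennreal (norm x powr p) \<partial>\<mu>) < \<top>"
    and kernel: "is_kernel \<mu> A i \<kappa>" and adm: "admissible A D" and \<epsilon>: "0 < \<epsilon>"
  shows "\<exists>D' W. admissible (insert i A) D' \<and> refines A D D' \<and> W \<in> borel_measurable (borel \<Otimes>\<^sub>M borel) \<and>
    (\<forall>x x'. W (x, x') \<le> wasserstein p (\<kappa> (seg A x)) (\<kappa> (seg A x'))) \<and>
    lpn p (density (\<mu> \<Otimes>\<^sub>M \<nu>) D') (\<lambda>(x, y). ennreal (norm (x $ i - y $ i))) \<le>
      lpn p (lift D) (\<lambda>(x, x', z). W (x, x')) + ennreal \<sigma> * lpn p \<xi> (\<lambda>z. ennreal (norm z)) + ennreal \<epsilon>"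
proof -
  have p0: "0 < p" using p by simp
  have \<kappa>: "\<kappa> \<in> borel \<rightarrow>\<^sub>M prob_algebra borel" using kernel by (simp add: is_kernel_def)
  define \<alpha> where "\<alpha> = distr \<mu> borel (\<lambda>x. x $ i)"
  have "(\<integral>\<^sup>+a. ennreal (norm a powr p) \<partial>\<alpha>) = (\<integral>\<^sup>+x. ennreal (norm (x $ i) powr p) \<partial>\<mu>)"
    unfolding \<alpha>_def by (rule nn_integral_distr) measurable
  also have "\<dots> \<le> (\<integral>\<^sup>+x. ennreal (norm x powr p) \<partial>\<mu>)"
    using p0 by (intro nn_integral_mono ennreal_leI powr_mono2 Finite_Cartesian_Product.norm_nth_le) auto
  finally have fin_\<alpha>: "(\<integral>\<^sup>+a. ennreal (norm a powr p) \<partial>\<alpha>) < \<top>" using moment by simp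
  have "sets \<alpha> = sets borel" "0 < \<epsilon> / 5" using \<epsilon> by (auto simp: \<alpha>_def)
  from simple_approximation_Lp[OF p this(1) fin_\<alpha> this(2)] obtain \<rho>
    where \<rho>[measurable]: "\<rho> \<in> borel_measurable borel" and fin: "finite (range \<rho>)"
      and \<rho>\<epsilon>: "lpn p \<alpha> (\<lambda>x. ennreal (norm (x - \<rho> x))) \<le> ennreal (\<epsilon> / 5)" by blast
  have "lpn p \<alpha> (\<lambda>x. ennreal (norm (x - \<rho> x))) = lpn p \<mu> (\<lambda>x. ennreal (norm (x $ i - \<rho> (x $ i))))"
    unfolding \<alpha>_def by (rule lpn_distr) measurable
  with \<rho>\<epsilon> have \<rho>\<mu>: "lpn p \<mu> (\<lambda>x. ennreal (norm (x $ i - \<rho> (x $ i)))) \<le> ennreal (\<epsilon> / 5)" by simp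
  obtain K where K: "K \<in> borel \<rightarrow>\<^sub>M prob_algebra borel" "\<And>f. f \<in> borel_measurable (borel \<Otimes>\<^sub>M borel) \<Longrightarrow>
     (\<integral>\<^sup>+y. \<integral>\<^sup>+x'. f (seg (insert i A) y, x') \<partial>K (seg (insert i A) y) \<partial>\<nu>) =
     (\<integral>\<^sup>+z. \<integral>\<^sup>+x'. f (seg (insert i A) (x' + \<sigma> *\<^sub>R z), x') \<partial>\<mu> \<partial>\<xi>)"
    using exists_posterior[of "insert i A"] by blast
  \<comment> \<open>Chosen so that the p-th root is \<open>\<epsilon> / 5\<close>, one of the five
    equal errors of a step.\<close>
  define \<eta> where "\<eta> = (\<epsilon> / 5) powr p"
  have \<eta>: "0 < \<eta>" "epowr (ennreal \<eta>) (1 / p) \<le> ennreal (\<epsilon> / 5)"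
    using \<epsilon> p0 by (auto simp: \<eta>_def epowr_ennreal powr_powr)
  note cpm = borel_measurable_cell_prob[OF \<kappa> \<rho>]
  have "\<exists>q. (\<forall>j\<in>range \<rho>. \<forall>l\<in>range \<rho>. (\<lambda>w. q w j l) \<in> borel_measurable (borel \<Otimes>\<^sub>M borel)) \<and>
    (\<forall>w. is_coupling_matrix (range \<rho>) (cell_prob \<kappa> \<rho> (fst w)) (cell_prob \<kappa> \<rho> (snd w)) (q w) \<and>
      (\<forall>r. is_coupling_matrix (range \<rho>) (cell_prob \<kappa> \<rho> (fst w)) (cell_prob \<kappa> \<rho> (snd w)) r \<longrightarrow>
        (\<Sum>j\<in>range \<rho>. \<Sum>l\<in>range \<rho>. norm (j - l) powr p * q w j l) \<le>
        (\<Sum>j\<in>range \<rho>. \<Sum>l\<in>range \<rho>. norm (j - l) powr p * r j l) + \<eta>))"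
    by (rule measurable_coupling_matrix_selection[OF fin])
      (auto simp: cell_prob_sum[OF \<kappa> \<rho> fin] \<eta> intro: measurable_compose[OF measurable_fst cpm] measurable_compose[OF measurable_snd cpm])
  then obtain q where q1: "\<forall>j\<in>range \<rho>. \<forall>l\<in>range \<rho>. (\<lambda>w. q w j l) \<in> borel_measurable (borel \<Otimes>\<^sub>M borel)"
    and q2: "\<forall>w. is_coupling_matrix (range \<rho>) (cell_prob \<kappa> \<rho> (fst w)) (cell_prob \<kappa> \<rho> (snd w)) (q w) \<and>
      (\<forall>r. is_coupling_matrix (range \<rho>) (cell_prob \<kappa> \<rho> (fst w)) (cell_prob \<kappa> \<rho> (snd w)) r \<longrightarrow>
        (\<Sum>j\<in>range \<rho>. \<Sum>l\<in>range \<rho>. norm (j - l) powr p * q w j l) \<le>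
        (\<Sum>j\<in>range \<rho>. \<Sum>l\<in>range \<rho>. norm (j - l) powr p * r j l) + \<eta>)"
    by (elim exE conjE) (rule that)
  have q: "(\<lambda>w. q w j l) \<in> borel_measurable (borel \<Otimes>\<^sub>M borel)" if "j \<in> range \<rho>" "l \<in> range \<rho>" for j l
    using q1 that by blast
  have q': "is_coupling_matrix (range \<rho>) (cell_prob \<kappa> \<rho> s) (cell_prob \<kappa> \<rho> s') (q (s, s'))" for s s'
    using spec[OF q2, of "(s, s')"] by simp
  have q'': "(\<Sum>j\<in>range \<rho>. \<Sum>l\<in>range \<rho>. norm (j - l) powr p * q (s, s') j l) \<le>
        (\<Sum>j\<in>range \<rho>. \<Sum>l\<in>range \<rho>. norm (j - l) powr p * r j l) + \<eta>"
    if "is_coupling_matrix (range \<rho>) (cell_prob \<kappa> \<rho> s) (cell_prob \<kappa> \<rho> s') r" for s s' r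
    using conjunct2[OF spec[OF q2, of "(s, s')"], rule_format, of r] that by simp
  interpret S: coupling_step p \<sigma> \<mu> \<xi> A i \<kappa> K \<rho> q "\<epsilon> / 5" \<eta>
    by unfold_locales (fact kernel K \<rho> fin q q' q'' less_imp_le[OF \<eta>(1)] \<eta>(2) \<rho>\<mu> \<sigma>)+
  have "5 * ennreal (\<epsilon> / 5) = ennreal \<epsilon>"
    using ennreal_mult[of 5 "\<epsilon> / 5"] \<epsilon> by simp
  with S.step_bound[OF adm] show ?thesis
    by (intro exI[of _ "S.next_density D"] exI[of _ S.low] conjI allI S.next_density_admissible[OF adm]
        S.next_density_refines[OF adm] S.low_meas S.low_le_wasserstein) simp
qed

lemma lpn_lift_pair:
  assumes adm: "admissible A D" and [measurable]: "f \<in> borel_measurable (borel \<Otimes>\<^sub>M borel)"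
  shows "lpn p (lift D) (\<lambda>(x, x', z). f (x, x' + \<sigma> *\<^sub>R z)) = lpn p (density (\<mu> \<Otimes>\<^sub>M \<nu>) D) f"
proof -
  have [measurable]: "D \<in> borel_measurable (borel \<Otimes>\<^sub>M borel)" using adm by (simp add: admissible_def)
  have "(\<integral>\<^sup>+w. (case w of (x, x', z) \<Rightarrow> epowr (f (x, x' + \<sigma> *\<^sub>R z)) p) \<partial>lift D) =
    (\<integral>\<^sup>+x. \<integral>\<^sup>+z. \<integral>\<^sup>+x'. epowr (f (x, x' + \<sigma> *\<^sub>R z)) p * D (x, x' + \<sigma> *\<^sub>R z) \<partial>\<mu> \<partial>\<xi> \<partial>\<mu>)"
    by (simp add: lift_def nn_integral_density nn_integral_\<Omega>(1) case_prod_unfold mult.commute)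
  also have "\<dots> = (\<integral>\<^sup>+x. \<integral>\<^sup>+y. epowr (f (x, y)) p * D (x, y) \<partial>\<nu> \<partial>\<mu>)"
    by (intro nn_integral_cong nn_integral_\<nu>[symmetric]) measurable
  also have "\<dots> = (\<integral>\<^sup>+w. epowr (f w) p \<partial>density (\<mu> \<Otimes>\<^sub>M \<nu>) D)"
    by (rule nn_integral_density_\<mu>\<nu>(1)[symmetric]) measurable
  finally show ?thesis by (simp add: lpn_def case_prod_unfold)
qed

lemma lpn_indicator: "epowr (indicator S x) r = indicator S x"
  by (simp split: split_indicator)

text \<open>The norm of an indicator is the p-th root of a measure, so equality of norms for all
  indicators identifies marginal laws.\<close>

lemma lpn_indicator_eqD:
  assumes "lpn p M (\<lambda>w. indicator S (f w)) = lpn p N (indicator T)"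
    and "S \<in> sets L" "f \<in> M \<rightarrow>\<^sub>M L" "T \<in> sets N"
  shows "emeasure (distr M L f) S = emeasure N T"
proof -
  have p0: "0 < p" using p by simp
  have "(\<integral>\<^sup>+w. indicator S (f w) \<partial>M) = (\<integral>\<^sup>+w. indicator T w \<partial>N)"
    using arg_cong[OF assms(1), of "\<lambda>x. epowr x p"] p0
    by (simp add: lpn_def lpn_indicator epowr_inverse)
  moreover have "(\<integral>\<^sup>+w. indicator S (f w) \<partial>M) = emeasure (distr M L f) S"
    using assms(2,3) by (simp flip: nn_integral_indicator add: nn_integral_distr)
  ultimately show ?thesis using assms(4) by simp
qed

lemma lift_coupling:
  assumes adm: "admissible A D"
  shows "distr (lift D) (borel \<Otimes>\<^sub>M borel) (\<lambda>(x, x', z). (x, x')) \<in> couplings \<mu> \<mu>"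
proof -
  have m[measurable]: "(\<lambda>(x, x', z). (x, x')) \<in> lift D \<rightarrow>\<^sub>M borel \<Otimes>\<^sub>M borel" by measurable
  have 1: "distr (lift D) borel (\<lambda>(x, x', z). x) = \<mu>"
  proof (rule measure_eqI)
    fix S assume "S \<in> sets (distr (lift D) borel (\<lambda>(x, x', z). x))"
    then have [measurable]: "S \<in> sets borel" by simp
    show "emeasure (distr (lift D) borel (\<lambda>(x, x', z). x)) S = emeasure \<mu> S"
      using lpn_lift(1)[OF adm, of "indicator S"]
      by (intro lpn_indicator_eqD) (simp_all add: case_prod_unfold)
  qed simp
  have 2: "distr (lift D) borel (\<lambda>(x, x', z). x') = \<mu>"
  proof (rule measure_eqI)
    fix S assume "S \<in> sets (distr (lift D) borel (\<lambda>(x, x', z). x'))"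
    then have [measurable]: "S \<in> sets borel" by simp
    show "emeasure (distr (lift D) borel (\<lambda>(x, x', z). x')) S = emeasure \<mu> S"
      using lpn_lift(2)[OF adm, of "indicator S"]
      by (intro lpn_indicator_eqD) (simp_all add: case_prod_unfold)
  qed simp
  show ?thesis
    using 1 2 by (simp add: couplings_def distr_distr comp_def case_prod_unfold)
qed

lemma density_coupling:
  assumes adm: "admissible A D"
  shows "density (\<mu> \<Otimes>\<^sub>M \<nu>) D \<in> couplings \<mu> \<nu>"
proof -
  have [measurable]: "D \<in> borel_measurable (borel \<Otimes>\<^sub>M borel)" using adm by (simp add: admissible_def)
  have s[measurable_cong]: "sets (density (\<mu> \<Otimes>\<^sub>M \<nu>) D) = sets (borel \<Otimes>\<^sub>M borel)"
    by (simp add: sets_\<mu>\<nu>)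
  have one: "(\<integral>\<^sup>+y. D (x, y) \<partial>\<nu>) = 1" "(\<integral>\<^sup>+x. D (x, y) \<partial>\<mu>) = 1" for x y
    using adm by (auto simp: admissible_def)
  have "distr (density (\<mu> \<Otimes>\<^sub>M \<nu>) D) borel fst = \<mu>"
  proof (rule measure_eqI)
    fix S assume "S \<in> sets (distr (density (\<mu> \<Otimes>\<^sub>M \<nu>) D) borel fst)"
    then have [measurable]: "S \<in> sets borel" by simp
    have "emeasure (distr (density (\<mu> \<Otimes>\<^sub>M \<nu>) D) borel fst) S = (\<integral>\<^sup>+w. indicator S (fst w) \<partial>density (\<mu> \<Otimes>\<^sub>M \<nu>) D)"
      by (simp flip: nn_integral_indicator add: nn_integral_distr)
    also have "\<dots> = (\<integral>\<^sup>+x. \<integral>\<^sup>+y. indicator S x * D (x, y) \<partial>\<nu> \<partial>\<mu>)"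
      by (subst nn_integral_density_\<mu>\<nu>(1)) simp_all
    also have "\<dots> = emeasure \<mu> S"
      by (simp add: nn_integral_cmult one)
    finally show "emeasure (distr (density (\<mu> \<Otimes>\<^sub>M \<nu>) D) borel fst) S = emeasure \<mu> S" .
  qed simp
  moreover have "distr (density (\<mu> \<Otimes>\<^sub>M \<nu>) D) borel snd = \<nu>"
  proof (rule measure_eqI)
    fix S assume "S \<in> sets (distr (density (\<mu> \<Otimes>\<^sub>M \<nu>) D) borel snd)"
    then have [measurable]: "S \<in> sets borel" by simp
    have "emeasure (distr (density (\<mu> \<Otimes>\<^sub>M \<nu>) D) borel snd) S = (\<integral>\<^sup>+w. indicator S (snd w) \<partial>density (\<mu> \<Otimes>\<^sub>M \<nu>) D)"
      by (simp flip: nn_integral_indicator add: nn_integral_distr)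
    also have "\<dots> = (\<integral>\<^sup>+y. \<integral>\<^sup>+x. indicator S y * D (x, y) \<partial>\<mu> \<partial>\<nu>)"
      by (subst nn_integral_density_\<mu>\<nu>(2)) simp_all
    also have "\<dots> = emeasure \<nu> S"
      by (simp add: nn_integral_cmult one)
    finally show "emeasure (distr (density (\<mu> \<Otimes>\<^sub>M \<nu>) D) borel snd) S = emeasure \<nu> S" .
  qed simp
  ultimately show ?thesis using s by (simp add: couplings_def)
qed

end

text \<open>The hypothesis says that \<open>\<psi> (Z w)\<close> is the conditional probability of
  \<open>X w \<in> A\<close> given both \<open>Y\<close> and \<open>Z\<close>. Since it is a
  function of \<open>Z\<close> alone, conditioning further down to \<open>Z\<close> makes the
  product factor.\<close>

lemma cond_indepI:
  fixes X :: "'w \<Rightarrow> 'a::topological_space" and Y :: "'w \<Rightarrow> 'b::topological_space" and Z :: "'w \<Rightarrow> 'c::topological_space"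
  assumes M: "prob_space M" and [measurable]: "X \<in> M \<rightarrow>\<^sub>M borel" "Y \<in> M \<rightarrow>\<^sub>M borel" "Z \<in> M \<rightarrow>\<^sub>M borel"
    and \<psi>: "\<And>A. A \<in> sets borel \<Longrightarrow> \<exists>\<psi>. \<psi> \<in> borel_measurable borel \<and> (\<forall>c. \<psi> c \<le> (1::ennreal)) \<and>
      (\<forall>B\<in>sets borel. \<forall>C\<in>sets borel. (\<integral>\<^sup>+w. indicator A (X w) * indicator B (Y w) * indicator C (Z w) \<partial>M) =
        (\<integral>\<^sup>+w. \<psi> (Z w) * indicator B (Y w) * indicator C (Z w) \<partial>M))"
  shows "cond_indep M X Y Z"
  unfolding cond_indep_def
proof (intro ballI)
  interpret prob_space M by fact
  define F where "F = vimage_algebra (space M) Z borel"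
  have sub: "subalgebra M F"
    unfolding subalgebra_def F_def using measurable_sets[OF \<open>Z \<in> M \<rightarrow>\<^sub>M borel\<close>]
    by (auto simp: sets_vimage_algebra2 measurable_space[OF \<open>Z \<in> M \<rightarrow>\<^sub>M borel\<close>])
  interpret F: finite_measure_subalgebra M F by unfold_locales (rule sub)
  interpret F: sigma_finite_subalgebra M F by (rule finite_measure_subalgebra_is_sigma_finite) unfold_locales
  have ZF[measurable]: "Z \<in> F \<rightarrow>\<^sub>M borel"
    unfolding F_def by (rule measurable_vimage_algebra1) simp
  fix A :: "'a set" and B :: "'b set"
  assume A[measurable]: "A \<in> sets borel" and B[measurable]: "B \<in> sets borel"
  obtain \<psi> where \<psi>m[measurable]: "\<psi> \<in> borel_measurable borel" and \<psi>1: "\<And>c. \<psi> c \<le> (1::ennreal)"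
    and eq: "\<And>B C. B \<in> sets borel \<Longrightarrow> C \<in> sets borel \<Longrightarrow> (\<integral>\<^sup>+w. indicator A (X w) * indicator B (Y w) * indicator C (Z w) \<partial>M) =
        (\<integral>\<^sup>+w. \<psi> (Z w) * indicator B (Y w) * indicator C (Z w) \<partial>M)"
    using \<psi>[OF A] by blast
  define r where "r c = enn2real (\<psi> c)" for c
  have rm[measurable]: "r \<in> borel_measurable borel" unfolding r_def by measurable
  have \<psi>r: "\<psi> c = ennreal (r c)" for c
    unfolding r_def using \<psi>1[of c] by (simp add: ennreal_enn2real_if) (metis ennreal_one_less_top leD)
  have r01: "0 \<le> r c" "r c \<le> 1" for c
    using \<psi>1[of c] unfolding \<psi>r by (auto simp: r_def)
  have int: "(\<integral>w\<in>E. indicat_real A (X w) * indicat_real B (Y w) \<partial>M) = (\<integral>w\<in>E. r (Z w) * indicator B (Y w) \<partial>M)"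
    if B[measurable]: "B \<in> sets borel" and E: "E \<in> sets F" for B E
  proof -
    obtain C where C[measurable]: "C \<in> sets borel" and EC: "E = Z -` C \<inter> space M"
      using E by (auto simp: F_def sets_vimage_algebra2)
    have "(\<integral>w\<in>E. indicat_real A (X w) * indicat_real B (Y w) \<partial>M) = (\<integral>w. indicator A (X w) * indicator B (Y w) * indicator C (Z w) \<partial>M)"
      unfolding set_lebesgue_integral_def EC
      by (intro Bochner_Integration.integral_cong) (auto split: split_indicator)
    also have "\<dots> = enn2real (\<integral>\<^sup>+w. indicator A (X w) * indicator B (Y w) * indicator C (Z w) \<partial>M)"
      by (subst integral_eq_nn_integral) (auto simp: ennreal_mult ennreal_indicator)
    also have "\<dots> = enn2real (\<integral>\<^sup>+w. \<psi> (Z w) * indicator B (Y w) * indicator C (Z w) \<partial>M)"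
      by (simp add: eq)
    also have "\<dots> = (\<integral>w. r (Z w) * indicator B (Y w) * indicator C (Z w) \<partial>M)"
      by (subst integral_eq_nn_integral) (auto simp: ennreal_mult ennreal_indicator \<psi>r r01)
    also have "\<dots> = (\<integral>w\<in>E. r (Z w) * indicator B (Y w) \<partial>M)"
      unfolding set_lebesgue_integral_def EC
      by (intro Bochner_Integration.integral_cong) (auto split: split_indicator)
    finally show ?thesis .
  qed
  have i1: "integrable M (\<lambda>w. indicator A (X w) * indicator B (Y w) :: real)" if [measurable]: "B \<in> sets borel" for B
    by (rule integrable_const_bound[where B=1]) (auto split: split_indicator)
  have i2: "integrable M (\<lambda>w. r (Z w) * indicator B (Y w) :: real)" if [measurable]: "B \<in> sets borel" for B
    by (rule integrable_const_bound[where B=1]) (auto split: split_indicator simp: r01)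
  \<comment> \<open>The case where the event for \<open>Y\<close> is \<open>UNIV\<close>.\<close>
  have "AE w in M. real_cond_exp M F (\<lambda>v. indicator A (X v)) w = r (Z w)"
  proof (rule F.real_cond_exp_charact)
    show "(\<integral>w\<in>E. indicat_real A (X w) \<partial>M) = (\<integral>w\<in>E. r (Z w) \<partial>M)" if "E \<in> sets F" for E
      using int[of UNIV E] that by simp
    show "integrable M (\<lambda>v. indicator A (X v) :: real)" "integrable M (\<lambda>w. r (Z w))"
      using i1[of UNIV] i2[of UNIV] by simp_all
  qed measurable
  moreover have "AE w in M. real_cond_exp M F (\<lambda>v. indicator A (X v) * indicator B (Y v)) w =
      real_cond_exp M F (\<lambda>v. r (Z v) * indicator B (Y v)) w"
  proof (rule F.real_cond_exp_charact)
    show "(\<integral>w\<in>E. indicat_real A (X w) * indicat_real B (Y w) \<partial>M) = (\<integral>w\<in>E. real_cond_exp M F (\<lambda>v. r (Z v) * indicator B (Y v)) w \<partial>M)"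
      if "E \<in> sets F" for E
      unfolding int[OF B that] by (rule F.real_cond_exp_intA[OF i2[OF B] that])
    show "integrable M (real_cond_exp M F (\<lambda>v. r (Z v) * indicator B (Y v)))"
      by (rule F.real_cond_exp_int(1)[OF i2[OF B]])
  qed (simp_all add: i1)
  moreover have "AE w in M. real_cond_exp M F (\<lambda>v. r (Z v) * indicator B (Y v)) w = r (Z w) * real_cond_exp M F (\<lambda>v. indicator B (Y v)) w"
    by (rule F.real_cond_exp_mult) (simp_all add: i2)
  ultimately show "AE w in M. real_cond_exp M (vimage_algebra (space M) Z borel) (\<lambda>v. indicator A (X v) * indicator B (Y v)) w =
      real_cond_exp M (vimage_algebra (space M) Z borel) (\<lambda>v. indicator A (X v)) w *
      real_cond_exp M (vimage_algebra (space M) Z borel) (\<lambda>v. indicator B (Y v)) w"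
    unfolding F_def[symmetric] by eventually_elim simp
qed

section \<open>Conditional laws and the modulus of continuity\<close>

lemma init_seg_eq_seg: "init_seg t = seg {..time_pt t}"
  by (auto simp: fun_eq_iff init_seg_def seg_def)

lemma final_seg_eq_seg: "final_seg t = seg {time_pt t<..}"
  by (auto simp: fun_eq_iff final_seg_def seg_def)

lemma is_cond_law_cond_law:
  fixes \<mu> :: "('d::finite, 'n::{finite,linorder}) path measure"
  assumes "prob_space \<mu>" and s[measurable_cong]: "sets \<mu> = sets borel"
  shows "is_cond_law \<mu> t (cond_law \<mu> t)"
proof -
  have sp: "space \<mu> = UNIV" using sets_eq_imp_space_eq[OF s] by simp
  have S: "init_seg t \<in> \<mu> \<rightarrow>\<^sub>M borel" unfolding init_seg_eq_seg by measurable
  have X: "(\<lambda>x. x $ time_pt (t + 1)) \<in> borel_measurable \<mu>" by measurable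
  obtain k where "k \<in> borel \<rightarrow>\<^sub>M prob_algebra borel" "\<forall>A\<in>sets borel. \<forall>B\<in>sets borel.
     emeasure \<mu> {w\<in>space \<mu>. init_seg t w \<in> A \<and> w $ time_pt (t + 1) \<in> B} =
     (\<integral>\<^sup>+w. indicator A (init_seg t w) * emeasure (k (init_seg t w)) B \<partial>\<mu>)"
    using disintegration[OF assms(1) S X] by (elim bexE) (rule that)
  then have "is_cond_law \<mu> t k" unfolding is_cond_law_def sp by simp
  then show ?thesis unfolding cond_law_def by (rule someI[where P = "is_cond_law \<mu> t"])
qed

lemma is_kernel_cond_law:
  fixes \<mu> :: "('d::finite, 'n::{finite,linorder}) path measure"
  assumes "prob_space \<mu>" and s[measurable_cong]: "sets \<mu> = sets borel"
  shows "is_kernel \<mu> {..time_pt t} (time_pt (t + 1)) (cond_law \<mu> t)"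
  unfolding is_kernel_def
proof (intro conjI ballI)
  have sp: "space \<mu> = UNIV" using sets_eq_imp_space_eq[OF s] by simp
  note c = is_cond_law_cond_law[OF assms, of t]
  show k: "cond_law \<mu> t \<in> borel \<rightarrow>\<^sub>M prob_algebra borel" using c by (simp add: is_cond_law_def)
  fix f :: "('d, 'n) path \<times> (real ^ 'd) \<Rightarrow> ennreal" assume f: "f \<in> borel_measurable (borel \<Otimes>\<^sub>M borel)"
  show "(\<integral>\<^sup>+x. f (seg {..time_pt t} x, x $ time_pt (t + 1)) \<partial>\<mu>) =
    (\<integral>\<^sup>+x. \<integral>\<^sup>+a. f (seg {..time_pt t} x, a) \<partial>cond_law \<mu> t (seg {..time_pt t} x) \<partial>\<mu>)"
  proof (rule disintegration_nn_integral[OF assms(1) _ _ k _ f])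
    fix A B assume "A \<in> sets (borel :: ('d, 'n) path measure)" "B \<in> sets (borel :: (real ^ 'd) measure)"
    then show "emeasure \<mu> {w\<in>space \<mu>. seg {..time_pt t} w \<in> A \<and> w $ time_pt (t + 1) \<in> B} =
      (\<integral>\<^sup>+w. indicator A (seg {..time_pt t} w) * emeasure (cond_law \<mu> t (seg {..time_pt t} w)) B \<partial>\<mu>)"
      using c by (simp add: is_cond_law_def init_seg_eq_seg sp)
  qed measurable
qed

text \<open>The law of the first coordinate given an empty past. It starts the construction at time
  1, where \<open>cond_law\<close> does not apply.\<close>

lemma is_kernel_empty:
  fixes \<mu> :: "('d::finite, 'n::finite) path measure"
  assumes "prob_space \<mu>" and s[measurable_cong]: "sets \<mu> = sets borel"
  shows "is_kernel \<mu> {} i (\<lambda>_. distr \<mu> borel (\<lambda>x. x $ i))"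
  unfolding is_kernel_def
proof (intro conjI ballI)
  interpret prob_space \<mu> by fact
  have "prob_space (distr \<mu> borel (\<lambda>x. x $ i))" by (rule prob_space_distr) measurable
  then show "(\<lambda>_. distr \<mu> borel (\<lambda>x. x $ i)) \<in> borel \<rightarrow>\<^sub>M prob_algebra borel"
    by (intro measurable_const) (simp add: space_prob_algebra)
  fix f :: "('d, 'n) path \<times> (real ^ 'd) \<Rightarrow> ennreal" assume [measurable]: "f \<in> borel_measurable (borel \<Otimes>\<^sub>M borel)"
  have "(\<integral>\<^sup>+a. f (0, a) \<partial>distr \<mu> borel (\<lambda>x. x $ i)) = (\<integral>\<^sup>+x. f (0, x $ i) \<partial>\<mu>)"
    by (rule nn_integral_distr) measurable
  then show "(\<integral>\<^sup>+x. f (seg {} x, x $ i) \<partial>\<mu>) = (\<integral>\<^sup>+x. \<integral>\<^sup>+a. f (seg {} x, a) \<partial>distr \<mu> borel (\<lambda>x. x $ i) \<partial>\<mu>)"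
    by (simp add: seg_empty emeasure_space_1)
qed

lemma wasserstein_self:
  assumes s: "sets \<alpha> = sets (borel :: 'a::euclidean_space measure)"
  shows "wasserstein p \<alpha> \<alpha> = 0"
proof -
  note [measurable_cong] = s
  let ?\<pi> = "distr \<alpha> (borel \<Otimes>\<^sub>M borel) (\<lambda>a. (a, a))"
  have id: "distr \<alpha> borel (\<lambda>x. x) = \<alpha>" using distr_id2[OF s[symmetric]] by simp
  have "?\<pi> \<in> couplings \<alpha> \<alpha>"
    by (simp add: couplings_def distr_distr comp_def id)
  moreover have "(\<integral>\<^sup>+(x, y). ennreal (norm (x - y) powr p) \<partial>?\<pi>) = 0"
    by (subst nn_integral_distr) (auto simp: case_prod_unfold)
  ultimately have "(INF \<pi>\<in>couplings \<alpha> \<alpha>. \<integral>\<^sup>+(x, y). ennreal (norm (x - y) powr p) \<partial>\<pi>) = 0"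
    by (intro antisym INF_lower2[of ?\<pi>]) auto
  then show ?thesis by (simp add: wasserstein_def)
qed

text \<open>Toss a coin with success probability \<open>l\<close>: keep the pair on success,
  otherwise duplicate its first coordinate. Both marginals stay \<open>\<mu>\<close>.\<close>

lemma mixture_with_diagonal:
  fixes \<mu> :: "'a::euclidean_space measure"
  assumes \<mu>: "prob_space \<mu>" and \<pi>: "\<pi> \<in> couplings \<mu> \<mu>" and l: "0 \<le> l" "l \<le> 1"
  shows "\<exists>\<pi>'\<in>couplings \<mu> \<mu>. \<forall>f\<in>borel_measurable (borel \<Otimes>\<^sub>M borel).
    (\<integral>\<^sup>+w. f w \<partial>\<pi>') = ennreal l * (\<integral>\<^sup>+w. f w \<partial>\<pi>) + ennreal (1 - l) * (\<integral>\<^sup>+x. f (x, x) \<partial>\<mu>)"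
proof -
  have s[measurable_cong]: "sets \<pi> = sets (borel \<Otimes>\<^sub>M borel)" and d1: "distr \<pi> borel fst = \<mu>" and d2: "distr \<pi> borel snd = \<mu>"
    using \<pi> by (auto simp: couplings_def)
  interpret \<pi>: prob_space \<pi> by (rule coupling_prob_space[OF \<mu> \<pi>])
  have s\<mu>: "sets \<mu> = sets borel" unfolding d1[symmetric] by simp
  let ?B = "measure_pmf (bernoulli_pmf l)"
  let ?T = "\<lambda>w. if fst w then snd w else (fst (snd w), fst (snd w))"
  define \<pi>' where "\<pi>' = distr (?B \<Otimes>\<^sub>M \<pi>) (borel \<Otimes>\<^sub>M borel) ?T"
  have [measurable]: "?T \<in> ?B \<Otimes>\<^sub>M \<pi> \<rightarrow>\<^sub>M borel \<Otimes>\<^sub>M borel" by measurable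
  have int: "(\<integral>\<^sup>+w. f w \<partial>\<pi>') = ennreal l * (\<integral>\<^sup>+w. f w \<partial>\<pi>) + ennreal (1 - l) * (\<integral>\<^sup>+x. f (x, x) \<partial>\<mu>)"
    if f[measurable]: "f \<in> borel_measurable (borel \<Otimes>\<^sub>M borel)" for f
  proof -
    have "(\<integral>\<^sup>+w. f w \<partial>\<pi>') = (\<integral>\<^sup>+w. f (?T w) \<partial>(?B \<Otimes>\<^sub>M \<pi>))"
      unfolding \<pi>'_def by (rule nn_integral_distr) measurable
    also have "\<dots> = (\<integral>\<^sup>+b. \<integral>\<^sup>+w. f (?T (b, w)) \<partial>\<pi> \<partial>?B)"
      by (rule \<pi>.nn_integral_fst[symmetric]) measurable
    also have "\<dots> = ennreal l * (\<integral>\<^sup>+w. f w \<partial>\<pi>) + ennreal (1 - l) * (\<integral>\<^sup>+w. f (fst w, fst w) \<partial>\<pi>)"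
      using l by (simp add: mult.commute)
    also have "(\<integral>\<^sup>+w. f (fst w, fst w) \<partial>\<pi>) = (\<integral>\<^sup>+x. f (x, x) \<partial>\<mu>)"
      unfolding d1[symmetric] by (rule nn_integral_distr[symmetric]) measurable
    finally show ?thesis .
  qed
  have e: "ennreal l * x + ennreal (1 - l) * x = x" for x
  proof -
    have "ennreal l + ennreal (1 - l) = 1" using l by (simp flip: ennreal_plus)
    then show ?thesis by (simp flip: distrib_right)
  qed
  have s': "sets \<pi>' = sets (borel \<Otimes>\<^sub>M borel)" by (simp add: \<pi>'_def)
  have "distr \<pi>' borel fst = \<mu>"
  proof (rule measure_eqI)
    fix S assume "S \<in> sets (distr \<pi>' borel fst)"
    then have S[measurable]: "S \<in> sets borel" by simp
    note [measurable_cong] = s'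
    have "emeasure (distr \<pi>' borel fst) S = (\<integral>\<^sup>+w. indicator S (fst w) \<partial>\<pi>')"
      by (simp flip: nn_integral_indicator add: nn_integral_distr)
    also have "\<dots> = ennreal l * emeasure (distr \<pi> borel fst) S + ennreal (1 - l) * emeasure \<mu> S"
      using s\<mu> by (subst int) (simp_all flip: nn_integral_indicator add: nn_integral_distr)
    finally show "emeasure (distr \<pi>' borel fst) S = emeasure \<mu> S" by (simp add: d1 e)
  qed (simp add: s\<mu>)
  moreover have "distr \<pi>' borel snd = \<mu>"
  proof (rule measure_eqI)
    fix S assume "S \<in> sets (distr \<pi>' borel snd)"
    then have S[measurable]: "S \<in> sets borel" by simp
    note [measurable_cong] = s'
    have "emeasure (distr \<pi>' borel snd) S = (\<integral>\<^sup>+w. indicator S (snd w) \<partial>\<pi>')"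
      by (simp flip: nn_integral_indicator add: nn_integral_distr)
    also have "\<dots> = ennreal l * emeasure (distr \<pi> borel snd) S + ennreal (1 - l) * emeasure \<mu> S"
      using s\<mu> by (subst int) (simp_all flip: nn_integral_indicator add: nn_integral_distr)
    finally show "emeasure (distr \<pi>' borel snd) S = emeasure \<mu> S" by (simp add: d2 e)
  qed (simp add: s\<mu>)
  ultimately have "\<pi>' \<in> couplings \<mu> \<mu>" using s' by (simp add: couplings_def)
  with int show ?thesis by blast
qed

text \<open>Amounts to \<open>modulus p \<mu> t (c * \<delta>) \<le> c * modulus p \<mu> t \<delta>\<close>, by mixing with the diagonal coupling. The
  distance of the conditional laws need not be measurable, so it is replaced by a measurable minorant.\<close>

lemma modulus_scaling:
  fixes \<mu> :: "('d::finite, 'n::{finite,linorder}) path measure"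
  assumes p: "1 \<le> p" and \<mu>: "prob_space \<mu>" and \<pi>: "\<pi> \<in> couplings \<mu> \<mu>" and c: "1 \<le> c"
    and W[measurable]: "W \<in> borel_measurable (borel \<Otimes>\<^sub>M borel)"
    and le: "\<And>x y. W (x, y) \<le> wasserstein p (cond_law \<mu> t (init_seg t x)) (cond_law \<mu> t (init_seg t y))"
    and dist: "lpn p \<pi> (\<lambda>(x, y). ennreal (norm (init_seg t x - init_seg t y))) < ennreal c * \<delta>"
  shows "lpn p \<pi> W \<le> ennreal c * modulus p \<mu> t \<delta>"
proof -
  have p0: "0 < p" and c0: "0 < c" using p c by auto
  \<comment> \<open>The diagonal has distance 0, so the mixture multiplies the distance of initial
    segments by \<open>l powr (1 / p) = 1 / c\<close>.\<close>
  define l where "l = c powr (- p)"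
  have l: "0 \<le> l" "l \<le> 1" using c p0 powr_mono[of "- p" 0 c] by (auto simp: l_def)
  have "l powr (1 / p) = 1 / c"
    unfolding l_def using c0 p0 by (subst powr_powr) (simp add: powr_minus_divide)
  then have lc: "epowr (ennreal l) (1 / p) = ennreal (1 / c)"
    using l by (simp add: epowr_ennreal)
  have cc: "ennreal c * (ennreal (1 / c) * x) = x" for x
    using c0 by (simp add: mult.assoc[symmetric] flip: ennreal_mult)
  obtain \<pi>' where \<pi>': "\<pi>' \<in> couplings \<mu> \<mu>" and int: "\<And>f. f \<in> borel_measurable (borel \<Otimes>\<^sub>M borel) \<Longrightarrow>
    (\<integral>\<^sup>+w. f w \<partial>\<pi>') = ennreal l * (\<integral>\<^sup>+w. f w \<partial>\<pi>) + ennreal (1 - l) * (\<integral>\<^sup>+x. f (x, x) \<partial>\<mu>)"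
    using mixture_with_diagonal[OF \<mu> \<pi> l] by blast
  have [measurable]: "init_seg t \<in> borel_measurable (borel :: ('d, 'n) path measure)"
    unfolding init_seg_eq_seg by measurable
  let ?n = "\<lambda>(x, y). ennreal (norm (init_seg t x - init_seg t y))"
  have "lpn p \<pi>' ?n = epowr (ennreal l * (\<integral>\<^sup>+w. epowr (?n w) p \<partial>\<pi>)) (1 / p)"
    unfolding lpn_def by (subst int) simp_all
  also have "\<dots> = ennreal (1 / c) * lpn p \<pi> ?n" by (simp add: epowr_mult lc lpn_def)
  finally have n: "lpn p \<pi>' ?n = ennreal (1 / c) * lpn p \<pi> ?n" .
  have "lpn p \<pi>' ?n < \<delta>"
  proof (rule ccontr)
    assume "\<not> lpn p \<pi>' ?n < \<delta>"
    then have "ennreal c * \<delta> \<le> ennreal c * (ennreal (1 / c) * lpn p \<pi> ?n)"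
      unfolding n by (intro mult_left_mono) auto
    then show False using dist unfolding cc by simp
  qed
  then have mem: "\<pi>' \<in> {\<pi> \<in> couplings \<mu> \<mu>.
         epowr (\<integral>\<^sup>+(x, y). ennreal (norm (init_seg t x - init_seg t y) powr p) \<partial>\<pi>) (1 / p) < \<delta>}"
    using \<pi>' by (simp add: lpn_def epowr_norm case_prod_unfold)
  have "ennreal (1 / c) * lpn p \<pi> W = epowr (ennreal l * (\<integral>\<^sup>+w. epowr (W w) p \<partial>\<pi>)) (1 / p)"
    by (simp add: epowr_mult lc lpn_def)
  \<comment> \<open>The diagonal part of the mixture is nonnegative and is dropped.\<close>
  also have "\<dots> \<le> epowr (\<integral>\<^sup>+w. epowr (W w) p \<partial>\<pi>') (1 / p)"
    using p0 by (intro epowr_mono) (simp_all add: int)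
  also have "\<dots> \<le> epowr (\<integral>\<^sup>+(x, y). epowr (wasserstein p (cond_law \<mu> t (init_seg t x))
                                        (cond_law \<mu> t (init_seg t y))) p \<partial>\<pi>') (1 / p)"
    using p0 le by (intro epowr_mono nn_integral_mono) (auto simp: case_prod_unfold intro!: epowr_mono)
  also have "\<dots> \<le> modulus p \<mu> t \<delta>"
    unfolding modulus_def by (rule SUP_upper[OF mem])
  finally have "ennreal c * (ennreal (1 / c) * lpn p \<pi> W) \<le> ennreal c * modulus p \<mu> t \<delta>"
    by (intro mult_left_mono) auto
  then show ?thesis unfolding cc .
qed

section \<open>The bicausal coupling\<close>

context smoothing
begin

text \<open>For a fixed full path of one process, \<open>D\<close> and \<open>E\<close> give the
  same law to the other process up to time \<open>t\<close>. As \<open>E\<close> depends only on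
  initial segments, this law does not see the future of the fixed path.\<close>

lemma bicausal_density:
  assumes adm: "admissible UNIV D"
    and ref: "\<And>t. 1 \<le> t \<Longrightarrow> t < CARD('n) \<Longrightarrow> \<exists>E. admissible {..time_pt t} E \<and> refines {..time_pt t} E D"
  shows "density (\<mu> \<Otimes>\<^sub>M \<nu>) D \<in> bicausal_couplings \<mu> \<nu>"
  unfolding bicausal_couplings_def
proof (intro CollectI conjI allI impI)
  show c: "density (\<mu> \<Otimes>\<^sub>M \<nu>) D \<in> couplings \<mu> \<nu>" by (rule density_coupling[OF adm])
  have D[measurable]: "D \<in> borel_measurable (borel \<Otimes>\<^sub>M borel)" using adm by (simp add: admissible_def)
  note pr = coupling_prob_space[OF prob_\<mu> c]
  fix t assume t: "1 \<le> t \<and> t < CARD('n)"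
  define A :: "'n set" where "A = {..time_pt t}"
  define A' :: "'n set" where "A' = {time_pt t<..}"
  obtain E where E: "admissible A E" "refines A E D" using ref t unfolding A_def by blast
  have Em[measurable]: "E \<in> borel_measurable (borel \<Otimes>\<^sub>M borel)" using E by (simp add: admissible_def)
  have E\<nu>: "(\<integral>\<^sup>+y. E (x, y) \<partial>\<nu>) = 1" and E\<mu>: "(\<integral>\<^sup>+x. E (x, y) \<partial>\<mu>) = 1"
    and Eseg: "E (seg A x, seg A y) = E (x, y)" for x y using E by (auto simp: admissible_def)
  have Ex: "E (seg A x, y) = E (x, y)" and Ey: "E (x, seg A y) = E (x, y)" for x y
    using Eseg[of x y] Eseg[of "seg A x" y] Eseg[of x "seg A y"] by simp_all
  have D\<nu>: "(\<integral>\<^sup>+y. f (seg A y) * D (x, y) \<partial>\<nu>) = (\<integral>\<^sup>+y. f (seg A y) * E (x, y) \<partial>\<nu>)"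
    and D\<mu>: "(\<integral>\<^sup>+x. f (seg A x) * D (x, y) \<partial>\<mu>) = (\<integral>\<^sup>+x. f (seg A x) * E (x, y) \<partial>\<mu>)"
    if "f \<in> borel_measurable borel" for f x y
    using E(2) that by (auto simp: refines_def)
  have D1: "(\<integral>\<^sup>+y. D (x, y) \<partial>\<nu>) = 1" "(\<integral>\<^sup>+x. D (x, y) \<partial>\<mu>) = 1" for x y
    using adm by (auto simp: admissible_def)
  show "cond_indep (density (\<mu> \<Otimes>\<^sub>M \<nu>) D) (\<lambda>(x, y). init_seg t y) (\<lambda>(x, y). final_seg t x) (\<lambda>(x, y). init_seg t x)"
    unfolding init_seg_eq_seg final_seg_eq_seg A_def[symmetric] A'_def[symmetric]
  proof (rule cond_indepI[OF pr])
    fix S :: "('d, 'n) path set" assume [measurable]: "S \<in> sets borel"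
    \<comment> \<open>The conditional probability of \<open>seg A y \<in> S\<close> given the whole
      path \<open>x\<close>; by the invariance of \<open>E\<close> it is a function of
      \<open>seg A x\<close>.\<close>
    define \<psi> where "\<psi> x = (\<integral>\<^sup>+y. indicator S (seg A y) * E (x, y) \<partial>\<nu>)" for x
    have \<psi>m[measurable]: "\<psi> \<in> borel_measurable borel"
      unfolding \<psi>_def by measurable
    have \<psi>A: "\<psi> (seg A x) = \<psi> x" for x by (simp add: \<psi>_def Ex)
    have "\<psi> x \<le> (\<integral>\<^sup>+y. E (x, y) \<partial>\<nu>)" for x
      unfolding \<psi>_def by (intro nn_integral_mono) (auto split: split_indicator)
    then have \<psi>1: "\<psi> x \<le> 1" for x by (simp add: E\<nu>)
    show "\<exists>\<psi>. \<psi> \<in> borel_measurable borel \<and> (\<forall>c. \<psi> c \<le> 1) \<and> (\<forall>B\<in>sets borel. \<forall>C\<in>sets borel.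
      (\<integral>\<^sup>+w. indicator S (case w of (x, y) \<Rightarrow> seg A y) * indicator B (case w of (x, y) \<Rightarrow> seg A' x) *
         indicator C (case w of (x, y) \<Rightarrow> seg A x) \<partial>density (\<mu> \<Otimes>\<^sub>M \<nu>) D) =
      (\<integral>\<^sup>+w. \<psi> (case w of (x, y) \<Rightarrow> seg A x) * indicator B (case w of (x, y) \<Rightarrow> seg A' x) *
         indicator C (case w of (x, y) \<Rightarrow> seg A x) \<partial>density (\<mu> \<Otimes>\<^sub>M \<nu>) D))"
    proof (intro exI[of _ \<psi>] conjI allI ballI \<psi>m \<psi>1)
      fix B C :: "('d, 'n) path set" assume [measurable]: "B \<in> sets borel" "C \<in> sets borel"
      define b where "b x = indicator B (seg A' x) * (indicator C (seg A x) :: ennreal)" for x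
      have [measurable]: "b \<in> borel_measurable borel" unfolding b_def by measurable
      have "(\<integral>\<^sup>+w. indicator S (case w of (x, y) \<Rightarrow> seg A y) * indicator B (case w of (x, y) \<Rightarrow> seg A' x) *
         indicator C (case w of (x, y) \<Rightarrow> seg A x) \<partial>density (\<mu> \<Otimes>\<^sub>M \<nu>) D) =
         (\<integral>\<^sup>+w. indicator S (seg A (snd w)) * b (fst w) \<partial>density (\<mu> \<Otimes>\<^sub>M \<nu>) D)"
        by (simp add: case_prod_unfold b_def mult.assoc)
      also have "\<dots> = (\<integral>\<^sup>+x. \<integral>\<^sup>+y. b x * (indicator S (seg A y) * D (x, y)) \<partial>\<nu> \<partial>\<mu>)"
        by (subst nn_integral_density_\<mu>\<nu>(1)) (simp_all add: mult_ac)
      also have "\<dots> = (\<integral>\<^sup>+x. b x * \<psi> x \<partial>\<mu>)"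
        by (simp add: nn_integral_cmult D\<nu>[of "indicator S"] \<psi>_def)
      also have "\<dots> = (\<integral>\<^sup>+x. \<integral>\<^sup>+y. b x * \<psi> x * D (x, y) \<partial>\<nu> \<partial>\<mu>)"
        by (simp add: nn_integral_cmult D1)
      also have "\<dots> = (\<integral>\<^sup>+w. b (fst w) * \<psi> (fst w) \<partial>density (\<mu> \<Otimes>\<^sub>M \<nu>) D)"
        by (subst nn_integral_density_\<mu>\<nu>(1)) simp_all
      also have "\<dots> = (\<integral>\<^sup>+w. \<psi> (case w of (x, y) \<Rightarrow> seg A x) * indicator B (case w of (x, y) \<Rightarrow> seg A' x) *
         indicator C (case w of (x, y) \<Rightarrow> seg A x) \<partial>density (\<mu> \<Otimes>\<^sub>M \<nu>) D)"
        by (simp add: case_prod_unfold b_def \<psi>A mult_ac)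
      finally show "(\<integral>\<^sup>+w. indicator S (case w of (x, y) \<Rightarrow> seg A y) * indicator B (case w of (x, y) \<Rightarrow> seg A' x) *
         indicator C (case w of (x, y) \<Rightarrow> seg A x) \<partial>density (\<mu> \<Otimes>\<^sub>M \<nu>) D) = \<dots>" .
    qed
  qed measurable
  show "cond_indep (density (\<mu> \<Otimes>\<^sub>M \<nu>) D) (\<lambda>(x, y). init_seg t x) (\<lambda>(x, y). final_seg t y) (\<lambda>(x, y). init_seg t y)"
    unfolding init_seg_eq_seg final_seg_eq_seg A_def[symmetric] A'_def[symmetric]
  proof (rule cond_indepI[OF pr])
    fix S :: "('d, 'n) path set" assume [measurable]: "S \<in> sets borel"
    define \<psi> where "\<psi> y = (\<integral>\<^sup>+x. indicator S (seg A x) * E (x, y) \<partial>\<mu>)" for y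
    have \<psi>m[measurable]: "\<psi> \<in> borel_measurable borel"
      unfolding \<psi>_def by measurable
    have \<psi>A: "\<psi> (seg A x) = \<psi> x" for x by (simp add: \<psi>_def Ey)
    have "\<psi> y \<le> (\<integral>\<^sup>+x. E (x, y) \<partial>\<mu>)" for y
      unfolding \<psi>_def by (intro nn_integral_mono) (auto split: split_indicator)
    then have \<psi>1: "\<psi> x \<le> 1" for x by (simp add: E\<mu>)
    show "\<exists>\<psi>. \<psi> \<in> borel_measurable borel \<and> (\<forall>c. \<psi> c \<le> 1) \<and> (\<forall>B\<in>sets borel. \<forall>C\<in>sets borel.
      (\<integral>\<^sup>+w. indicator S (case w of (x, y) \<Rightarrow> seg A x) * indicator B (case w of (x, y) \<Rightarrow> seg A' y) *
         indicator C (case w of (x, y) \<Rightarrow> seg A y) \<partial>density (\<mu> \<Otimes>\<^sub>M \<nu>) D) =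
      (\<integral>\<^sup>+w. \<psi> (case w of (x, y) \<Rightarrow> seg A y) * indicator B (case w of (x, y) \<Rightarrow> seg A' y) *
         indicator C (case w of (x, y) \<Rightarrow> seg A y) \<partial>density (\<mu> \<Otimes>\<^sub>M \<nu>) D))"
    proof (intro exI[of _ \<psi>] conjI allI ballI \<psi>m \<psi>1)
      fix B C :: "('d, 'n) path set" assume [measurable]: "B \<in> sets borel" "C \<in> sets borel"
      define b where "b x = indicator B (seg A' x) * (indicator C (seg A x) :: ennreal)" for x
      have [measurable]: "b \<in> borel_measurable borel" unfolding b_def by measurable
      have "(\<integral>\<^sup>+w. indicator S (case w of (x, y) \<Rightarrow> seg A x) * indicator B (case w of (x, y) \<Rightarrow> seg A' y) *
         indicator C (case w of (x, y) \<Rightarrow> seg A y) \<partial>density (\<mu> \<Otimes>\<^sub>M \<nu>) D) =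
         (\<integral>\<^sup>+w. indicator S (seg A (fst w)) * b (snd w) \<partial>density (\<mu> \<Otimes>\<^sub>M \<nu>) D)"
        by (simp add: case_prod_unfold b_def mult.assoc)
      also have "\<dots> = (\<integral>\<^sup>+y. \<integral>\<^sup>+x. b y * (indicator S (seg A x) * D (x, y)) \<partial>\<mu> \<partial>\<nu>)"
        by (subst nn_integral_density_\<mu>\<nu>(2)) (simp_all add: mult_ac)
      also have "\<dots> = (\<integral>\<^sup>+y. b y * \<psi> y \<partial>\<nu>)"
        by (simp add: nn_integral_cmult D\<mu>[of "indicator S"] \<psi>_def)
      also have "\<dots> = (\<integral>\<^sup>+y. \<integral>\<^sup>+x. b y * \<psi> y * D (x, y) \<partial>\<mu> \<partial>\<nu>)"
        by (simp add: nn_integral_cmult D1)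
      also have "\<dots> = (\<integral>\<^sup>+w. b (snd w) * \<psi> (snd w) \<partial>density (\<mu> \<Otimes>\<^sub>M \<nu>) D)"
        by (subst nn_integral_density_\<mu>\<nu>(2)) simp_all
      also have "\<dots> = (\<integral>\<^sup>+w. \<psi> (case w of (x, y) \<Rightarrow> seg A y) * indicator B (case w of (x, y) \<Rightarrow> seg A' y) *
         indicator C (case w of (x, y) \<Rightarrow> seg A y) \<partial>density (\<mu> \<Otimes>\<^sub>M \<nu>) D)"
        by (simp add: case_prod_unfold b_def \<psi>A mult_ac)
      finally show "(\<integral>\<^sup>+w. indicator S (case w of (x, y) \<Rightarrow> seg A x) * indicator B (case w of (x, y) \<Rightarrow> seg A' y) *
         indicator C (case w of (x, y) \<Rightarrow> seg A y) \<partial>density (\<mu> \<Otimes>\<^sub>M \<nu>) D) = \<dots>" .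
    qed
  qed measurable
qed

end

text \<open>Agrees with \<open>{..time_pt n}\<close> for \<open>n\<close> between 1 and
  \<open>CARD('n)\<close>, but is empty at \<open>n = 0\<close>; there the truncated subtraction
  gives \<open>time_pt 0 = time_pt 1\<close>.\<close>

definition first_times :: "nat \<Rightarrow> 'n::{finite,linorder} set" where
  "first_times n = time_pt ` {1..n}"

lemma first_times_0 [simp]: "first_times 0 = {}"
  by (simp add: first_times_def)

lemma first_times_Suc: "first_times (Suc n) = insert (time_pt (Suc n)) (first_times n)"
  by (simp add: first_times_def atLeastAtMostSuc_conv)

lemma first_times_mono: "m \<le> n \<Longrightarrow> first_times m \<subseteq> first_times n"
  by (auto simp: first_times_def)

lemma first_times_CARD: "first_times CARD('n) = (UNIV :: 'n::{finite,linorder} set)"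
  using bij_betw_time_pt[where 'n='n] by (simp add: first_times_def bij_betw_def)

lemma first_times_eq_atMost:
  assumes "1 \<le> n" "n \<le> CARD('n)"
  shows "first_times n = {..time_pt n :: 'n::{finite,linorder}}"
proof (intro set_eqI)
  fix x :: 'n
  obtain m where m: "m \<in> {1..CARD('n)}" "x = time_pt m"
    using bij_betw_time_pt[where 'n='n] by (metis bij_betw_def imageE UNIV_I)
  have "x \<in> first_times n \<longleftrightarrow> m \<le> n"
  proof
    assume "x \<in> first_times n"
    then obtain k where k: "k \<in> {1..n}" "x = time_pt k" by (auto simp: first_times_def)
    have "inj_on (time_pt :: nat \<Rightarrow> 'n) {1..CARD('n)}"
      using bij_betw_time_pt[where 'n='n] by (simp add: bij_betw_def)
    then have "k = m" using k m assms by (auto dest: inj_onD)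
    then show "m \<le> n" using k by simp
  qed (use m in \<open>auto simp: first_times_def\<close>)
  also have "m \<le> n \<longleftrightarrow> x \<le> time_pt n"
    using strict_mono_on_less_eq[OF strict_mono_on_time_pt[where 'n='n], of m n] m assms by simp
  finally show "x \<in> first_times n \<longleftrightarrow> x \<in> {..time_pt n}" by simp
qed

lemma time_pt_Suc_notin_first_times:
  assumes "Suc n \<le> CARD('n)"
  shows "time_pt (Suc n) \<notin> (first_times n :: 'n::{finite,linorder} set)"
proof
  assume "time_pt (Suc n) \<in> (first_times n :: 'n set)"
  then obtain k where k: "k \<in> {1..n}" "time_pt (Suc n) = (time_pt k :: 'n)" by (auto simp: first_times_def)
  have "inj_on (time_pt :: nat \<Rightarrow> 'n) {1..CARD('n)}"
    using bij_betw_time_pt[where 'n='n] by (simp add: bij_betw_def)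
  then have "Suc n = k" using k assms by (auto dest: inj_onD)
  then show False using k by simp
qed

lemma norm_vec_le_sum: "norm (x :: ('a::real_normed_vector, 'n::finite) vec) \<le> (\<Sum>i\<in>UNIV. norm (x $ i))"
  unfolding norm_vec_def by (rule L2_set_le_sum) simp

section \<open>Induction over time\<close>

context smoothing
begin

abbreviation "gap D i \<equiv> lpn p (density (\<mu> \<Otimes>\<^sub>M \<nu>) D) (\<lambda>(x, y). ennreal (norm (x $ i - y $ i)))"

text \<open>The cost at a time in \<open>A\<close> involves \<open>y\<close> only through
  \<open>seg A y\<close>, so later steps leave the earlier gaps unchanged.\<close>

lemma refines_gap:
  assumes "D \<in> borel_measurable (borel \<Otimes>\<^sub>M borel)" "D' \<in> borel_measurable (borel \<Otimes>\<^sub>M borel)"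
    and ref: "refines A D D'" and i: "i \<in> A"
  shows "gap D' i = gap D i"
proof -
  note [measurable] = assms(1,2)
  let ?c = "\<lambda>x y :: ('d, 'n) path. epowr (ennreal (norm (x $ i - y $ i))) p"
  have "(\<integral>\<^sup>+w. (case w of (x, y) \<Rightarrow> ?c x y) \<partial>density (\<mu> \<Otimes>\<^sub>M \<nu>) D') = (\<integral>\<^sup>+x. \<integral>\<^sup>+y. ?c x (seg A y) * D' (x, y) \<partial>\<nu> \<partial>\<mu>)"
    using i by (subst nn_integral_density_\<mu>\<nu>(1)) simp_all
  also have "\<dots> = (\<integral>\<^sup>+x. \<integral>\<^sup>+y. ?c x (seg A y) * D (x, y) \<partial>\<nu> \<partial>\<mu>)"
  proof (rule nn_integral_cong)
    fix x
    have "?c x \<in> borel_measurable borel" by measurable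
    then show "(\<integral>\<^sup>+y. ?c x (seg A y) * D' (x, y) \<partial>\<nu>) = (\<integral>\<^sup>+y. ?c x (seg A y) * D (x, y) \<partial>\<nu>)"
      using bspec[OF ref[unfolded refines_def], of "?c x"] by simp
  qed
  also have "\<dots> = (\<integral>\<^sup>+w. (case w of (x, y) \<Rightarrow> ?c x y) \<partial>density (\<mu> \<Otimes>\<^sub>M \<nu>) D)"
    using i by (subst nn_integral_density_\<mu>\<nu>(1)) simp_all
  finally show ?thesis by (simp add: lpn_def case_prod_unfold)
qed

text \<open>On \<open>A\<close>, \<open>X - X' = (X - Y) + \<sigma>Z\<close>. The first term is
  split into coordinates, while the noise is bounded by the norm of its full path and so is counted
  only once, whatever the size of \<open>A\<close>.\<close>

lemma pair_distance:
  assumes \<sigma>: "0 < \<sigma>" and adm: "admissible A D"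
  shows "lpn p (lift D) (\<lambda>(x, x', z). ennreal (norm (seg A x - seg A x'))) \<le>
    (\<Sum>i\<in>A. gap D i) + ennreal \<sigma> * lpn p \<xi> (\<lambda>z. ennreal (norm z))"
proof -
  have p0: "0 < p" using p by simp
  let ?g = "\<lambda>i (x, x', z). ennreal (norm (x $ i - (x' + \<sigma> *\<^sub>R z) $ i))"
  have "lpn p (lift D) (\<lambda>(x, x', z). ennreal (norm (seg A x - seg A x'))) \<le>
    lpn p (lift D) (\<lambda>w. (\<Sum>i\<in>A. ?g i w) + (case w of (x, x', z) \<Rightarrow> ennreal \<sigma> * ennreal (norm z)))"
  proof (rule lpn_mono[OF p0])
    fix w :: "('d, 'n) path \<times> ('d, 'n) path \<times> ('d, 'n) path"
    obtain x x' z where w: "w = (x, x', z)" by (rule prod_cases3)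
    have "norm (seg A x - seg A x') \<le> norm (seg A (x - (x' + \<sigma> *\<^sub>R z))) + norm (seg A (\<sigma> *\<^sub>R z))"
    proof -
      have "seg A x - seg A x' = seg A (x - (x' + \<sigma> *\<^sub>R z)) + seg A (\<sigma> *\<^sub>R z)" by (simp add: vec_eq_iff)
      then show ?thesis by (simp add: norm_triangle_ineq)
    qed
    also have "norm (seg A (\<sigma> *\<^sub>R z)) \<le> norm (\<sigma> *\<^sub>R z)"
      by (rule norm_le_componentwise_cart) simp
    also have "norm (\<sigma> *\<^sub>R z) = \<sigma> * norm z" using \<sigma> by simp
    also have "norm (seg A (x - (x' + \<sigma> *\<^sub>R z))) \<le> (\<Sum>i\<in>UNIV. norm (seg A (x - (x' + \<sigma> *\<^sub>R z)) $ i))"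
      by (rule norm_vec_le_sum)
    also have "\<dots> = (\<Sum>i\<in>A. norm (x $ i - (x' $ i + \<sigma> *\<^sub>R z $ i)))"
      by (rule sum.mono_neutral_cong_right) auto
    finally have "norm (seg A x - seg A x') \<le> (\<Sum>i\<in>A. norm (x $ i - (x' $ i + \<sigma> *\<^sub>R z $ i))) + \<sigma> * norm z" by simp
    then have "ennreal (norm (seg A x - seg A x')) \<le> ennreal ((\<Sum>i\<in>A. norm (x $ i - (x' $ i + \<sigma> *\<^sub>R z $ i))) + \<sigma> * norm z)"
      by (rule ennreal_leI)
    then show "(case w of (x, x', z) \<Rightarrow> ennreal (norm (seg A x - seg A x'))) \<le>
        (\<Sum>i\<in>A. ?g i w) + (case w of (x, x', z) \<Rightarrow> ennreal \<sigma> * ennreal (norm z))"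
      using \<sigma> by (simp add: w sum_nonneg sum_ennreal ennreal_mult)
  qed
  also have "\<dots> \<le> lpn p (lift D) (\<lambda>w. \<Sum>i\<in>A. ?g i w) + lpn p (lift D) (\<lambda>(x, x', z). ennreal \<sigma> * ennreal (norm z))"
    by (rule lpn_add_le[OF p]) measurable
  also have "lpn p (lift D) (\<lambda>(x, x', z). ennreal \<sigma> * ennreal (norm z)) = ennreal \<sigma> * lpn p \<xi> (\<lambda>z. ennreal (norm z))"
    by (subst lpn_lift(3)[OF adm]) (simp_all add: lpn_cmult p0)
  also have "lpn p (lift D) (\<lambda>w. \<Sum>i\<in>A. ?g i w) \<le> (\<Sum>i\<in>A. lpn p (lift D) (?g i))"
    by (rule lpn_sum_le[OF p]) (simp, measurable)
  also have "(\<Sum>i\<in>A. lpn p (lift D) (?g i)) = (\<Sum>i\<in>A. gap D i)"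
    using lpn_lift_pair[OF adm, of "\<lambda>(x, y). ennreal (norm (x $ i - y $ i))" for i]
    by (intro sum.cong) (simp_all add: case_prod_unfold)
  finally show ?thesis by (simp add: add_right_mono)
qed

text \<open>The densities of all earlier stages are remembered because bicausality at time
  \<open>s\<close> is a comparison with the stage \<open>s\<close>. Finiteness of all
  \<open>h\<close> allows strict comparisons of real numbers, for which \<open>\<theta> > 1\<close>
  leaves room.\<close>

lemma construction:
  fixes \<theta> C :: real
  assumes \<sigma>: "0 < \<sigma>" and moment: "(\<integral>\<^sup>+x. ennreal (norm x powr p) \<partial>\<mu>) < \<top>"
    and \<theta>: "1 < \<theta>" and C: "1 \<le> C" "lpn p \<xi> (\<lambda>z. ennreal (norm z)) \<le> ennreal C"
    and fin: "\<And>s. s < CARD('n) \<Longrightarrow> h_mod p \<mu> \<sigma> s \<noteq> \<top>" and n: "n \<le> CARD('n)"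
  shows "\<exists>D. admissible (first_times n) D \<and>
     (\<forall>s. 1 \<le> s \<and> s \<le> n \<longrightarrow> (\<exists>E. admissible (first_times s) E \<and> refines (first_times s) E D)) \<and>
     (\<Sum>i\<in>first_times n. gap D i) \<le> ennreal (\<theta> * n * C) * (\<Sum>s\<in>{0..<n}. h_mod p \<mu> \<sigma> s)"
  using n
proof (induction n)
  case 0
  have "admissible {} (\<lambda>_. 1)"
    using \<nu>.emeasure_space_1 by (simp add: admissible_def)
  then show ?case by (intro exI[of _ "\<lambda>_. 1"]) simp
next
  case (Suc n)
  let ?h = "h_mod p \<mu> \<sigma>"
  define H where "H = (\<Sum>s\<in>{0..<n}. ?h s)"
  \<comment> \<open>Makes noise and selection error together equal to
    \<open>\<theta> * C * \<sigma>\<close>.\<close>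
  define \<epsilon> where "\<epsilon> = (\<theta> - 1) * C * \<sigma>"
  have \<epsilon>: "0 < \<epsilon>" using \<theta> C \<sigma> by (simp add: \<epsilon>_def)
  have p0: "0 < p" using p by simp
  have "n \<le> CARD('n)" using Suc.prems by simp
  from Suc.IH[OF this, folded H_def] obtain D where adm: "admissible (first_times n) D"
    and chain: "\<forall>s. 1 \<le> s \<and> s \<le> n \<longrightarrow> (\<exists>E. admissible (first_times s) E \<and> refines (first_times s) E D)"
    and S: "(\<Sum>i\<in>first_times n. gap D i) \<le> ennreal (\<theta> * n * C) * H"
    by (elim exE conjE) (rule that)
  define i where "i = (time_pt (Suc n) :: 'n)"
  have i: "i \<notin> first_times n" using time_pt_Suc_notin_first_times Suc.prems by (simp add: i_def)
  have H: "H \<noteq> \<top>" using fin Suc.prems by (simp add: H_def)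
  have hn: "?h n \<noteq> \<top>" using fin Suc.prems by simp
  have step: "\<exists>D'. admissible (insert i (first_times n)) D' \<and> refines (first_times n) D D' \<and>
    gap D' i \<le> ennreal (\<theta> * Suc n * C) * ?h n + ennreal (\<theta> * C) * H"
  proof (cases "n = 0")
    case True
    define \<kappa> where "\<kappa> = (\<lambda>_ :: ('d, 'n) path. distr \<mu> borel (\<lambda>x. x $ i))"
    have "is_kernel \<mu> (first_times n) i \<kappa>"
      unfolding \<kappa>_def using True is_kernel_empty[OF prob_\<mu> sets_\<mu>] by simp
    from exists_step[OF \<sigma> moment this adm \<epsilon>] obtain D' W
      where D': "admissible (insert i (first_times n)) D'" "refines (first_times n) D D'"
        and W: "\<And>x x'. W (x, x') \<le> wasserstein p (\<kappa> (seg (first_times n) x)) (\<kappa> (seg (first_times n) x'))"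
        and le: "gap D' i \<le> lpn p (lift D) (\<lambda>(x, x', z). W (x, x')) + ennreal \<sigma> * lpn p \<xi> (\<lambda>z. ennreal (norm z)) + ennreal \<epsilon>"
      by blast
    \<comment> \<open>With an empty past both kernels are the same law, so the first step pays only
      for the noise and the error.\<close>
    have "W (x, x') = 0" for x x'
      using W[of x x'] wasserstein_self[of "distr \<mu> borel (\<lambda>x. x $ i)" p] by (simp add: \<kappa>_def)
    then have "gap D' i \<le> ennreal \<sigma> * lpn p \<xi> (\<lambda>z. ennreal (norm z)) + ennreal \<epsilon>"
      using le by (simp add: case_prod_unfold)
    also have "\<dots> \<le> ennreal \<sigma> * ennreal C + ennreal \<epsilon>"
      by (intro add_right_mono mult_left_mono C) simp
    also have "\<dots> = ennreal (\<theta> * Suc n * C) * ?h n"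
    proof -
      have "\<sigma> * C + \<epsilon> = \<theta> * Suc n * C * \<sigma>" using True by (simp add: \<epsilon>_def algebra_simps)
      then show ?thesis
        using True \<sigma> C \<theta> \<epsilon> by (simp add: h_mod.simps[of p \<mu> \<sigma> 0] flip: ennreal_mult ennreal_plus)
    qed
    finally have "gap D' i \<le> ennreal (\<theta> * Suc n * C) * ?h n + ennreal (\<theta> * C) * H"
      by (rule order_trans) simp
    with D' show ?thesis by blast
  next
    case False
    then have n1: "1 \<le> n" by simp
    have tn: "first_times n = {..time_pt n :: 'n}" using first_times_eq_atMost[where 'n='n, OF n1] Suc.prems by simp
    have "is_kernel \<mu> (first_times n) i (cond_law \<mu> n)"
      using is_kernel_cond_law[OF prob_\<mu> sets_\<mu>, of n] by (simp add: tn i_def)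
    from exists_step[OF \<sigma> moment this adm \<epsilon>] obtain D' W
      where D': "admissible (insert i (first_times n)) D'" "refines (first_times n) D D'"
        and Wm[measurable]: "W \<in> borel_measurable (borel \<Otimes>\<^sub>M borel)"
        and W: "\<And>x x'. W (x, x') \<le> wasserstein p (cond_law \<mu> n (seg (first_times n) x)) (cond_law \<mu> n (seg (first_times n) x'))"
        and le: "gap D' i \<le> lpn p (lift D) (\<lambda>(x, x', z). W (x, x')) + ennreal \<sigma> * lpn p \<xi> (\<lambda>z. ennreal (norm z)) + ennreal \<epsilon>"
      by blast
    obtain H' where H': "H = ennreal H'" "0 \<le> H'" using H by (cases H) auto
    have "ennreal \<sigma> = ?h 0" by (simp add: h_mod.simps)
    also have "\<dots> \<le> H" unfolding H_def using n1 by (intro member_le_sum) auto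
    finally have \<sigma>H: "\<sigma> \<le> H'" using H' \<sigma> by (simp add: ennreal_le_iff)
    \<comment> \<open>The factor pulled out of the modulus: \<open>\<theta> * n * C\<close> bounds
      the gaps so far relative to \<open>H\<close>, and one more \<open>\<theta> * C\<close>
      accounts for the noise.\<close>
    define c where "c = \<theta> * Suc n * C"
    have "1 \<le> \<theta> * real (Suc n)" using \<theta> mult_mono[of 1 \<theta> 1 "real (Suc n)"] by simp
    then have c1: "1 \<le> c" unfolding c_def using C mult_mono[of 1 "\<theta> * real (Suc n)" 1 C] by simp
    define \<pi> where "\<pi> = distr (lift D) (borel \<Otimes>\<^sub>M borel) (\<lambda>(x, x', z). (x, x'))"
    have \<pi>: "\<pi> \<in> couplings \<mu> \<mu>" unfolding \<pi>_def by (rule lift_coupling[OF adm])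
    have lpn_\<pi>: "lpn p \<pi> f = lpn p (lift D) (\<lambda>(x, x', z). f (x, x'))"
      if [measurable]: "f \<in> borel_measurable (borel \<Otimes>\<^sub>M borel)" for f
      unfolding \<pi>_def by (subst lpn_distr) (simp_all add: case_prod_unfold)
    have [measurable]: "init_seg n \<in> borel_measurable (borel :: ('d, 'n) path measure)"
      unfolding init_seg_eq_seg by measurable
    have "lpn p \<pi> (\<lambda>(x, y). ennreal (norm (init_seg n x - init_seg n y))) =
       lpn p (lift D) (\<lambda>(x, x', z). ennreal (norm (seg (first_times n) x - seg (first_times n) x')))"
      by (subst lpn_\<pi>) (simp_all add: init_seg_eq_seg tn)
    also have "\<dots> \<le> ennreal (\<theta> * n * C) * H + ennreal \<sigma> * ennreal C"
      by (intro order_trans[OF pair_distance[OF \<sigma> adm]] add_mono S mult_left_mono C) simp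
    also have "\<dots> = ennreal (\<theta> * n * C * H' + \<sigma> * C)"
      using \<theta> C \<sigma> H' by (simp flip: ennreal_mult ennreal_plus)
    \<comment> \<open>Strictness, which the supremum in \<open>modulus\<close> demands, comes from
      \<open>\<sigma> < \<theta> * \<sigma> \<le> \<theta> * H'\<close>.\<close>
    also have "\<dots> < ennreal c * H"
    proof -
      have "\<sigma> < \<theta> * \<sigma>" using \<theta> \<sigma> by simp
      also have "\<dots> \<le> \<theta> * H'" using \<theta> \<sigma>H by simp
      finally have "\<sigma> < \<theta> * H'" .
      then have "\<sigma> * C < \<theta> * H' * C" using C by simp
      then have "\<theta> * n * C * H' + \<sigma> * C < c * H'" by (simp add: c_def algebra_simps)
      moreover have "0 \<le> \<theta> * n * C * H' + \<sigma> * C" using \<theta> C \<sigma> H' by simp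
      ultimately show ?thesis using c1 H' by (simp add: ennreal_less_iff flip: ennreal_mult)
    qed
    finally have "lpn p \<pi> W \<le> ennreal c * modulus p \<mu> n H"
      using W by (intro modulus_scaling[OF p prob_\<mu> \<pi> c1 Wm]) (simp_all add: init_seg_eq_seg tn)
    also have "modulus p \<mu> n H = ?h n" using False by (simp add: H_def h_mod.simps[of p \<mu> \<sigma> n])
    finally have "gap D' i \<le> ennreal c * ?h n + ennreal \<sigma> * ennreal C + ennreal \<epsilon>"
      unfolding lpn_\<pi>[OF Wm]
      by (intro order_trans[OF le] add_mono mult_left_mono C) simp_all
    also have "ennreal c * ?h n + ennreal \<sigma> * ennreal C + ennreal \<epsilon> = ennreal c * ?h n + ennreal (\<theta> * C * \<sigma>)"
    proof -
      have "\<sigma> * C + \<epsilon> = \<theta> * C * \<sigma>" by (simp add: \<epsilon>_def algebra_simps)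
      then show ?thesis using \<sigma> C \<epsilon> by (simp add: add.assoc flip: ennreal_mult ennreal_plus)
    qed
    also have "\<dots> \<le> ennreal c * ?h n + ennreal (\<theta> * C) * H"
      using \<sigma>H H' C \<theta> \<sigma> by (intro add_left_mono) (simp add: ennreal_leI mult_left_mono flip: ennreal_mult)
    finally show ?thesis using D' unfolding c_def by blast
  qed
  then obtain D' where D': "admissible (insert i (first_times n)) D'" "refines (first_times n) D D'"
    and g: "gap D' i \<le> ennreal (\<theta> * Suc n * C) * ?h n + ennreal (\<theta> * C) * H" by blast
  have ts: "first_times (Suc n) = insert i (first_times n)" by (simp add: first_times_Suc i_def)
  have "(\<Sum>j\<in>first_times (Suc n). gap D' j) = gap D' i + (\<Sum>j\<in>first_times n. gap D' j)"
    unfolding ts using i by (intro sum.insert) auto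
  also have "(\<Sum>j\<in>first_times n. gap D' j) = (\<Sum>j\<in>first_times n. gap D j)"
    using adm D' by (intro sum.cong refl refines_gap[OF _ _ D'(2)]) (auto simp: admissible_def)
  also have "gap D' i + \<dots> \<le> ennreal (\<theta> * Suc n * C) * ?h n + ennreal (\<theta> * C) * H + ennreal (\<theta> * n * C) * H"
    by (intro add_mono g S)
  also have "\<dots> = ennreal (\<theta> * Suc n * C) * (\<Sum>s\<in>{0..<Suc n}. ?h s)"
  proof -
    have "ennreal (\<theta> * Suc n * C) = ennreal (\<theta> * C) + ennreal (\<theta> * n * C)"
      using \<theta> C by (simp add: algebra_simps flip: ennreal_plus)
    then show ?thesis by (simp add: H_def distrib_left distrib_right ac_simps)
  qed
  finally have sum: "(\<Sum>j\<in>first_times (Suc n). gap D' j) \<le> ennreal (\<theta> * Suc n * C) * (\<Sum>s\<in>{0..<Suc n}. ?h s)" .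
  \<comment> \<open>The last stage is its own witness; earlier witnesses survive because
    \<open>D'\<close> refines \<open>D\<close> on a larger set of times.\<close>
  have "\<exists>E. admissible (first_times s) E \<and> refines (first_times s) E D'" if s: "1 \<le> s" "s \<le> Suc n" for s
  proof (cases "s = Suc n")
    case True
    then show ?thesis using D'(1) refines_refl ts by metis
  next
    case False
    then obtain E where "admissible (first_times s) E" "refines (first_times s) E D" using chain s by (meson le_SucE)
    then show ?thesis using refines_trans[OF _ D'(2) first_times_mono[of s n]] s False by auto
  qed
  with D'(1) sum show ?case unfolding ts[symmetric] by blast
qed

text \<open>The root of the total cost is at most the sum of the roots over the times: Minkowski's
  inequality in the time index.\<close>

lemma adapted_wasserstein_le_gaps:
  assumes adm: "admissible UNIV D"
    and ref: "\<And>t. 1 \<le> t \<Longrightarrow> t < CARD('n) \<Longrightarrow> \<exists>E. admissible {..time_pt t} E \<and> refines {..time_pt t} E D"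
  shows "adapted_wasserstein p \<mu> \<nu> \<le> (\<Sum>i\<in>UNIV. gap D i)"
proof -
  have p0: "0 < p" using p by simp
  let ?\<pi> = "density (\<mu> \<Otimes>\<^sub>M \<nu>) D"
  have "adapted_wasserstein p \<mu> \<nu> \<le>
    epowr (\<integral>\<^sup>+(x, y). (\<Sum>i\<in>UNIV. ennreal (norm (x $ i - y $ i) powr p)) \<partial>?\<pi>) (1 / p)"
    unfolding adapted_wasserstein_def
    using p0 by (intro epowr_mono INF_lower bicausal_density[OF adm ref]) auto
  also have "(\<integral>\<^sup>+(x, y). (\<Sum>i\<in>UNIV. ennreal (norm (x $ i - y $ i) powr p)) \<partial>?\<pi>) =
    (\<Sum>i\<in>UNIV. \<integral>\<^sup>+(x, y). ennreal (norm (x $ i - y $ i) powr p) \<partial>?\<pi>)"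
    unfolding case_prod_unfold by (rule nn_integral_sum) measurable
  also have "epowr \<dots> (1 / p) \<le> (\<Sum>i\<in>UNIV. gap D i)"
    by (rule order_trans[OF epowr_sum_le[OF p]]) (simp_all add: lpn_def epowr_norm case_prod_unfold)
  finally show ?thesis .
qed

end

theorem theorem26:
  fixes p \<sigma> :: real
    and \<mu> \<xi> :: "('d::finite, 'n::{finite,linorder}) path measure"
    and f :: "('d, 'n) path \<Rightarrow> real"
  assumes p: "1 \<le> p"
    and \<xi>: "\<xi> \<in> prob_moment p"
    and density: "\<And>x. 0 \<le> f x" "\<xi> = density lborel (\<lambda>x. ennreal (f x))"
    and C1: "\<exists>g. (\<forall>x. GDERIV f x :> g x) \<and> continuous_on UNIV g \<and> integrable lborel g"
    and zeros: "{s. fourier f s = 0} \<in> null_sets lebesgue"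
    and \<mu>: "\<mu> \<in> prob_moment p"
    and \<sigma>: "0 < \<sigma>"
  shows "adapted_wasserstein p \<mu> (smoothed \<mu> \<xi> \<sigma>)
    \<le> of_nat CARD('n) * max 1 (epowr (moment p \<xi>) (1 / p)) * (\<Sum>t = 0..CARD('n) - 1. h_mod p \<mu> \<sigma> t)"
proof -
  interpret smoothing p \<sigma> \<mu> \<xi>
    using p \<mu> \<xi> by (intro smoothing.intro) (simp_all add: prob_moment_def)
  let ?T = "CARD('n)" and ?h = "h_mod p \<mu> \<sigma>"
  have T: "0 < ?T" by simp
  define m where "m = epowr (moment p \<xi>) (1 / p)"
  have m: "lpn p \<xi> (\<lambda>z. ennreal (norm z)) = m" by (simp add: m_def lpn_def moment_def epowr_norm)
  have "m \<noteq> \<top>" using \<xi> by (auto simp: m_def prob_moment_def)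
  then have "max 1 m \<noteq> \<top>" by (simp add: max_def)
  then obtain C where C: "max 1 m = ennreal C" "0 \<le> C" by (cases "max 1 m") auto
  have C1: "1 \<le> C" using C by (metis ennreal_1 ennreal_le_iff max.cobounded1)
  define H where "H = (\<Sum>t\<in>{0..<?T}. ?h t)"
  have Heq: "(\<Sum>t = 0..?T - 1. ?h t) = H"
    unfolding H_def
    by (simp only: One_nat_def Suc_pred[OF T] flip: atLeastLessThanSuc_atLeastAtMost)
  have goal: "adapted_wasserstein p \<mu> \<nu> \<le> of_nat ?T * ennreal C * H"
  \<comment> \<open>If some \<open>h\<close> is infinite the right-hand side is
    \<open>\<top>\<close>, since \<open>C \<ge> 1\<close> and there is at least one time.\<close>
  proof (cases "H = \<top>")
    case True
    then show ?thesis using C1 by (simp add: ennreal_mult_top)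
  next
    case False
    then have fin: "?h s \<noteq> \<top>" if "s < ?T" for s using that by (auto simp: H_def)
    obtain H' where H': "H = ennreal H'" "0 \<le> H'" using False by (cases H) auto
    define x where "x = ?T * C * H'"
    have x: "0 \<le> x" using C H' by (simp add: x_def)
    have le: "adapted_wasserstein p \<mu> \<nu> \<le> ennreal (\<theta> * x)" if \<theta>: "1 < \<theta>" for \<theta>
    proof -
      have m': "lpn p \<xi> (\<lambda>z. ennreal (norm z)) \<le> ennreal C" unfolding m C(1)[symmetric] by simp
      have mom: "(\<integral>\<^sup>+x. ennreal (norm x powr p) \<partial>\<mu>) < \<top>"
        using \<mu> by (simp add: prob_moment_def moment_def)
      have "\<exists>D. admissible (first_times ?T) D \<and>
          (\<forall>s. 1 \<le> s \<and> s \<le> ?T \<longrightarrow> (\<exists>E. admissible (first_times s) E \<and> refines (first_times s) E D)) \<and>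
          (\<Sum>i\<in>first_times ?T. gap D i) \<le> ennreal (\<theta> * ?T * C) * H"
        unfolding H_def by (rule construction[OF \<sigma> mom \<theta> C1 m' _ order_refl]) (rule fin)
      then obtain D where adm: "admissible (first_times ?T) D"
        and chain: "\<forall>s. 1 \<le> s \<and> s \<le> ?T \<longrightarrow> (\<exists>E. admissible (first_times s) E \<and> refines (first_times s) E D)"
        and g: "(\<Sum>i\<in>first_times ?T. gap D i) \<le> ennreal (\<theta> * ?T * C) * H"
        by (elim exE conjE) (rule that)
      have "adapted_wasserstein p \<mu> \<nu> \<le> (\<Sum>i\<in>UNIV. gap D i)"
      proof (rule adapted_wasserstein_le_gaps)
        show "admissible UNIV D" using adm by (simp add: first_times_CARD)
        show "\<exists>E. admissible {..time_pt t} E \<and> refines {..time_pt t} E D" if "1 \<le> t" "t < ?T" for t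
          using spec[OF chain, of t] first_times_eq_atMost[of t, where 'n='n] that by simp
      qed
      also have "\<dots> \<le> ennreal (\<theta> * ?T * C) * H" using g by (simp add: first_times_CARD)
      also have "\<dots> = ennreal (\<theta> * x)"
        using \<theta> C H' by (simp add: x_def mult.assoc flip: ennreal_mult)
      finally show ?thesis .
    qed
    have "adapted_wasserstein p \<mu> \<nu> \<le> ennreal x"
    proof (rule ennreal_le_epsilon)
      fix e :: real assume e: "0 < e"
      \<comment> \<open>Here \<open>\<theta>\<close> is \<open>1 + e / (x + 1)\<close>; the
        denominator \<open>x + 1\<close> also covers \<open>x = 0\<close>.\<close>
      have "(1 + e / (x + 1)) * x \<le> x + e"
      proof -
        have "e * x / (x + 1) \<le> e" using x e by (simp add: field_simps)
        then show ?thesis by (simp add: distrib_right)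
      qed
      then have "ennreal ((1 + e / (x + 1)) * x) \<le> ennreal x + ennreal e"
        using x e by (simp add: ennreal_leI flip: ennreal_plus)
      moreover have "1 < 1 + e / (x + 1)" using x e by simp
      ultimately show "adapted_wasserstein p \<mu> \<nu> \<le> ennreal x + ennreal e"
        using le order_trans by blast
    qed
    also have "ennreal x = of_nat ?T * ennreal C * H"
      using C H' by (simp add: x_def ennreal_mult ennreal_of_nat_eq_real_of_nat)
    finally show ?thesis .
  qed
  then show ?thesis unfolding Heq C(1)[symmetric] m_def .
qed

end
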